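(* Let $n,m\in\mathbb{R}$, $R>0$, $0<\epsilon\le1$, and let $k\ge1$ be an integer. Let $\phi_0$ satisfy $$\|\phi_0-1\|_{H^k}<R,\qquad \Big\|\frac1{\phi_0}\Big\|_\infty\le\frac1{2\epsilon}.$$ Then there exist $T>0$, depending on $R$, $\epsilon$ and $R-\|\phi_0-1\|_{H^k}$ (for fixed $n,m,k$), and $\phi$ with $\phi-1\in C^1([0,T);H^k(\mathbb{R}))$ such that, for $t\in[0,T)$, $$\phi(\cdot,t)=\phi_0+\int_0^t\phi(\cdot,s)^m u(\cdot,s)\,ds,\qquad -(\phi(\cdot,t)^n u(\cdot,t)_z)_z+\phi(\cdot,t)^m u(\cdot,t)=-(\phi(\cdot,t)^n)_z .$$ This is a local solution of $\phi_t+(\phi^n)_z-(\phi^n(\phi^{-m}\phi_t)_z)_z=0$ such that $\phi(\cdot,t)\ge\epsilon$ and $\|\phi(\cdot,t)-1\|_{H^k}\le R$ for $t<T$. Moreover, there is a maximal time of existence $T_{\max}>0$ such that if $T_{\max}<\infty$, then $$\lim_{t\to T_{\max}}\left(\|\phi(\cdot,t)-1\|_{H^k}+\Big\|\frac1{\phi(\cdot,t)}\Big\|_\infty\right)=\infty .$$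
   Context: $H^k=W^{k,2}(\mathbb{R})$; functions are real valued, of $z\in\mathbb{R}$. For $\phi$ bounded and bounded below by a positive constant, $u(\cdot,t)\in H^1(\mathbb{R})$ denotes the unique weak solution of the elliptic equation $-(\phi^n u_z)_z+\phi^m u=-(\phi^n)_z$. A local solution of the equation with data $\phi_0$ on a time interval is a function $\phi>0$, with $\phi-1$ a $C^1$ function of time into $H^k(\mathbb{R})$, satisfying the integral equation displayed in the claim. *)

theory Defs
  imports "HOL-Analysis.Analysis" "HOL-Probability.Essential_Supremum"
begin

section \<open>The Sobolev spaces $W^{k,2}$ on the real line\<close>

text \<open>
  Elements of $L^2$ and $H^k$ are represented by Borel functions. All predicates and norms of this
  section are invariant under modification of the represented function on a (Borel) null set.
\<close>

definition L2 :: "(real \<Rightarrow> real) \<Rightarrow> bool" where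
  "L2 f \<longleftrightarrow> f \<in> borel_measurable lborel \<and> integrable lborel (\<lambda>z. (f z)\<^sup>2)"

definition test_function :: "(real \<Rightarrow> real) \<Rightarrow> bool" where
  "test_function \<psi> \<longleftrightarrow>
     (\<forall>j. (deriv ^^ j) \<psi> differentiable_on UNIV) \<and> compact (closure {z. \<psi> z \<noteq> 0})"

definition weak_derivative :: "nat \<Rightarrow> (real \<Rightarrow> real) \<Rightarrow> (real \<Rightarrow> real) \<Rightarrow> bool" where
  "weak_derivative j f g \<longleftrightarrow>
     (\<forall>\<psi>. test_function \<psi> \<longrightarrow>
        (LINT z|lborel. f z * (deriv ^^ j) \<psi> z) = (-1) ^ j * (LINT z|lborel. g z * \<psi> z))"

definition Hk :: "nat \<Rightarrow> (real \<Rightarrow> real) \<Rightarrow> bool" where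
  "Hk k f \<longleftrightarrow> L2 f \<and> (\<forall>j\<le>k. \<exists>g. L2 g \<and> weak_derivative j f g)"

text \<open>A representative of the weak derivative; it is determined up to null sets. It is
  only meaningful for functions that have a square integrable weak derivative of order \<open>j\<close>.\<close>

definition weak_D :: "nat \<Rightarrow> (real \<Rightarrow> real) \<Rightarrow> real \<Rightarrow> real" where
  "weak_D j f = (SOME g. L2 g \<and> weak_derivative j f g)"

definition Hk_norm :: "nat \<Rightarrow> (real \<Rightarrow> real) \<Rightarrow> real" where
  "Hk_norm k f = sqrt (\<Sum>j\<le>k. LINT z|lborel. (weak_D j f z)\<^sup>2)"

text \<open>The $L^\infty$ norm is taken for extended real valued functions, so that $1/\phi$ takes the
  value \<open>\<infinity>\<close> (and not \<open>0\<close>) where \<open>\<phi>\<close> vanishes.\<close>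

definition Linf_norm :: "(real \<Rightarrow> ereal) \<Rightarrow> ereal" where
  "Linf_norm g = esssup lborel (\<lambda>z. \<bar>g z\<bar>)"

abbreviation recip_norm :: "(real \<Rightarrow> real) \<Rightarrow> ereal" where
  "recip_norm \<phi> \<equiv> Linf_norm (\<lambda>z. 1 / ereal (\<phi> z))"


section \<open>Functions of time with values in $H^k$\<close>

text \<open>The half-open time interval $[0,T)$, where \<open>T\<close> may be infinite.\<close>

definition time_interval :: "ereal \<Rightarrow> real set" where
  "time_interval T = {t. 0 \<le> t \<and> ereal t < T}"

text \<open>\<open>f'\<close> is the derivative of \<open>f\<close> with respect to time, as a limit of difference quotients in the
  norm of $H^k$ (one-sided at time \<open>0\<close>), and it is continuous in the norm of $H^k$.\<close>

definition C1_Hk_derivative ::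
    "nat \<Rightarrow> ereal \<Rightarrow> (real \<Rightarrow> real \<Rightarrow> real) \<Rightarrow> (real \<Rightarrow> real \<Rightarrow> real) \<Rightarrow> bool" where
  "C1_Hk_derivative k T f f' \<longleftrightarrow>
     (\<forall>t\<in>time_interval T.
        Hk k (f t) \<and> Hk k (f' t) \<and>
        ((\<lambda>s. Hk_norm k (\<lambda>z. (f s z - f t z) / (s - t) - f' t z)) \<longlongrightarrow> 0)
          (at t within time_interval T) \<and>
        ((\<lambda>s. Hk_norm k (\<lambda>z. f' s z - f' t z)) \<longlongrightarrow> 0) (at t within time_interval T))"

definition C1_Hk :: "nat \<Rightarrow> ereal \<Rightarrow> (real \<Rightarrow> real \<Rightarrow> real) \<Rightarrow> bool" where
  "C1_Hk k T f \<longleftrightarrow> (\<exists>f'. C1_Hk_derivative k T f f')"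


section \<open>The equation\<close>

text \<open>
  \<open>u\<close> is a weak solution in $H^1$ of $-(\phi^n u_z)_z + \phi^m u = -(\phi^n)_z$. Since
  $\phi^n$ itself is not integrable on the line, the equation is tested with compactly supported
  smooth functions, so that each term below is integrable when \<open>\<phi>\<close> is bounded and bounded below
  by a positive constant.
\<close>

definition elliptic_weak_solution ::
    "real \<Rightarrow> real \<Rightarrow> (real \<Rightarrow> real) \<Rightarrow> (real \<Rightarrow> real) \<Rightarrow> bool" where
  "elliptic_weak_solution n m \<phi> u \<longleftrightarrow>
     Hk 1 u \<and>
     (\<forall>\<psi>. test_function \<psi> \<longrightarrow>
        (LINT z|lborel. \<phi> z powr n * weak_D 1 u z * deriv \<psi> z + \<phi> z powr m * u z * \<psi> z)
          = (LINT z|lborel. \<phi> z powr n * deriv \<psi> z))"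

text \<open>
  For \<open>k \<ge> 1\<close> the functions $\phi(\cdot,t)$ and $u(\cdot,t)$ have continuous representatives, and a
  solution consists of these. The initial datum \<open>\<phi>0\<close> may be any representative of its class,
  which is why the integral equation is required for almost every \<open>z\<close> only. Note that positivity
  of the continuous function $\phi(\cdot,t)$, together with $\phi(\cdot,t)-1 \in H^k$, makes
  $\phi(\cdot,t)$ bounded and bounded below by a positive constant.
\<close>

definition local_solution ::
    "real \<Rightarrow> real \<Rightarrow> nat \<Rightarrow> (real \<Rightarrow> real) \<Rightarrow> ereal \<Rightarrow> (real \<Rightarrow> real \<Rightarrow> real) \<Rightarrow> bool" where
  "local_solution n m k \<phi>0 T \<phi> \<longleftrightarrow>
     (\<forall>t\<in>time_interval T. continuous_on UNIV (\<phi> t) \<and> (\<forall>z. \<phi> t z > 0)) \<and>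
     C1_Hk k T (\<lambda>t z. \<phi> t z - 1) \<and>
     (\<exists>u. \<forall>t\<in>time_interval T.
        continuous_on UNIV (u t) \<and>
        elliptic_weak_solution n m (\<phi> t) (u t) \<and>
        (AE z in lborel. ((\<lambda>s. \<phi> s z powr m * u s z) has_integral (\<phi> t z - \<phi>0 z)) {0..t}))"

text \<open>
  The equation $\phi_t + (\phi^n)_z - (\phi^n (\phi^{-m}\phi_t)_z)_z = 0$, where $\phi_t$ is
  the derivative of $\phi - 1$ as a function of time into $H^k$, the function $\phi^{-m}\phi_t$
  lies in $H^1$, and the outer derivatives with respect to \<open>z\<close> are distributional.
\<close>

definition solves_evolution_equation ::
    "real \<Rightarrow> real \<Rightarrow> nat \<Rightarrow> ereal \<Rightarrow> (real \<Rightarrow> real \<Rightarrow> real) \<Rightarrow> bool" where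
  "solves_evolution_equation n m k T \<phi> \<longleftrightarrow>
     (\<exists>\<phi>t. C1_Hk_derivative k T (\<lambda>t z. \<phi> t z - 1) \<phi>t \<and>
        (\<forall>t\<in>time_interval T.
           Hk 1 (\<lambda>z. \<phi> t z powr (- m) * \<phi>t t z) \<and>
           (\<forall>\<psi>. test_function \<psi> \<longrightarrow>
              (LINT z|lborel. \<phi>t t z * \<psi> z - \<phi> t z powr n * deriv \<psi> z
                 + \<phi> t z powr n * weak_D 1 (\<lambda>y. \<phi> t y powr (- m) * \<phi>t t y) z * deriv \<psi> z)
              = 0)))"

text \<open>\<open>Tmax\<close> is the maximal time of existence for the initial datum \<open>\<phi>0\<close>, and it is attained by the
  solution \<open>\<phi>\<close>.\<close>

definition maximal_solution ::
    "real \<Rightarrow> real \<Rightarrow> nat \<Rightarrow> (real \<Rightarrow> real) \<Rightarrow> ereal \<Rightarrow> (real \<Rightarrow> real \<Rightarrow> real) \<Rightarrow> bool" where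
  "maximal_solution n m k \<phi>0 Tmax \<phi> \<longleftrightarrow>
     local_solution n m k \<phi>0 Tmax \<phi> \<and>
     (\<forall>T \<phi>'. local_solution n m k \<phi>0 T \<phi>' \<longrightarrow> T \<le> Tmax)"

end

theory Submission
  imports Defs
begin

text \<open>
  With \<open>a = \<phi>\<^sup>-\<^sup>n\<close>, \<open>b = \<phi>\<^sup>m\<close> and the flux \<open>v = \<phi>\<^sup>n (u\<^sub>z - 1) + 1\<close> the elliptic equation becomes the first order
  system \<open>u' = a v + 1 - a\<close>, \<open>v' = b u\<close>, whose right-hand side contains no derivatives. Integrating
  \<open>(u v)'\<close> over the line gives the \<open>L\<^sup>2\<close> estimate for it, a contraction argument starting from constant
  coefficients gives solvability, and differentiating the system lifts both to \<open>H\<^sup>k\<close>. Together with the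
  product and chain rules this makes \<open>\<phi> \<mapsto> \<phi>\<^sup>m u\<close> a locally Lipschitz vector velocity on the open set
  of positive \<open>\<phi> \<in> 1 + H\<^sup>k\<close>, bounded and Lipschitz on \<open>{\<parallel>\<phi> - 1\<parallel> \<le> r, \<phi> \<ge> \<delta>}\<close>, and the claim is the
  Cauchy--Lipschitz theorem with its blow-up alternative. To have a single Banach space for all \<open>k\<close>,
  \<open>H\<^sup>k\<close> is identified with \<open>L\<^sup>2\<close> through \<open>(1 + d/dz)\<^sup>k\<close>.
\<close>

section \<open>Test functions and the fundamental lemma of the calculus of variations\<close>

text \<open>The system form is dictated by regularity: \<phi> has only k derivatives, and expanding
  the divergence in the elliptic equation would put the derivative of \<phi>^n into the
  coefficients. The limit \<phi> = 1 at infinity shapes much of the rest: powers of \<phi> are not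
  in L^2, so \<open>(1 + f) powr p - 1\<close> is what gets estimated, and pointwise positivity
  amounts to a positive infimum. Maximality refers to all local solutions in the sense of the
  definition, whose u is any continuous weak solution and whose integral equation holds for almost
  every z. Hence the translation into an ordinary differential equation has to work in both
  directions, and the elliptic problem has to be uniquely solvable. The identification of H^k with
  L^2 is not isometric, whereas R refers to the original norm; the local existence time therefore
  comes from balls so small that the change of norm and infimum is controlled by the gap to R and by
  \<epsilon>. Blow-up is a limit and not just a limit superior because the time of existence is
  bounded below on every set with bounded norm and infimum bounded away from 0.\<close>

definition smooth :: "(real \<Rightarrow> real) \<Rightarrow> bool" where
  "smooth f \<longleftrightarrow> (\<forall>j. (deriv ^^ j) f differentiable_on UNIV)"

text \<open>Spares a formula for the j-th derivative: it is enough to exhibit a class of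
  differentiable functions that \<open>deriv\<close> maps into itself. Below these are sums of
  products, affine substitutions, and functions P(1/x) exp(-1/x).\<close>

lemma smooth_coinduct:
  assumes "f \<in> S" and "\<And>g. g \<in> S \<Longrightarrow> g differentiable_on UNIV \<and> deriv g \<in> S"
  shows "smooth f"
proof -
  have "(deriv ^^ j) f \<in> S" for j
    by (induction j) (use assms in auto)
  then show ?thesis using assms unfolding smooth_def by blast
qed

lemma smooth_DERIV: "smooth f \<Longrightarrow> (f has_real_derivative deriv f x) (at x)"
  unfolding smooth_def
  by (metis DERIV_deriv_iff_real_differentiable UNIV_I differentiable_on_def funpow_0)

lemma smooth_deriv: "smooth f \<Longrightarrow> smooth (deriv f)"
  unfolding smooth_def by (metis comp_apply funpow_Suc_right)

lemma smooth_funpow: "smooth f \<Longrightarrow> smooth ((deriv ^^ j) f)"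
  by (induction j) (auto intro: smooth_deriv)

lemma differentiable_onI_DERIV:
  "(\<And>x. \<exists>d. (f has_real_derivative d) (at x)) \<Longrightarrow> f differentiable_on UNIV"
  by (simp add: differentiable_on_def) (metis real_differentiable_def)

lemma smooth_continuous: "smooth f \<Longrightarrow> continuous_on UNIV f"
  using smooth_DERIV by (meson DERIV_isCont continuous_at_imp_continuous_on)

lemma smooth_measurable: "smooth f \<Longrightarrow> f \<in> borel_measurable borel"
  by (simp add: borel_measurable_continuous_onI smooth_continuous)

text \<open>The Leibniz rule turns one product into a sum of two, so sums have to belong to the
  class for it to be invariant under \<open>deriv\<close>.\<close>

inductive_set smooth_products :: "(real \<Rightarrow> real) set" where
  prod: "smooth f \<Longrightarrow> smooth g \<Longrightarrow> (\<lambda>x. f x * g x) \<in> smooth_products"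
| add: "p \<in> smooth_products \<Longrightarrow> q \<in> smooth_products \<Longrightarrow> (\<lambda>x. p x + q x) \<in> smooth_products"

lemma smooth_mult:
  assumes "smooth f" "smooth g" shows "smooth (\<lambda>x. f x * g x)"
proof (rule smooth_coinduct)
  show "(\<lambda>x. f x * g x) \<in> smooth_products" by (intro smooth_products.intros assms)
  fix p assume "p \<in> smooth_products"
  then have "(\<forall>x. \<exists>d. (p has_real_derivative d) (at x)) \<and> deriv p \<in> smooth_products"
  proof induction
    case (prod f g)
    have D: "((\<lambda>x. f x * g x) has_real_derivative (deriv f x * g x + f x * deriv g x)) (at x)" for x
      by (rule derivative_eq_intros smooth_DERIV prod refl)+ simp
    have "deriv (\<lambda>x. f x * g x) = (\<lambda>x. deriv f x * g x + f x * deriv g x)"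
      using D by (intro ext DERIV_imp_deriv)
    then show ?case using D prod
      by (auto intro!: smooth_products.intros smooth_deriv)
  next
    case (add p q)
    then have "(p has_real_derivative deriv p x) (at x)" "(q has_real_derivative deriv q x) (at x)" for x
      by (metis DERIV_imp_deriv)+
    then have D: "((\<lambda>x. p x + q x) has_real_derivative (deriv p x + deriv q x)) (at x)" for x
      by (intro derivative_intros)
    have "deriv (\<lambda>x. p x + q x) = (\<lambda>x. deriv p x + deriv q x)"
      using D by (intro ext DERIV_imp_deriv)
    then show ?case using D add by (auto intro!: smooth_products.intros)
  qed
  then show "p differentiable_on UNIV \<and> deriv p \<in> smooth_products"
    using differentiable_onI_DERIV by blast
qed

text \<open>The prefactor k keeps the class invariant, since every differentiation produces another
  factor c.\<close>

lemma smooth_affine: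
  assumes "smooth f" shows "smooth (\<lambda>x. k * f (c * x + d))"
proof (rule smooth_coinduct)
  let ?S = "{\<lambda>x. k * f (c * x + d) | k f. smooth f}"
  show "(\<lambda>x. k * f (c * x + d)) \<in> ?S" using assms by blast
  fix p assume "p \<in> ?S"
  then obtain k f where p: "p = (\<lambda>x. k * f (c * x + d))" and f: "smooth f" by blast
  have D: "(p has_real_derivative (k * c * deriv f (c * x + d))) (at x)" for x
    unfolding p
    by (rule derivative_eq_intros DERIV_chain2[OF smooth_DERIV[OF f]] refl)+ simp
  have "deriv p = (\<lambda>x. k * c * deriv f (c * x + d))"
    using D by (intro ext DERIV_imp_deriv)
  then show "p differentiable_on UNIV \<and> deriv p \<in> ?S"
    using D f smooth_deriv differentiable_onI_DERIV by blast
qed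

text \<open>The standard flat function. Its support is a half-line; compactly supported functions
  arise as products of one translate and one reflected translate.\<close>

definition bump :: "real \<Rightarrow> real" where
  "bump x = (if x > 0 then exp (- 1 / x) else 0)"

lemma poly_exp_decay: "((\<lambda>y. poly P y * exp (- y)) \<longlongrightarrow> (0::real)) at_top"
proof -
  have "((\<lambda>y. \<Sum>i\<le>degree P. coeff P i * (y ^ i / exp y)) \<longlongrightarrow> (\<Sum>i\<le>degree P. coeff P i * 0)) at_top"
    by (intro tendsto_intros tendsto_power_div_exp_0)
  then show ?thesis
    by (simp add: poly_altdef sum_distrib_right exp_minus divide_inverse mult.assoc)
qed

lemma smooth_bump: "smooth bump"
proof (rule smooth_coinduct)
  let ?h = "\<lambda>P x. if x > 0 then poly P (1 / x) * exp (- 1 / x) else (0::real)"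
  let ?S = "range ?h"
  have "bump = ?h 1" by (auto simp: bump_def fun_eq_iff)
  then show "bump \<in> ?S" by blast
  fix p assume "p \<in> ?S"
  then obtain P where p: "p = ?h P" by blast
  \<comment> \<open>In the variable y = 1/x, d/dx is - y^2 d/dy, which turns P(y) exp(-y) into y^2
    (P - P')(y) exp(-y). The list \<open>[:0, 0, 1:]\<close> is the polynomial y^2.\<close>
  define Q where "Q = (P - pderiv P) * [:0, 0, 1:]"
  have D: "(p has_real_derivative ?h Q x) (at x)" for x
  proof -
    consider "x > 0" | "x < 0" | "x = 0" by linarith
    then show ?thesis
    proof cases
      case 1
      have "((\<lambda>x. poly P (1 / x) * exp (- 1 / x)) has_real_derivative ?h Q x) (at x)"
        using 1 unfolding Q_def
        by (auto intro!: derivative_eq_intros DERIV_chain2[OF poly_DERIV]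
            simp: field_simps power2_eq_square)
      moreover have "\<forall>\<^sub>F y in nhds x. p y = poly P (1 / y) * exp (- 1 / y)"
        using eventually_nhds_in_open[OF open_greaterThan, of x 0] 1
        by (auto simp: p elim!: eventually_mono)
      ultimately show ?thesis by (subst DERIV_cong_ev[OF refl _ refl]) auto
    next
      case 2
      have "((\<lambda>x. 0) has_real_derivative ?h Q x) (at x)" using 2 by auto
      moreover have "\<forall>\<^sub>F y in nhds x. p y = 0"
        using eventually_nhds_in_open[OF open_lessThan, of x 0] 2
        by (auto simp: p elim!: eventually_mono)
      ultimately show ?thesis by (subst DERIV_cong_ev[OF refl _ refl]) auto
    next
      case 3
      \<comment> \<open>At 0 from the right the difference quotient is P(y) exp(-y) / x = y P(y)
        exp(-y); the factor \<open>[:0, 1:]\<close> is this y.\<close>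
      have "((\<lambda>y. poly (P * [:0, 1:]) y * exp (- y)) \<longlongrightarrow> 0) at_top"
        by (rule poly_exp_decay)
      then have "((\<lambda>x. poly (P * [:0, 1:]) (inverse x) * exp (- inverse x)) \<longlongrightarrow> 0) (at_right 0)"
        by (rule filterlim_compose) (rule filterlim_inverse_at_top_right)
      moreover have "\<forall>\<^sub>F y in at_right 0. poly (P * [:0, 1:]) (inverse y) * exp (- inverse y) = (p y - p 0) / (y - 0)"
        using eventually_at_right_less[of 0]
        by eventually_elim (auto simp: p field_simps)
      ultimately have R: "((\<lambda>y. (p y - p 0) / (y - 0)) \<longlongrightarrow> 0) (at_right 0)"
        using tendsto_cong by force
      have "\<forall>\<^sub>F y in at_left 0. 0 = (p y - p 0) / (y - 0)"
        using eventually_at_left_real[of "-1" 0] by (auto simp: p elim!: eventually_mono)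
      then have L: "((\<lambda>y. (p y - p 0) / (y - 0)) \<longlongrightarrow> 0) (at_left 0)"
        using tendsto_cong tendsto_const by fast
      show ?thesis using L R 3 by (auto simp: has_field_derivative_iff filterlim_split_at)
    qed
  qed
  have "deriv p = ?h Q" using D by (intro ext DERIV_imp_deriv)
  then show "p differentiable_on UNIV \<and> deriv p \<in> ?S"
    using D differentiable_onI_DERIV by blast
qed

lemma bump_bounds: "0 \<le> bump x" "bump x \<le> 1"
  by (auto simp: bump_def)

text \<open>The limit is the indicator of an open half-line; products of two such families
  approximate indicators of open intervals by test functions.\<close>

lemma bump_scaled_tendsto: "(\<lambda>i. bump (real (Suc i) * x)) \<longlonglongrightarrow> (if x > 0 then 1 else 0)"
proof (cases "x > 0")
  case True
  have "(\<lambda>i. exp (- 1 / x * (1 / real (Suc i)))) \<longlonglongrightarrow> exp (- 1 / x * 0)"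
    by (intro tendsto_intros LIMSEQ_Suc[OF lim_1_over_n])
  moreover have "bump (real (Suc i) * x) = exp (- 1 / x * (1 / real (Suc i)))" for i
    using True by (simp add: bump_def zero_less_mult_iff del: of_nat_Suc)
  ultimately show ?thesis using True by simp
next
  case False
  then show ?thesis by (simp add: bump_def mult_pos_pos zero_less_mult_iff)
qed

section \<open>Test functions, their supports and bounds\<close>

lemma test_functionI:
  assumes "smooth \<psi>" "\<And>x. x \<notin> {a..b} \<Longrightarrow> \<psi> x = 0" shows "test_function \<psi>"
proof -
  have "closure {z. \<psi> z \<noteq> 0} \<subseteq> {a..b}"
    using assms(2) by (intro closure_minimal) (auto simp del: atLeastAtMost_iff)
  then have "compact (closure {z. \<psi> z \<noteq> 0})"
    using bounded_subset[OF bounded_closed_interval] by (auto simp: compact_eq_bounded_closed)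
  then show ?thesis using assms(1) by (auto simp: test_function_def smooth_def)
qed

lemma test_function_smooth: "test_function \<psi> \<Longrightarrow> smooth \<psi>"
  by (auto simp: test_function_def smooth_def)

lemma test_function_support:
  assumes "test_function \<psi>"
  obtains N :: real where "N > 0" "\<And>x. x \<notin> {-N..N} \<Longrightarrow> \<psi> x = 0"
proof -
  have "bounded {z. \<psi> z \<noteq> 0}"
    using assms unfolding test_function_def
    by (meson bounded_subset closure_subset compact_imp_bounded)
  then obtain N where "N > 0" "\<And>x. \<psi> x \<noteq> 0 \<Longrightarrow> \<bar>x\<bar> \<le> N"
    unfolding bounded_pos by auto
  then show ?thesis by (intro that[of N]) (force simp: abs_le_iff)+
qed

lemma test_function_deriv:
  assumes "test_function \<psi>" shows "test_function (deriv \<psi>)"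
proof -
  obtain N where N: "\<And>x. x \<notin> {-N..N} \<Longrightarrow> \<psi> x = 0" using test_function_support[OF assms] by blast
  show ?thesis
  proof (rule test_functionI[where a = "-N" and b = N])
    fix x assume x: "x \<notin> {-N..N}"
    have "\<forall>\<^sub>F y in nhds x. \<psi> y = 0"
      using eventually_nhds_in_open[of "- {-N..N}" x] x N
      by (auto simp: open_Compl elim!: eventually_mono)
    then have "(\<psi> has_real_derivative 0) (at x)"
      by (subst DERIV_cong_ev[OF refl _ refl, where g = "\<lambda>x. 0"]) auto
    then show "deriv \<psi> x = 0" by (rule DERIV_imp_deriv)
  qed (use assms smooth_deriv test_function_smooth in auto)
qed

lemma test_function_funpow: "test_function \<psi> \<Longrightarrow> test_function ((deriv ^^ j) \<psi>)"
  by (induction j) (auto intro: test_function_deriv)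

lemma test_function_bounded:
  assumes "test_function \<psi>" obtains B where "B \<ge> 0" "\<And>x. \<bar>\<psi> x\<bar> \<le> B"
proof -
  obtain N where N: "N > 0" "\<And>x. x \<notin> {-N..N} \<Longrightarrow> \<psi> x = 0" using test_function_support[OF assms] by blast
  have "compact (\<psi> ` {-N..N})"
    using assms by (intro compact_continuous_image continuous_on_subset[OF smooth_continuous] test_function_smooth) auto
  then obtain B where B: "\<And>x. x \<in> {-N..N} \<Longrightarrow> \<bar>\<psi> x\<bar> \<le> B"
    by (force simp: bounded_iff dest!: compact_imp_bounded)
  show ?thesis
    by (rule that[of "max B 0"]) (use B N in \<open>force simp: le_max_iff_disj\<close>)+
qed

definition locally_integrable :: "(real \<Rightarrow> real) \<Rightarrow> bool" where
  "locally_integrable f \<longleftrightarrow> f \<in> borel_measurable lborel \<and> (\<forall>a b. set_integrable lborel {a..b} f)"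

lemma integrable_test_mult:
  assumes "locally_integrable f" "test_function \<psi>"
  shows "integrable lborel (\<lambda>x. f x * \<psi> x)"
proof -
  obtain N where N: "N > 0" "\<And>x. x \<notin> {-N..N} \<Longrightarrow> \<psi> x = 0" using test_function_support[OF assms(2)] by blast
  obtain B where B: "B \<ge> 0" "\<And>x. \<bar>\<psi> x\<bar> \<le> B" using test_function_bounded[OF assms(2)] by blast
  have [measurable]: "f \<in> borel_measurable borel" "\<psi> \<in> borel_measurable borel"
    using assms smooth_measurable test_function_smooth by (auto simp: locally_integrable_def)
  have "integrable lborel (\<lambda>x. B * (indicator {-N..N} x *\<^sub>R f x))"
    using assms by (auto simp: locally_integrable_def set_integrable_def)
  moreover have "(\<lambda>x. f x * \<psi> x) \<in> borel_measurable lborel" by simp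
  ultimately show ?thesis
    by (rule Bochner_Integration.integrable_bound)
       (use B N in \<open>auto simp: indicator_def abs_mult mult.commute[of "\<bar>f _\<bar>"] intro!: AE_I2 mult_right_mono\<close>)
qed

text \<open>The positive and the negative part of f are densities of two finite measures that agree
  on all half-lines. Such measures are equal, and a density is determined almost everywhere.\<close>

lemma AE_zero_if_interval_integrals_zero:
  fixes f :: "real \<Rightarrow> real"
  assumes f: "integrable lborel f" and z: "\<And>a b. a < b \<Longrightarrow> (LINT x|lborel. indicator {a<..<b} x * f x) = 0"
  shows "AE x in lborel. f x = 0"
proof -
  have [measurable]: "f \<in> borel_measurable borel" using f by auto
  define p q where "p x = max 0 (f x)" and "q x = max 0 (- f x)" for x
  have "integrable lborel (\<lambda>x. - f x)" using f by simp
  then have pq: "integrable lborel p" "integrable lborel q"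
    unfolding p_def[abs_def] q_def[abs_def] using f by (rule_tac [!] integrable_max[OF integrable_zero])
  have [measurable]: "p \<in> borel_measurable borel" "q \<in> borel_measurable borel" using pq by auto
  \<comment> \<open>Half-lines are exhausted by bounded intervals; they are the sets on which
    \<open>measure_eqI_lessThan\<close> compares two measures.\<close>
  have z2: "(LINT x|lborel. indicator {a<..} x * f x) = 0" for a
  proof -
    have "(\<lambda>i. LINT x|lborel. indicator {a<..<a + real (Suc i)} x * f x) \<longlonglongrightarrow> (LINT x|lborel. indicator {a<..} x * f x)"
    proof (rule integral_dominated_convergence[where w = "\<lambda>x. \<bar>f x\<bar>"])
      have "(\<lambda>i. indicator {a<..<a + real (Suc i)} x * f x) \<longlonglongrightarrow> indicator {a<..} x * f x" for x
      proof -
        obtain N where "x - a < real N" using reals_Archimedean2 by blast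
        then have "\<forall>\<^sub>F i in sequentially. indicator {a<..<a + real (Suc i)} x * f x = indicator {a<..} x * f x"
          by (auto intro!: eventually_sequentiallyI[of N] simp: indicator_def)
        then show ?thesis by (rule tendsto_eventually)
      qed
      then show "AE x in lborel. (\<lambda>i. indicator {a<..<a + real (Suc i)} x * f x) \<longlonglongrightarrow> indicator {a<..} x * f x" by auto
    qed (use f in \<open>auto simp: indicator_def\<close>)
    moreover have "(LINT x|lborel. indicator {a<..<a + real (Suc i)} x * f x) = 0" for i by (rule z) simp
    ultimately have "(\<lambda>i::nat. 0) \<longlonglongrightarrow> (LINT x|lborel. indicator {a<..} x * f x)" by (simp only:)
    then show ?thesis by (simp add: LIMSEQ_const_iff)
  qed
  have em: "emeasure (density lborel (\<lambda>x. ennreal (r x))) {a<..} = ennreal (LINT x|lborel. indicator {a<..} x * r x)"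
    if r: "integrable lborel r" "\<And>x. r x \<ge> 0" for r :: "real \<Rightarrow> real" and a
  proof -
    have [measurable]: "r \<in> borel_measurable borel" using r by auto
    have "emeasure (density lborel (\<lambda>x. ennreal (r x))) {a<..} = (\<integral>\<^sup>+x. ennreal (indicator {a<..} x * r x) \<partial>lborel)"
      by (subst emeasure_density) (auto intro!: nn_integral_cong split: split_indicator)
    also have "\<dots> = ennreal (LINT x|lborel. indicator {a<..} x * r x)"
      using integrable_real_mult_indicator[OF _ r(1), of "{a<..}"] r(2)
      by (intro nn_integral_eq_integral) (auto simp: mult.commute)
    finally show ?thesis .
  qed
  have pq0: "p x \<ge> 0" "q x \<ge> 0" for x by (auto simp: p_def q_def)
  have "(LINT x|lborel. indicator {a<..} x * p x) = (LINT x|lborel. indicator {a<..} x * q x)" for a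
  proof -
    have "(LINT x|lborel. indicator {a<..} x * p x) - (LINT x|lborel. indicator {a<..} x * q x)
       = (LINT x|lborel. indicator {a<..} x * p x - indicator {a<..} x * q x)"
      using integrable_real_mult_indicator[of "{a<..}" lborel] pq
      by (intro Bochner_Integration.integral_diff[symmetric]) (auto simp: mult.commute)
    also have "\<dots> = (LINT x|lborel. indicator {a<..} x * f x)"
      by (intro Bochner_Integration.integral_cong) (auto simp: p_def q_def indicator_def max_def)
    finally show ?thesis using z2 by simp
  qed
  then have "density lborel (\<lambda>x. ennreal (p x)) = density lborel (\<lambda>x. ennreal (q x))"
    by (intro measure_eqI_lessThan) (simp_all add: em[OF pq(1) pq0(1)] em[OF pq(2) pq0(2)])
  moreover have "integral\<^sup>N lborel p \<noteq> \<infinity>"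
    using pq(1) pq0(1) by (subst nn_integral_eq_integral) simp_all
  ultimately have "AE x in lborel. ennreal (p x) = ennreal (q x)"
    by (subst (asm) finite_density_unique) auto
  then show ?thesis
    by eventually_elim (auto simp: p_def q_def max_def split: if_splits)
qed

text \<open>Products of two scaled copies of \<open>bump\<close> tend to the indicator of an
  interval (a, b), vanish outside of it and are bounded by 1. By dominated convergence f has
  integral 0 over every interval.\<close>

lemma fundamental_lemma:
  assumes f: "locally_integrable f"
    and z: "\<And>\<psi>. test_function \<psi> \<Longrightarrow> (LINT x|lborel. f x * \<psi> x) = 0"
  shows "AE x in lborel. f x = 0"
proof -
  have [measurable]: "f \<in> borel_measurable borel" "bump \<in> borel_measurable borel"
    using f smooth_measurable[OF smooth_bump] by (auto simp: locally_integrable_def)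
  have I: "(LINT x|lborel. indicator {a<..<b} x * f x) = 0" for a b
  proof -
    define \<psi> where "\<psi> i x = bump (real (Suc i) * (x - a)) * bump (real (Suc i) * (b - x))" for i x
    have "test_function (\<psi> i)" for i
    proof (rule test_functionI[where a = a and b = b])
      have "smooth (\<lambda>x. (1 * bump (real (Suc i) * x + - real (Suc i) * a)) * (1 * bump (- real (Suc i) * x + real (Suc i) * b)))"
        by (intro smooth_mult smooth_affine smooth_bump)
      then show "smooth (\<psi> i)" by (simp add: \<psi>_def[abs_def] algebra_simps)
    qed (auto simp: \<psi>_def bump_def zero_less_mult_iff)
    then have "(\<lambda>i. LINT x|lborel. f x * \<psi> i x) \<longlonglongrightarrow> 0" using z by simp
    moreover have "(\<lambda>i. LINT x|lborel. f x * \<psi> i x) \<longlonglongrightarrow> (LINT x|lborel. indicator {a<..<b} x * f x)"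
    proof (rule integral_dominated_convergence[where w = "\<lambda>x. \<bar>indicator {a..b} x *\<^sub>R f x\<bar>"])
      show "integrable lborel (\<lambda>x. \<bar>indicator {a..b} x *\<^sub>R f x\<bar>)"
        using f by (auto simp: locally_integrable_def set_integrable_def intro!: integrable_abs)
      have "(\<lambda>i. f x * \<psi> i x) \<longlonglongrightarrow> indicator {a<..<b} x * f x" for x
      proof -
        have "(\<lambda>i. f x * \<psi> i x) \<longlonglongrightarrow> f x * ((if x - a > 0 then 1 else 0) * (if b - x > 0 then 1 else 0))"
          unfolding \<psi>_def by (intro tendsto_intros bump_scaled_tendsto)
        then show ?thesis by (auto simp: indicator_def split: if_splits)
      qed
      then show "AE x in lborel. (\<lambda>i. f x * \<psi> i x) \<longlonglongrightarrow> indicator {a<..<b} x * f x" by auto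
      fix i
      have "\<bar>\<psi> i x\<bar> \<le> 1 * 1" for x
        unfolding \<psi>_def abs_mult using bump_bounds by (intro mult_mono) auto
      moreover have "\<psi> i x = 0" if "x \<notin> {a..b}" for x
        using that by (auto simp: \<psi>_def bump_def zero_less_mult_iff)
      ultimately show "AE x in lborel. norm (f x * \<psi> i x) \<le> \<bar>indicator {a..b} x *\<^sub>R f x\<bar>"
        by (intro AE_I2) (auto simp: abs_mult indicator_def mult_left_le)
    qed (auto simp: \<psi>_def)
    ultimately show ?thesis by (rule LIMSEQ_unique[symmetric])
  qed
  \<comment> \<open>f is integrable only on bounded sets, so it is truncated to [-i, i]; up to
    finitely many points the intersection with an interval is again an interval.\<close>
  have "AE x in lborel. indicator {- real i..real i} x * f x = 0" for i :: nat
  proof (rule AE_zero_if_interval_integrals_zero)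
    show "integrable lborel (\<lambda>x. indicator {- real i..real i} x * f x)"
      using f by (auto simp: locally_integrable_def set_integrable_def)
    fix a b :: real assume "a < b"
    have "(LINT x|lborel. indicator {a<..<b} x * (indicator {- real i..real i} x * f x))
        = (LINT x|lborel. indicator {max a (- real i)<..<min b (real i)} x * f x)"
    proof (rule integral_cong_AE)
      have "AE x in lborel. x \<noteq> - real i \<and> x \<noteq> real i"
        by (intro AE_conjI AE_lborel_singleton)
      then show "AE x in lborel. indicator {a<..<b} x * (indicator {- real i..real i} x * f x)
           = indicator {max a (- real i)<..<min b (real i)} x * f x"
        by eventually_elim (auto simp: indicator_def)
    qed auto
    then show "(LINT x|lborel. indicator {a<..<b} x * (indicator {- real i..real i} x * f x)) = 0"
      using I by simp
  qed
  then have "AE x in lborel. \<forall>i::nat. indicator {- real i..real i} x * f x = 0"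
    unfolding AE_all_countable by blast
  then show ?thesis
  proof eventually_elim
    case (elim x)
    obtain i :: nat where "\<bar>x\<bar> \<le> real i" using real_arch_simple by blast
    then show ?case using elim[rule_format, of i] by (auto simp: indicator_def abs_le_iff)
  qed
qed

section \<open>Absolutely continuous functions\<close>

lemma locally_integrable_measurable [measurable_dest]:
  "locally_integrable f \<Longrightarrow> f \<in> borel_measurable borel"
  by (simp add: locally_integrable_def)

lemma locally_integrable_integrable_on: "locally_integrable f \<Longrightarrow> f integrable_on {a..b}"
  using set_borel_integral_eq_integral(1) by (auto simp: locally_integrable_def)

lemma locally_integrable_LINT:
  "locally_integrable f \<Longrightarrow> (LINT x|lborel. indicator {a..b} x * f x) = integral {a..b} f"
  using set_borel_integral_eq_integral(2)[of "{a..b}" f]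
  by (auto simp: locally_integrable_def set_lebesgue_integral_def)

lemma locally_integrable_add:
  "locally_integrable f \<Longrightarrow> locally_integrable g \<Longrightarrow> locally_integrable (\<lambda>x. f x + g x)"
  by (auto simp: locally_integrable_def)

lemma locally_integrable_cmult: "locally_integrable f \<Longrightarrow> locally_integrable (\<lambda>x. c * f x)"
  by (auto simp: locally_integrable_def)

lemma locally_integrable_diff:
  "locally_integrable f \<Longrightarrow> locally_integrable g \<Longrightarrow> locally_integrable (\<lambda>x. f x - g x)"
  by (auto simp: locally_integrable_def)

lemma locally_integrable_abs: "locally_integrable f \<Longrightarrow> locally_integrable (\<lambda>x. \<bar>f x\<bar>)"
  by (auto simp: locally_integrable_def intro: set_integrable_abs)

lemma locally_integrable_mult_continuous:
  assumes f: "locally_integrable f" and k: "continuous_on UNIV k"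
  shows "locally_integrable (\<lambda>x. k x * f x)"
proof -
  have [measurable]: "f \<in> borel_measurable borel" "k \<in> borel_measurable borel"
    using f k borel_measurable_continuous_onI by (auto simp: locally_integrable_def)
  have "set_integrable lborel {a..b} (\<lambda>x. k x * f x)" for a b
  proof -
    have "bounded (k ` {a..b})"
      using k by (intro compact_imp_bounded compact_continuous_image continuous_on_subset[OF k]) auto
    then obtain B where B: "\<And>x. x \<in> {a..b} \<Longrightarrow> \<bar>k x\<bar> \<le> B" unfolding bounded_iff by force
    have "integrable lborel (\<lambda>x. B * (indicator {a..b} x *\<^sub>R f x))"
      using f by (auto simp: locally_integrable_def set_integrable_def)
    then show ?thesis unfolding set_integrable_def
    proof (rule Bochner_Integration.integrable_bound)
      show "AE x in lborel. norm (indicator {a..b} x *\<^sub>R (k x * f x)) \<le> norm (B * (indicator {a..b} x *\<^sub>R f x))"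
        using B by (intro AE_I2) (force simp: indicator_def abs_mult intro!: mult_right_mono)
    qed simp
  qed
  then show ?thesis by (simp add: locally_integrable_def)
qed

lemma integrable_indicator_Icc [simp]: "integrable lborel (indicator {a..b::real} :: real \<Rightarrow> real)"
  by (rule integrable_real_indicator) (auto simp: emeasure_lborel_Icc_eq)

lemma locally_integrable_continuous: "continuous_on UNIV k \<Longrightarrow> locally_integrable k"
  using locally_integrable_mult_continuous[of "\<lambda>_. 1" k]
  by (simp add: locally_integrable_def set_integrable_def)

lemma locally_integrable_integrable: "integrable lborel f \<Longrightarrow> locally_integrable f"
  using integrable_real_mult_indicator[of _ lborel f]
  by (auto simp: locally_integrable_def set_integrable_def mult.commute)

lemma locally_integrable_reflect:
  assumes "locally_integrable f" shows "locally_integrable (\<lambda>x. f (- x))"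
proof -
  have "integrable lborel (\<lambda>x. indicator {a..b} x * f (- x))" for a b
  proof -
    have "integrable lborel (\<lambda>x. indicator {- b..- a} x * f x)"
      using assms by (auto simp: locally_integrable_def set_integrable_def)
    from lborel_integrable_real_affine[OF this, of "-1" 0]
    have "integrable lborel (\<lambda>x. indicator {- b..- a} (- x) * f (- x))" by simp
    moreover have "indicator {- b..- a} (- x) = (indicator {a..b} x :: real)" for x :: real
      by (auto simp: indicator_def)
    ultimately show ?thesis by simp
  qed
  then show ?thesis using assms by (auto simp: locally_integrable_def set_integrable_def)
qed

section \<open>Square integrable functions\<close>

lemma L2_measurable [measurable_dest]: "L2 f \<Longrightarrow> f \<in> borel_measurable borel"
  by (simp add: L2_def)

lemma L2_integrable_square: "L2 f \<Longrightarrow> integrable lborel (\<lambda>x. (f x)\<^sup>2)"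
  by (simp add: L2_def)

lemma L2_integrable_mult:
  assumes "L2 f" "L2 g" shows "integrable lborel (\<lambda>x. f x * g x)"
proof -
  have [measurable]: "f \<in> borel_measurable borel" "g \<in> borel_measurable borel"
    using assms by (auto simp: L2_def)
  have "integrable lborel (\<lambda>x. (f x)\<^sup>2 + (g x)\<^sup>2)" using assms by (auto simp: L2_def)
  then show ?thesis
  proof (rule Bochner_Integration.integrable_bound)
    have "\<bar>f x * g x\<bar> \<le> (f x)\<^sup>2 + (g x)\<^sup>2" for x
      using sum_squares_bound[of "\<bar>f x\<bar>" "\<bar>g x\<bar>"] mult_nonneg_nonneg[of "\<bar>f x\<bar>" "\<bar>g x\<bar>"]
      unfolding abs_mult power2_abs by linarith
    then show "AE x in lborel. norm (f x * g x) \<le> norm ((f x)\<^sup>2 + (g x)\<^sup>2)" by simp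
  qed simp
qed

lemma L2_cmult: "L2 f \<Longrightarrow> L2 (\<lambda>x. c * f x)"
  by (auto simp: L2_def power_mult_distrib)

lemma L2_add:
  assumes "L2 f" "L2 g" shows "L2 (\<lambda>x. f x + g x)"
proof -
  have "integrable lborel (\<lambda>x. (f x)\<^sup>2 + (g x)\<^sup>2 + 2 * (f x * g x))"
    using assms L2_integrable_mult[OF assms] by (auto simp: L2_def)
  then show ?thesis using assms by (auto simp: L2_def power2_sum algebra_simps)
qed

lemma L2_diff: "L2 f \<Longrightarrow> L2 g \<Longrightarrow> L2 (\<lambda>x. f x - g x)"
  using L2_add[of f "\<lambda>x. -1 * g x"] L2_cmult[of g "-1"] by simp

lemma L2_zero: "L2 (\<lambda>x. 0)"
  by (auto simp: L2_def)

lemma L2_bound: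
  assumes g: "L2 g" and f: "f \<in> borel_measurable borel" and b: "AE x in lborel. \<bar>f x\<bar> \<le> \<bar>g x\<bar>"
  shows "L2 f"
proof -
  note [measurable] = f
  have "integrable lborel (\<lambda>x. (f x)\<^sup>2)"
    using L2_integrable_square[OF g]
    by (rule Bochner_Integration.integrable_bound)
       (use b in \<open>auto elim!: eventually_mono simp: abs_le_square_iff\<close>)
  then show ?thesis using f by (simp add: L2_def)
qed

lemma L2_mult_bounded:
  assumes g: "L2 g" and f: "f \<in> borel_measurable borel" and b: "\<And>x. \<bar>f x\<bar> \<le> B"
  shows "L2 (\<lambda>x. f x * g x)"
proof (rule L2_bound[OF L2_cmult[OF g, of B]])
  show "(\<lambda>x. f x * g x) \<in> borel_measurable borel" using f g by (auto simp: L2_def)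
  have "\<bar>f x * g x\<bar> \<le> \<bar>B * g x\<bar>" for x
    using b[of x] by (auto simp: abs_mult intro!: mult_right_mono)
  then show "AE x in lborel. \<bar>f x * g x\<bar> \<le> \<bar>B * g x\<bar>" by simp
qed

lemma L2_locally_integrable:
  assumes "L2 f" shows "locally_integrable f"
proof -
  have [measurable]: "f \<in> borel_measurable borel" using assms by (simp add: L2_def)
  have "set_integrable lborel {a..b} f" for a b
  proof -
    have "integrable lborel (\<lambda>x. indicator {a..b} x + (f x)\<^sup>2)"
      using assms by (auto simp: L2_def)
    then show ?thesis unfolding set_integrable_def
    proof (rule Bochner_Integration.integrable_bound)
      have "\<bar>f x\<bar> \<le> 1 + (f x)\<^sup>2" for x
        using sum_squares_bound[of 1 "\<bar>f x\<bar>"] by simp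
      then show "AE x in lborel. norm (indicat_real {a..b} x *\<^sub>R f x) \<le> norm (indicat_real {a..b} x + (f x)\<^sup>2)"
        by (intro AE_I2) (auto simp: indicator_def)
    qed simp
  qed
  then show ?thesis by (simp add: locally_integrable_def)
qed

text \<open>Local absolute continuity of f with derivative g, expressed by increments over
  intervals. The gauge integral gives access to the fundamental theorem of calculus and to bisection
  arguments, while local integrability of g links it with the Lebesgue integrals of the weak
  formulation.\<close>

definition primitive :: "(real \<Rightarrow> real) \<Rightarrow> (real \<Rightarrow> real) \<Rightarrow> bool" where
  "primitive f g \<longleftrightarrow> locally_integrable g \<and> (\<forall>a b. a \<le> b \<longrightarrow> (g has_integral (f b - f a)) {a..b})"

lemma primitiveD: "primitive f g \<Longrightarrow> a \<le> b \<Longrightarrow> (g has_integral (f b - f a)) {a..b}"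
  and primitive_locally_integrable: "primitive f g \<Longrightarrow> locally_integrable g"
  by (auto simp: primitive_def)

lemma primitive_integral: "primitive f g \<Longrightarrow> a \<le> b \<Longrightarrow> integral {a..b} g = f b - f a"
  using primitiveD by blast

lemma primitive_add: "primitive f f' \<Longrightarrow> primitive g g' \<Longrightarrow> primitive (\<lambda>x. f x + g x) (\<lambda>x. f' x + g' x)"
  unfolding primitive_def by (auto intro!: locally_integrable_add simp: add_diff_add intro: has_integral_add)

lemma primitive_cmult: "primitive f f' \<Longrightarrow> primitive (\<lambda>x. c * f x) (\<lambda>x. c * f' x)"
  unfolding primitive_def
  by (auto intro!: locally_integrable_cmult simp: right_diff_distrib[symmetric] intro: has_integral_mult_right)

lemma primitive_diff: "primitive f f' \<Longrightarrow> primitive g g' \<Longrightarrow> primitive (\<lambda>x. f x - g x) (\<lambda>x. f' x - g' x)"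
  using primitive_add[of f f' "\<lambda>x. -1 * g x" "\<lambda>x. -1 * g' x"] primitive_cmult[of g g' "-1"] by simp

lemma primitive_shift: "primitive f f' \<Longrightarrow> primitive (\<lambda>x. f x + c) f'"
  by (simp add: primitive_def)

lemma primitive_reflect:
  assumes "primitive f g" shows "primitive (\<lambda>x. f (- x)) (\<lambda>x. - g (- x))"
  unfolding primitive_def
proof (intro conjI allI impI)
  show "locally_integrable (\<lambda>x. - g (- x))"
    using locally_integrable_cmult[OF locally_integrable_reflect[OF primitive_locally_integrable[OF assms]], of "-1"] by simp
  fix a b :: real assume "a \<le> b"
  then have "(g has_integral (f (- a) - f (- b))) {- b..- a}" using primitiveD[OF assms] by simp
  then have "((\<lambda>x. g (- x)) has_integral (f (- a) - f (- b))) {a..b}"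
    using has_integral_reflect_lemma_real[of g "f (- a) - f (- b)" "- b" "- a"] by (simp only: minus_minus)
  from has_integral_neg[OF this] show "((\<lambda>x. - g (- x)) has_integral f (- b) - f (- a)) {a..b}"
    by simp
qed

lemma primitive_DERIV:
  assumes "\<And>x. (f has_real_derivative g x) (at x)" "continuous_on UNIV g"
  shows "primitive f g"
  unfolding primitive_def
  by (auto intro!: locally_integrable_continuous assms fundamental_theorem_of_calculus
      simp: has_real_derivative_iff_has_vector_derivative[symmetric]
      intro: has_field_derivative_at_within)

lemma primitive_smooth: "smooth \<psi> \<Longrightarrow> primitive \<psi> (deriv \<psi>)"
  by (intro primitive_DERIV smooth_DERIV smooth_continuous smooth_deriv)

lemma primitive_continuous:
  assumes "primitive f g" shows "continuous_on UNIV f"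
proof -
  have "isCont f x" for x
  proof -
    have "continuous_on {x - 1..x + 1} (\<lambda>y. f (x - 1) + integral {x - 1..y} g)"
      using assms by (intro continuous_intros indefinite_integral_continuous_1
          locally_integrable_integrable_on primitive_locally_integrable)
    then have "continuous_on {x - 1..x + 1} f"
      by (rule continuous_on_cong[THEN iffD1, rotated 2]) (auto simp: primitive_integral[OF assms])
    then show ?thesis by (rule continuous_on_interior) auto
  qed
  then show ?thesis by (simp add: continuous_at_imp_continuous_on)
qed

lemma primitive_DERIV_converse:
  assumes "primitive f g" "continuous_on UNIV g"
  shows "(f has_real_derivative g x) (at x)"
proof -
  have "((\<lambda>y. f (x - 1) + integral {x - 1..y} g) has_real_derivative (0 + g x)) (at x within {x - 1..x + 1})"
    using assms by (intro derivative_intros integral_has_real_derivative continuous_on_subset[OF assms(2)]) auto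
  then have "(f has_real_derivative g x) (at x within {x - 1..x + 1})"
    by (subst (asm) has_field_derivative_cong_eventually[where g = f])
       (auto simp: primitive_integral[OF assms(1)] eventually_at_filter)
  then show ?thesis by (simp add: at_within_Icc_at)
qed

lemma primitive_exists:
  assumes "locally_integrable g" shows "\<exists>f. primitive f g"
proof -
  define f where "f x = (if x \<ge> 0 then integral {0..x} g else - integral {x..0} g)" for x
  have i: "g integrable_on {a..b}" for a b by (rule locally_integrable_integrable_on[OF assms])
  have "f b - f a = integral {a..b} g" if "a \<le> b" for a b
    using that Henstock_Kurzweil_Integration.integral_combine[OF _ _ i, of 0 a b] Henstock_Kurzweil_Integration.integral_combine[OF _ _ i, of a 0 b]
      Henstock_Kurzweil_Integration.integral_combine[OF _ _ i, of a b 0]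
    by (auto simp: f_def)
  then show ?thesis using assms integrable_integral[OF i] unfolding primitive_def by (intro exI[of _ f]) auto
qed

text \<open>The mean value theorem bounds the defect of the chain rule on short intervals by
  \<open>e \<integral>|g|\<close>; this bound is additive, so bisection gives it on every interval.\<close>

lemma primitive_chain:
  assumes f: "primitive f g"
    and h: "\<And>x. (h has_real_derivative h' (f x)) (at (f x))"
    and h': "continuous_on UNIV (\<lambda>x. h' (f x))"
  shows "primitive (\<lambda>x. h (f x)) (\<lambda>x. h' (f x) * g x)"
proof -
  define k where "k x = h' (f x)" for x
  have cf: "continuous_on UNIV f" by (rule primitive_continuous[OF f])
  have lg: "locally_integrable g" by (rule primitive_locally_integrable[OF f])
  have li: "locally_integrable (\<lambda>x. k x * g x)"
    unfolding k_def by (rule locally_integrable_mult_continuous[OF lg h'])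
  have la: "locally_integrable (\<lambda>x. \<bar>g x\<bar>)" by (rule locally_integrable_abs[OF lg])
  note on = locally_integrable_integrable_on
  \<comment> \<open>Differentiability of h is given only at values of f. By the intermediate value
    theorem these fill the interval between f u and f v, and the intermediate point of the mean
    value theorem is itself of the form f c.\<close>
  have mvt: "\<exists>c\<in>{u..v}. h (f v) - h (f u) = k c * (f v - f u)" if "u \<le> v" for u v
  proof -
    have ivt: "\<exists>c\<in>{u..v}. f c = y" if "f u \<le> y \<and> y \<le> f v \<or> f v \<le> y \<and> y \<le> f u" for y
      using that IVT'[of f u y v] IVT2'[of f v y u] \<open>u \<le> v\<close> continuous_on_subset[OF cf, of "{u..v}"]
      by (auto simp: Bex_def)
    have mv: "\<exists>z. p \<le> z \<and> z \<le> q \<and> h q - h p = (q - p) * h' z"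
      if "p < q" "\<And>y. p \<le> y \<Longrightarrow> y \<le> q \<Longrightarrow> \<exists>c. f c = y" for p q
      using MVT2[of p q h h'] that h by (metis less_imp_le)
    consider "f u = f v" | "f u < f v" | "f v < f u" by linarith
    then show ?thesis
    proof cases
      case 1 then show ?thesis using that by (intro bexI[of _ u]) auto
    next
      case 2
      with mv[of "f u" "f v"] ivt obtain z where "f u \<le> z" "z \<le> f v" "h (f v) - h (f u) = (f v - f u) * h' z"
        by metis
      moreover from this ivt obtain c where "c \<in> {u..v}" "f c = z" by blast
      ultimately show ?thesis by (intro bexI[of _ c]) (auto simp: k_def)
    next
      case 3
      with mv[of "f v" "f u"] ivt obtain z where "f v \<le> z" "z \<le> f u" "h (f u) - h (f v) = (f u - f v) * h' z"
        by metis
      moreover from this ivt obtain c where "c \<in> {u..v}" "f c = z" by blast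
      ultimately show ?thesis by (intro bexI[of _ c]) (auto simp: k_def algebra_simps)
    qed
  qed
  have est: "\<bar>h (f b) - h (f a) - integral {a..b} (\<lambda>x. k x * g x)\<bar> \<le> e * integral {a..b} (\<lambda>x. \<bar>g x\<bar>)"
    if "a \<le> b" "e > 0" for a b e
    using that(1)
  proof (induction rule: Bolzano)
    case (trans a b c)
    then show ?case
      using Henstock_Kurzweil_Integration.integral_combine[OF _ _ on[OF li], of a b c] Henstock_Kurzweil_Integration.integral_combine[OF _ _ on[OF la], of a b c]
      by (smt (verit, best) distrib_left)
  next
    case (local x)
    have "isCont k x" using h' by (auto simp: k_def[abs_def] continuous_on_eq_continuous_at)
    then obtain d where d: "d > 0" "\<And>y. \<bar>y - x\<bar> < d \<Longrightarrow> \<bar>k y - k x\<bar> < e / 2"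
      using \<open>e > 0\<close> unfolding continuous_at_eps_delta by (metis half_gt_zero dist_real_def)
    have "\<bar>h (f v) - h (f u) - integral {u..v} (\<lambda>x. k x * g x)\<bar> \<le> e * integral {u..v} (\<lambda>x. \<bar>g x\<bar>)"
      if "u \<le> x" "x \<le> v" "v - u < d" for u v
    proof -
      from that mvt[of u v] obtain c where c: "c \<in> {u..v}" "h (f v) - h (f u) = k c * (f v - f u)" by auto
      have "h (f v) - h (f u) - integral {u..v} (\<lambda>x. k x * g x)
          = integral {u..v} (\<lambda>y. k c * g y) - integral {u..v} (\<lambda>y. k y * g y)"
        using c that by (simp add: primitive_integral[OF f])
      also have "\<dots> = integral {u..v} (\<lambda>y. k c * g y - k y * g y)"
        by (intro Henstock_Kurzweil_Integration.integral_diff[symmetric] on li locally_integrable_cmult lg)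
      finally have eq: "h (f v) - h (f u) - integral {u..v} (\<lambda>x. k x * g x)
          = integral {u..v} (\<lambda>y. k c * g y - k y * g y)" .
      have "norm (integral {u..v} (\<lambda>y. k c * g y - k y * g y)) \<le> integral {u..v} (\<lambda>y. e * \<bar>g y\<bar>)"
      proof (rule integral_norm_bound_integral)
        fix y assume "y \<in> {u..v}"
        then have "\<bar>k y - k x\<bar> < e / 2" "\<bar>k c - k x\<bar> < e / 2"
          using d(2)[of y] d(2)[of c] c that by (auto simp: abs_less_iff)
        then have "\<bar>k c - k y\<bar> \<le> e" by linarith
        then show "norm (k c * g y - k y * g y) \<le> e * \<bar>g y\<bar>"
          by (simp add: left_diff_distrib[symmetric] abs_mult mult_right_mono)
      qed (intro on locally_integrable_diff li locally_integrable_cmult lg la)+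
      then show ?thesis using eq by simp
    qed
    then show ?case using d(1) by blast
  qed
  show ?thesis
    unfolding primitive_def
  proof (intro conjI allI impI)
    show "locally_integrable (\<lambda>x. h' (f x) * g x)" using li by (simp add: k_def)
    fix a b :: real assume ab: "a \<le> b"
    define I where "I = integral {a..b} (\<lambda>x. \<bar>g x\<bar>)"
    have "I \<ge> 0" unfolding I_def by (intro integral_nonneg on la) auto
    have "\<bar>h (f b) - h (f a) - integral {a..b} (\<lambda>x. k x * g x)\<bar> \<le> 0 + e" if "e > 0" for e
    proof -
      have "\<bar>h (f b) - h (f a) - integral {a..b} (\<lambda>x. k x * g x)\<bar> \<le> (e / (I + 1)) * I"
        using est[OF ab, of "e / (I + 1)"] that \<open>I \<ge> 0\<close> by (simp add: I_def)
      also have "\<dots> \<le> e" using that \<open>I \<ge> 0\<close> by (simp add: field_simps)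
      finally show ?thesis by simp
    qed
    then have "h (f b) - h (f a) = integral {a..b} (\<lambda>x. k x * g x)"
      using field_le_epsilon[of "\<bar>h (f b) - h (f a) - integral {a..b} (\<lambda>x. k x * g x)\<bar>" 0] by simp
    then show "((\<lambda>x. h' (f x) * g x) has_integral h (f b) - h (f a)) {a..b}"
      using integrable_integral[OF on[OF li]] by (simp add: k_def)
  qed
qed

lemma primitive_square: "primitive f f' \<Longrightarrow> primitive (\<lambda>x. (f x)\<^sup>2) (\<lambda>x. 2 * f x * f' x)"
  by (rule primitive_chain[where h = "\<lambda>y. y\<^sup>2" and h' = "\<lambda>y. 2 * y"])
     (auto intro!: derivative_eq_intros continuous_on_mult continuous_on_const intro: primitive_continuous)

text \<open>Polarisation: f g is half of (f + g)^2 - f^2 - g^2, and squares are an instance of the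
  chain rule.\<close>

lemma primitive_mult:
  assumes "primitive f f'" "primitive g g'" shows "primitive (\<lambda>x. f x * g x) (\<lambda>x. f' x * g x + f x * g' x)"
proof -
  have "primitive (\<lambda>x. 1/2 * ((f x + g x)\<^sup>2 - (f x)\<^sup>2 - (g x)\<^sup>2))
     (\<lambda>x. 1/2 * (2 * (f x + g x) * (f' x + g' x) - 2 * f x * f' x - 2 * g x * g' x))"
    by (intro primitive_cmult primitive_diff primitive_square primitive_add assms)
  then show ?thesis by (simp add: power2_sum algebra_simps)
qed

section \<open>Primitives and weak derivatives\<close>

lemma primitive_weak_derivative:
  assumes "primitive f g" shows "weak_derivative 1 f g"
  unfolding weak_derivative_def
proof (intro allI impI)
  fix \<psi> :: "real \<Rightarrow> real" assume t: "test_function \<psi>"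
  obtain N where N: "N > 0" "\<And>x. x \<notin> {-N..N} \<Longrightarrow> \<psi> x = 0" using test_function_support[OF t] by blast
  obtain M where M: "M > 0" "\<And>x. x \<notin> {-M..M} \<Longrightarrow> deriv \<psi> x = 0"
    using test_function_support[OF test_function_deriv[OF t]] by blast
  \<comment> \<open>Strictly larger than both support bounds, so that \<psi> vanishes at the
    endpoints -K and K and the boundary terms of the product rule disappear.\<close>
  define K where "K = max N M + 1"
  have K: "x \<notin> {-N..N}" "x \<notin> {-M..M}" if "x \<notin> {- K..K}" for x
    using that by (auto simp: K_def)
  have i: "integrable lborel (\<lambda>x. g x * \<psi> x)" "integrable lborel (\<lambda>x. f x * deriv \<psi> x)"
    using assms t by (auto intro!: integrable_test_mult test_function_deriv
        intro: primitive_locally_integrable primitive_continuous locally_integrable_continuous)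
  have "primitive (\<lambda>x. f x * \<psi> x) (\<lambda>x. g x * \<psi> x + f x * deriv \<psi> x)"
    by (intro primitive_mult assms primitive_smooth test_function_smooth t)
  then have "((\<lambda>x. g x * \<psi> x + f x * deriv \<psi> x) has_integral (f K * \<psi> K - f (- K) * \<psi> (- K))) {- K..K}"
    using N M by (intro primitiveD) (auto simp: K_def)
  moreover have "\<psi> K = 0" "\<psi> (- K) = 0" by (rule N(2); use N(1) in \<open>auto simp: K_def\<close>)+
  ultimately have "((\<lambda>x. g x * \<psi> x + f x * deriv \<psi> x) has_integral 0) {- K..K}" by simp
  then have "((\<lambda>x. g x * \<psi> x + f x * deriv \<psi> x) has_integral 0) UNIV"
    by (rule has_integral_on_superset) (simp_all add: N(2)[OF K(1)] M(2)[OF K(2)] del: atLeastAtMost_iff)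
  moreover have "((\<lambda>x. g x * \<psi> x + f x * deriv \<psi> x) has_integral
      (LINT x|lborel. g x * \<psi> x + f x * deriv \<psi> x)) UNIV"
    using i by (intro has_integral_integral_lborel) auto
  ultimately have "(LINT x|lborel. g x * \<psi> x + f x * deriv \<psi> x) = 0" by (rule has_integral_unique[symmetric])
  then show "(LINT z|lborel. f z * (deriv ^^ 1) \<psi> z) = (- 1) ^ 1 * (LINT z|lborel. g z * \<psi> z)"
    using i by simp
qed

lemma weak_derivative_unique:
  assumes "weak_derivative j f g" "weak_derivative j f h" "locally_integrable g" "locally_integrable h"
  shows "AE x in lborel. g x = h x"
proof -
  have "AE x in lborel. g x - h x = 0"
  proof (rule fundamental_lemma)
    show "locally_integrable (\<lambda>x. g x - h x)" by (intro locally_integrable_diff assms)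
    fix \<psi> assume t: "test_function \<psi>"
    have "(- 1) ^ j * (LINT z|lborel. g z * \<psi> z) = (- 1) ^ j * (LINT z|lborel. h z * \<psi> z)"
      using assms(1,2)[unfolded weak_derivative_def, rule_format, OF t] by (rule trans[OF sym])
    then show "(LINT x|lborel. (g x - h x) * \<psi> x) = 0"
      using integrable_test_mult[OF _ t] assms(3,4) by (simp add: left_diff_distrib)
  qed
  then show ?thesis by simp
qed

text \<open>The antiderivative that vanishes to the left of the support of \<theta> equals the full
  integral of \<theta> to the right of it; mean zero is what makes it compactly supported.\<close>

lemma antiderivative_test_function:
  assumes t: "test_function \<theta>" and z: "(LINT x|lborel. \<theta> x) = 0"
  shows "\<exists>\<psi>. test_function \<psi> \<and> deriv \<psi> = \<theta>"
proof -
  have c: "continuous_on UNIV \<theta>" by (intro smooth_continuous test_function_smooth t)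
  obtain F where F: "primitive F \<theta>" using primitive_exists[OF locally_integrable_continuous[OF c]] by blast
  obtain N where N: "N > 0" "\<And>x. x \<notin> {-N..N} \<Longrightarrow> \<theta> x = 0" using test_function_support[OF t] by blast
  define \<psi> where "\<psi> x = F x - F (- N - 1)" for x
  have D: "(\<psi> has_real_derivative \<theta> x) (at x)" for x
    unfolding \<psi>_def[abs_def] using primitive_DERIV_converse[OF F c, of x] by (auto intro!: derivative_eq_intros)
  then have d: "deriv \<psi> = \<theta>" by (intro ext DERIV_imp_deriv)
  have i: "integrable lborel \<theta>"
    using integrable_test_mult[OF locally_integrable_continuous[of "\<lambda>_. 1"] t] by simp
  have "test_function \<psi>"
  proof (rule test_functionI[where a = "- N - 1" and b = "N + 1"])
    have "(deriv ^^ j) \<psi> differentiable_on UNIV" for j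
    proof (cases j)
      case 0
      then show ?thesis using D differentiable_onI_DERIV by auto
    next
      case (Suc j')
      then show ?thesis using test_function_smooth[OF t] by (simp add: funpow_Suc_right d smooth_def del: funpow.simps)
    qed
    then show "smooth \<psi>" by (simp add: smooth_def)
    fix x assume x: "x \<notin> {- N - 1..N + 1}"
    show "\<psi> x = 0"
    proof (cases "x < - N - 1")
      case True
      then have "(\<theta> has_integral (F (- N - 1) - F x)) {x..- N - 1}" by (intro primitiveD[OF F]) auto
      moreover have "(\<theta> has_integral 0) {x..- N - 1}"
        using N by (intro has_integral_is_0) auto
      ultimately show ?thesis by (auto simp: \<psi>_def dest: has_integral_unique)
    next
      case False
      then have "x > N + 1" using x by auto
      then have "(\<theta> has_integral \<psi> x) {- N - 1..x}"
        unfolding \<psi>_def using N by (intro primitiveD[OF F]) auto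
      then have "(\<theta> has_integral \<psi> x) UNIV"
        by (rule has_integral_on_superset) (use N \<open>x > N + 1\<close> in auto)
      then show ?thesis using has_integral_integral_lborel[OF i] z by (auto dest: has_integral_unique)
    qed
  qed
  then show ?thesis using d by blast
qed

text \<open>The lemma of du Bois-Reymond. Subtracting a primitive G of g leaves v = f - G, whose
  integral against every derivative of a test function is 0, that is, against every \<theta> of mean
  zero. A general test function \<eta> gets mean zero by subtracting a multiple of one fixed \<rho>
  of nonzero integral; the pairing of v with the normalised \<rho> is the constant C with v = C
  almost everywhere.\<close>

lemma weak_derivative_primitive:
  assumes f: "locally_integrable f" and g: "locally_integrable g" and w: "weak_derivative 1 f g"
  shows "\<exists>F. primitive F g \<and> (AE x in lborel. f x = F x)"
proof -
  obtain G where G: "primitive G g" using primitive_exists[OF g] by blast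
  define v where "v x = f x - G x" for x
  have lG: "locally_integrable G" by (intro locally_integrable_continuous primitive_continuous[OF G])
  have lv: "locally_integrable v" unfolding v_def[abs_def] by (intro locally_integrable_diff f lG)
  have vd: "(LINT x|lborel. v x * deriv \<psi> x) = 0" if t: "test_function \<psi>" for \<psi>
  proof -
    have "(LINT x|lborel. f x * deriv \<psi> x) = (LINT x|lborel. G x * deriv \<psi> x)"
      using w primitive_weak_derivative[OF G] t unfolding weak_derivative_def by simp
    then show ?thesis
      using integrable_test_mult[OF f test_function_deriv[OF t]] integrable_test_mult[OF lG test_function_deriv[OF t]]
      by (simp add: v_def left_diff_distrib)
  qed
  define \<rho> where "\<rho> x = bump x * bump (1 - x)" for x
  have t\<rho>: "test_function \<rho>"
  proof (rule test_functionI[where a = 0 and b = 1])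
    have "smooth (\<lambda>x. bump x * (1 * bump (-1 * x + 1)))"
      by (intro smooth_mult smooth_affine smooth_bump)
    then show "smooth \<rho>" by (simp add: \<rho>_def[abs_def])
  qed (auto simp: \<rho>_def bump_def)
  have one: "locally_integrable (\<lambda>_. 1)" by (intro locally_integrable_continuous) auto
  have i\<rho>: "integrable lborel \<rho>" using integrable_test_mult[OF one t\<rho>] by simp
  define c where "c = (LINT x|lborel. \<rho> x)"
  have "c \<noteq> 0"
  proof
    assume "c = 0"
    moreover have "\<rho> x \<ge> 0" for x by (auto simp: \<rho>_def bump_bounds)
    ultimately have "AE x in lborel. \<rho> x = 0"
      using i\<rho> integral_nonneg_eq_0_iff_AE[of lborel \<rho>] by (simp add: c_def)
    then have "AE x in lborel. x \<notin> {0<..<1::real}"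
      by eventually_elim (auto simp: \<rho>_def bump_def)
    then have "{0<..<1::real} \<in> null_sets lborel"
      using AE_iff_null_sets[of "{0<..<1::real}" lborel] by auto
    then show False by (auto simp: null_sets_def)
  qed
  define C where "C = (LINT x|lborel. v x * \<rho> x) / c"
  have "AE x in lborel. v x - C = 0"
  proof (rule fundamental_lemma)
    show "locally_integrable (\<lambda>x. v x - C)"
      by (intro locally_integrable_diff lv locally_integrable_continuous) auto
    fix \<eta> :: "real \<Rightarrow> real" assume t: "test_function \<eta>"
    have i\<eta>: "integrable lborel \<eta>" using integrable_test_mult[OF one t] by simp
    define k where "k = (LINT x|lborel. \<eta> x) / c"
    define \<theta> where "\<theta> x = \<eta> x - k * \<rho> x" for x
    obtain N where N: "\<And>x. x \<notin> {-N..N} \<Longrightarrow> \<eta> x = 0" using test_function_support[OF t] by blast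
    obtain M where M: "\<And>x. x \<notin> {-M..M} \<Longrightarrow> \<rho> x = 0" using test_function_support[OF t\<rho>] by blast
    have "test_function \<theta>"
    proof (rule test_functionI[where a = "- max N M" and b = "max N M"])
      have S: "smooth (\<lambda>x. p x + k * q x)" if "smooth p" "smooth q" for p q
      proof (rule smooth_coinduct)
        let ?S = "{\<lambda>x. p x + k * q x |p q. smooth p \<and> smooth q}"
        show "(\<lambda>x. p x + k * q x) \<in> ?S" using that by blast
        fix r assume "r \<in> ?S"
        then obtain p q where r: "r = (\<lambda>x. p x + k * q x)" "smooth p" "smooth q" by blast
        have D: "(r has_real_derivative (deriv p x + k * deriv q x)) (at x)" for x
          unfolding r(1) by (intro derivative_intros DERIV_cmult smooth_DERIV r)
        then have "deriv r = (\<lambda>x. deriv p x + k * deriv q x)" by (intro ext DERIV_imp_deriv)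
        then show "r differentiable_on UNIV \<and> deriv r \<in> ?S"
          using D r smooth_deriv differentiable_onI_DERIV by blast
      qed
      have "smooth (\<lambda>x. \<eta> x + k * (- 1 * \<rho> (1 * x + 0)))"
        by (intro S smooth_affine test_function_smooth t t\<rho>)
      then show "smooth \<theta>" by (simp add: \<theta>_def[abs_def])
    next
      fix x assume "x \<notin> {- max N M..max N M}"
      then have "x \<notin> {- N..N}" "x \<notin> {- M..M}" by auto
      then show "\<theta> x = 0" using N[of x] M[of x] by (simp add: \<theta>_def del: atLeastAtMost_iff)
    qed
    moreover have "(LINT x|lborel. \<theta> x) = 0"
      using i\<eta> i\<rho> \<open>c \<noteq> 0\<close> by (simp add: \<theta>_def k_def c_def)
    ultimately obtain \<psi> where "test_function \<psi>" "deriv \<psi> = \<theta>" using antiderivative_test_function by blast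
    then have "(LINT x|lborel. v x * \<theta> x) = 0" using vd by metis
    moreover have "(LINT x|lborel. v x * \<theta> x) = (LINT x|lborel. v x * \<eta> x) - k * (LINT x|lborel. v x * \<rho> x)"
      using integrable_test_mult[OF lv t] integrable_test_mult[OF lv t\<rho>]
      by (simp add: \<theta>_def right_diff_distrib mult.left_commute)
    ultimately show "(LINT x|lborel. (v x - C) * \<eta> x) = 0"
      using integrable_test_mult[OF lv t] i\<eta> by (simp add: left_diff_distrib C_def k_def)
  qed
  then have "AE x in lborel. f x = G x + C" by eventually_elim (auto simp: v_def)
  then show ?thesis using primitive_shift[OF G] by blast
qed

text \<open>For y in [x - 1, x] the values f(x)^2 and f(y)^2 differ by an integral of 2 f g, which
  is at most that of f^2 + g^2; averaging over y gives the bound. Keeping the integral on a unit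
  interval yields decay at infinity in addition to the Sobolev embedding.\<close>

lemma primitive_sup_bound:
  assumes p: "primitive f g" and f: "L2 f" and g: "L2 g"
  shows "(f x)\<^sup>2 \<le> 2 * (LINT y|lborel. indicator {x - 1..x} y * ((f y)\<^sup>2 + (g y)\<^sup>2))"
proof -
  note on = locally_integrable_integrable_on
  have l: "locally_integrable (\<lambda>y. (f y)\<^sup>2 + (g y)\<^sup>2)" "locally_integrable (\<lambda>y. (f y)\<^sup>2)"
    using f g by (auto intro!: locally_integrable_integrable L2_integrable_square)
  define A where "A = integral {x - 1..x} (\<lambda>y. (f y)\<^sup>2 + (g y)\<^sup>2)"
  have pt: "(f x)\<^sup>2 \<le> (f y)\<^sup>2 + A" if y: "y \<in> {x - 1..x}" for y
  proof -
    have "(f x)\<^sup>2 - (f y)\<^sup>2 = integral {y..x} (\<lambda>z. 2 * f z * g z)"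
      using y by (simp add: primitive_integral[OF primitive_square[OF p]])
    also have "\<dots> \<le> integral {y..x} (\<lambda>z. (f z)\<^sup>2 + (g z)\<^sup>2)"
      by (intro integral_le on l primitive_locally_integrable[OF primitive_square[OF p]]) (rule sum_squares_bound)
    also have "\<dots> \<le> A" unfolding A_def using y by (intro integral_subset_le on l) auto
    finally show ?thesis by simp
  qed
  have "integral {x - 1..x} (\<lambda>_. (f x)\<^sup>2) \<le> integral {x - 1..x} (\<lambda>y. (f y)\<^sup>2 + A)"
    by (intro integral_le integrable_add on l pt locally_integrable_continuous continuous_on_const)
  also have "\<dots> = integral {x - 1..x} (\<lambda>y. (f y)\<^sup>2) + A"
    by (subst Henstock_Kurzweil_Integration.integral_add) (auto intro: on l locally_integrable_continuous)
  also have "integral {x - 1..x} (\<lambda>y. (f y)\<^sup>2) \<le> A"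
    unfolding A_def by (intro integral_le on l) auto
  finally show ?thesis using locally_integrable_LINT[OF l(1), of "x - 1" x] by (simp add: A_def)
qed

lemma primitive_decay:
  assumes p: "primitive f g" and f: "L2 f" and g: "L2 g" and "e > 0"
  shows "\<exists>N. \<forall>x. \<bar>x\<bar> \<ge> N \<longrightarrow> \<bar>f x\<bar> < e"
proof -
  define H where "H y = (f y)\<^sup>2 + (g y)\<^sup>2" for y
  have iH: "integrable lborel H" using f g by (auto simp: H_def[abs_def] L2_integrable_square)
  have [measurable]: "H \<in> borel_measurable borel" using iH by auto
  have H0: "H y \<ge> 0" for y by (simp add: H_def)
  have "(\<lambda>i. LINT y|lborel. indicator {y. real i \<le> \<bar>y\<bar>} y * H y) \<longlonglongrightarrow> (LINT y|(lborel::real measure). 0)"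
  proof (rule integral_dominated_convergence[where w = H])
    have "(\<lambda>i. indicator {y. real i \<le> \<bar>y\<bar>} y * H y) \<longlonglongrightarrow> 0" for y :: real
    proof -
      obtain N where "\<bar>y\<bar> < real N" using reals_Archimedean2 by blast
      then have "\<forall>\<^sub>F i in sequentially. indicator {y. real i \<le> \<bar>y\<bar>} y * H y = 0"
        by (intro eventually_sequentiallyI[of N]) (simp add: indicator_def)
      then show ?thesis by (rule tendsto_eventually)
    qed
    then show "AE y in lborel. (\<lambda>i. indicator {y. real i \<le> \<bar>y\<bar>} y * H y) \<longlonglongrightarrow> 0" by auto
  qed (use iH H0 in \<open>auto simp: indicator_def\<close>)
  then have "\<forall>\<^sub>F i in sequentially. (LINT y|lborel. indicator {y. real i \<le> \<bar>y\<bar>} y * H y) < e\<^sup>2 / 2"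
    using \<open>e > 0\<close> by (intro order_tendstoD) auto
  then obtain i where i: "(LINT y|lborel. indicator {y. real i \<le> \<bar>y\<bar>} y * H y) < e\<^sup>2 / 2"
    by (auto simp: eventually_sequentially)
  \<comment> \<open>The extra 1 keeps the whole interval [x - 1, x] in the region where |y| \<ge>
    i.\<close>
  have "\<bar>f x\<bar> < e" if "\<bar>x\<bar> \<ge> real i + 1" for x
  proof -
    have "(f x)\<^sup>2 \<le> 2 * (LINT y|lborel. indicator {x - 1..x} y * H y)"
      using primitive_sup_bound[OF p f g] by (simp add: H_def)
    also have "(LINT y|lborel. indicator {x - 1..x} y * H y) \<le> (LINT y|lborel. indicator {y. real i \<le> \<bar>y\<bar>} y * H y)"
    proof (rule integral_mono)
      show "integrable lborel (\<lambda>y. indicator {x - 1..x} y * H y)"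
        "integrable lborel (\<lambda>y. indicator {y. real i \<le> \<bar>y\<bar>} y * H y)"
        using integrable_real_mult_indicator[OF _ iH] by (simp_all add: mult.commute)
    qed (use that H0 in \<open>auto simp: indicator_def\<close>)
    finally have "(f x)\<^sup>2 < e\<^sup>2" using i by simp
    then show ?thesis using \<open>e > 0\<close> by (metis abs_le_square_iff abs_of_pos linorder_not_le)
  qed
  then show ?thesis by blast
qed

text \<open>Both factors decay, so the boundary terms f g at -i and i vanish in the limit. This
  integration by parts over the whole line is the source of all energy estimates below.\<close>

lemma integral_product_derivative_zero:
  assumes p: "primitive f f'" "primitive g g'" and l: "L2 f" "L2 f'" "L2 g" "L2 g'"
  shows "(LINT x|lborel. f' x * g x + f x * g' x) = 0"
proof -
  define h where "h x = f' x * g x + f x * g' x" for x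
  have ih: "integrable lborel h" using l by (auto simp: h_def[abs_def] intro!: L2_integrable_mult)
  have [measurable]: "h \<in> borel_measurable borel" using ih by auto
  have ph: "primitive (\<lambda>x. f x * g x) h" unfolding h_def[abs_def] by (intro primitive_mult p)
  have "(\<lambda>i. LINT x|lborel. indicator {- real i..real i} x * h x) \<longlonglongrightarrow> (LINT x|lborel. h x)"
  proof (rule integral_dominated_convergence[where w = "\<lambda>x. \<bar>h x\<bar>"])
    have "(\<lambda>i. indicator {- real i..real i} x * h x) \<longlonglongrightarrow> h x" for x :: real
    proof -
      obtain N where "\<bar>x\<bar> < real N" using reals_Archimedean2 by blast
      then have "\<forall>\<^sub>F i in sequentially. indicator {- real i..real i} x * h x = h x"
        by (auto intro!: eventually_sequentiallyI[of N] simp: indicator_def)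
      then show ?thesis by (rule tendsto_eventually)
    qed
    then show "AE x in lborel. (\<lambda>i. indicator {- real i..real i} x * h x) \<longlonglongrightarrow> h x" by auto
  qed (use ih in \<open>auto simp: indicator_def\<close>)
  moreover have "(\<lambda>i. LINT x|lborel. indicator {- real i..real i} x * h x) \<longlonglongrightarrow> 0"
  proof (rule LIMSEQ_I)
    fix e :: real assume "e > 0"
    \<comment> \<open>Since both factors are below e' \<le> 1, their product is below e', and the
      two boundary terms together stay below 2 e' \<le> e.\<close>
    define e' where "e' = min 1 (e / 2)"
    have e': "e' > 0" "e' \<le> 1" "2 * e' \<le> e" using \<open>e > 0\<close> by (auto simp: e'_def)
    obtain N M where N: "\<And>x. \<bar>x\<bar> \<ge> N \<Longrightarrow> \<bar>f x\<bar> < e'" and M: "\<And>x. \<bar>x\<bar> \<ge> M \<Longrightarrow> \<bar>g x\<bar> < e'"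
      using primitive_decay[OF p(1) l(1,2) e'(1)] primitive_decay[OF p(2) l(3,4) e'(1)] by blast
    obtain k where k: "real k \<ge> max N M" using real_arch_simple by blast
    have "\<bar>LINT x|lborel. indicator {- real i..real i} x * h x\<bar> < e" if "i \<ge> k" for i
    proof -
      have b: "\<bar>f x * g x\<bar> < e'" if "\<bar>x\<bar> = real i" for x
      proof -
        have "\<bar>f x\<bar> < e'" "\<bar>g x\<bar> < e'" using that \<open>i \<ge> k\<close> k by (auto intro!: N M)
        then have "\<bar>f x\<bar> * \<bar>g x\<bar> \<le> \<bar>f x\<bar> * 1" using e' by (intro mult_left_mono) auto
        then show ?thesis using \<open>\<bar>f x\<bar> < e'\<close> by (simp add: abs_mult)
      qed
      have "(LINT x|lborel. indicator {- real i..real i} x * h x) = f (real i) * g (real i) - f (- real i) * g (- real i)"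
        using locally_integrable_LINT[OF primitive_locally_integrable[OF ph]] primitive_integral[OF ph, of "- real i" "real i"] by simp
      then show ?thesis using b[of "real i"] b[of "- real i"] e' by linarith
    qed
    then show "\<exists>k. \<forall>i\<ge>k. norm ((LINT x|lborel. indicator {- real i..real i} x * h x) - 0) < e" by auto
  qed
  ultimately show ?thesis unfolding h_def[symmetric] by (rule LIMSEQ_unique)
qed

section \<open>The Hilbert space of square integrable functions\<close>

\<comment> \<open>A separate type makes the theory of Banach and inner product spaces applicable.
  The quotient is partial: a function that is not square integrable is not related even to
  itself.\<close>
quotient_type l2 = "real \<Rightarrow> real" / partial: "\<lambda>f g. L2 f \<and> L2 g \<and> (AE x in lborel. f x = g x)"
proof (rule part_equivpI)
  show "\<exists>f. L2 f \<and> L2 f \<and> (AE x in lborel. f x = f x)" using L2_zero by auto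
  show "symp (\<lambda>f g. L2 f \<and> L2 g \<and> (AE x in lborel. f x = g x))"
    by (auto simp: symp_def elim!: eventually_mono)
  show "transp (\<lambda>f g. L2 f \<and> L2 g \<and> (AE x in lborel. f x = g x))"
    by (auto simp: transp_def elim!: eventually_elim2)
qed

instantiation l2 :: real_inner
begin

lift_definition zero_l2 :: l2 is "\<lambda>x. 0" by (simp add: L2_zero)

lift_definition plus_l2 :: "l2 \<Rightarrow> l2 \<Rightarrow> l2" is "\<lambda>f g x. f x + g x"
  by (auto intro!: L2_add elim!: eventually_elim2)

lift_definition minus_l2 :: "l2 \<Rightarrow> l2 \<Rightarrow> l2" is "\<lambda>f g x. f x - g x"
  by (auto intro!: L2_diff elim!: eventually_elim2)

lift_definition uminus_l2 :: "l2 \<Rightarrow> l2" is "\<lambda>f x. - 1 * f x"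
  by (auto intro!: L2_cmult[of _ "-1", simplified] elim!: eventually_mono)

lift_definition scaleR_l2 :: "real \<Rightarrow> l2 \<Rightarrow> l2" is "\<lambda>c f x. c * f x"
  by (auto intro!: L2_cmult elim!: eventually_mono)

lift_definition inner_l2 :: "l2 \<Rightarrow> l2 \<Rightarrow> real" is "\<lambda>f g. LINT x|lborel. f x * g x"
  by (rule integral_cong_AE) (auto simp: L2_def elim!: eventually_elim2)

definition norm_l2 :: "l2 \<Rightarrow> real" where "norm_l2 x = sqrt (inner x x)"

definition sgn_l2 :: "l2 \<Rightarrow> l2" where "sgn_l2 x = scaleR (inverse (norm x)) x"

definition dist_l2 :: "l2 \<Rightarrow> l2 \<Rightarrow> real" where "dist_l2 x y = norm (x - y)"

definition uniformity_l2 :: "(l2 \<times> l2) filter" where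
  "uniformity_l2 = (INF e\<in>{0<..}. principal {(x, y). dist x y < e})"

definition open_l2 :: "l2 set \<Rightarrow> bool" where
  "open_l2 U = (\<forall>x\<in>U. \<forall>\<^sub>F (x', y) in uniformity. x' = x \<longrightarrow> y \<in> U)"

instance
proof
  fix x y z :: l2 and a b :: real
  show "x + y + z = x + (y + z)" by transfer (auto intro!: L2_add simp: add.assoc)
  show "x + y = y + x" by transfer (auto intro!: L2_add simp: add.commute)
  show "0 + x = x" by transfer auto
  show "- x + x = 0" by transfer (auto simp: L2_zero)
  show "x - y = x + - y" by transfer (auto intro!: L2_diff)
  show "a *\<^sub>R (x + y) = a *\<^sub>R x + a *\<^sub>R y"
    by transfer (auto intro!: L2_add L2_cmult L2_cmult[OF L2_add] simp: distrib_left)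
  show "(a + b) *\<^sub>R x = a *\<^sub>R x + b *\<^sub>R x"
    by transfer (auto intro!: L2_add L2_cmult simp: distrib_right)
  show "a *\<^sub>R b *\<^sub>R x = (a * b) *\<^sub>R x" by transfer (auto intro!: L2_cmult simp: mult.assoc)
  show "1 *\<^sub>R x = x" by transfer auto
  show "dist x y = norm (x - y)" by (rule dist_l2_def)
  show "sgn x = scaleR (inverse (norm x)) x" by (rule sgn_l2_def)
  show "uniformity = (INF e\<in>{0<..}. principal {(x :: l2, y). dist x y < e})" by (rule uniformity_l2_def)
  show "open U = (\<forall>x\<in>U. \<forall>\<^sub>F (x', y) in uniformity. x' = x \<longrightarrow> y \<in> U)" for U :: "l2 set" by (rule open_l2_def)
  show "inner x y = inner y x" by transfer (simp add: mult.commute)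
  show "inner (x + y) z = inner x z + inner y z"
    by transfer (simp add: distrib_right L2_integrable_mult)
  show "inner (a *\<^sub>R x) y = a * inner x y" by transfer (simp add: mult.assoc)
  show "0 \<le> inner x x" by transfer simp
  show "inner x x = 0 \<longleftrightarrow> x = 0"
    by transfer (simp add: L2_zero integral_nonneg_eq_0_iff_AE L2_integrable_mult)
  show "norm x = sqrt (inner x x)" by (rule norm_l2_def)
qed

end

lemma L2_rep: "L2 (rep_l2 e)"
  using Quotient_l2 Quotient_rep_reflp by fastforce

lemma abs_rep_l2: "abs_l2 (rep_l2 e) = e"
  using Quotient_l2 Quotient_abs_rep by fastforce

lemma abs_l2_eq_iff: "L2 f \<Longrightarrow> L2 g \<Longrightarrow> abs_l2 f = abs_l2 g \<longleftrightarrow> (AE x in lborel. f x = g x)"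
  using Quotient_rel[OF Quotient_l2, of f g] by auto

lemma rep_abs_l2: "L2 f \<Longrightarrow> AE x in lborel. rep_l2 (abs_l2 f) x = f x"
  using abs_l2_eq_iff[of "rep_l2 (abs_l2 f)" f] by (simp add: L2_rep abs_rep_l2)

lemma abs_l2_add: "L2 f \<Longrightarrow> L2 g \<Longrightarrow> abs_l2 (\<lambda>x. f x + g x) = abs_l2 f + abs_l2 g"
  by (simp add: plus_l2.abs_eq)

lemma abs_l2_diff: "L2 f \<Longrightarrow> L2 g \<Longrightarrow> abs_l2 (\<lambda>x. f x - g x) = abs_l2 f - abs_l2 g"
  by (simp add: minus_l2.abs_eq)

lemma abs_l2_scaleR: "L2 f \<Longrightarrow> abs_l2 (\<lambda>x. c * f x) = c *\<^sub>R abs_l2 f"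
  by (simp add: scaleR_l2.abs_eq)

lemma inner_abs_l2: "L2 f \<Longrightarrow> L2 g \<Longrightarrow> inner (abs_l2 f) (abs_l2 g) = (LINT x|lborel. f x * g x)"
  by (simp add: inner_l2.abs_eq)

lemma norm_abs_l2: "L2 f \<Longrightarrow> norm (abs_l2 f) = sqrt (LINT x|lborel. (f x)\<^sup>2)"
  by (simp add: norm_l2_def inner_abs_l2 power2_eq_square)

lemma norm_diff_rep: "norm (d - e) = sqrt (LINT x|lborel. (rep_l2 d x - rep_l2 e x)\<^sup>2)"
  using norm_abs_l2[OF L2_diff[OF L2_rep L2_rep], of d e] by (simp add: abs_l2_diff L2_rep abs_rep_l2)

text \<open>The argument of Riesz and Fischer. Along a subsequence the steps have norm below 4^-i,
  hence squares with integral at most 16^-i; weighted by 4^i these are summable, so at almost every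
  point the steps are O(2^-i) and the subsequence converges. Fatou's lemma gives convergence to the
  pointwise limit in the norm.\<close>

instance l2 :: banach
proof
  fix X :: "nat \<Rightarrow> l2" assume X: "Cauchy X"
  have "\<exists>N. \<forall>m\<ge>N. \<forall>n\<ge>N. norm (X m - X n) < (1/4) ^ i" for i :: nat
    using X by (auto simp: Cauchy_iff)
  then obtain N where N: "norm (X m - X n) < (1/4) ^ i" if "m \<ge> N i" "n \<ge> N i" for i m n by metis
  \<comment> \<open>A partial sum of the N j exceeds each of its summands, so r j is beyond every
    threshold N i with i \<le> j.\<close>
  define r where "r i = (\<Sum>j\<le>i. N j)" for i
  have rN: "r j \<ge> N i" if "i \<le> j" for i j
    unfolding r_def using that by (intro member_le_sum) auto
  define f where "f i = rep_l2 (X (r i))" for i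
  have fL: "L2 (f i)" for i by (simp add: f_def L2_rep)
  have [measurable]: "f i \<in> borel_measurable borel" for i using fL by (auto simp: L2_def)
  have fd: "(\<integral>\<^sup>+x. ennreal ((f j x - f i x)\<^sup>2) \<partial>lborel) \<le> ennreal ((1/16) ^ i)" if "i \<le> j" for i j
  proof -
    have "(\<integral>\<^sup>+x. ennreal ((f j x - f i x)\<^sup>2) \<partial>lborel) = ennreal (LINT x|lborel. (f j x - f i x)\<^sup>2)"
      using L2_integrable_square[OF L2_diff[OF fL fL]] by (intro nn_integral_eq_integral) auto
    moreover have "(LINT x|lborel. (f j x - f i x)\<^sup>2) = (norm (X (r j) - X (r i)))\<^sup>2"
      by (simp add: norm_diff_rep f_def)
    moreover have "(norm (X (r j) - X (r i)))\<^sup>2 \<le> ((1/4) ^ i)\<^sup>2"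
      using N[OF rN[OF that] rN[OF order_refl]] by (intro power_mono) auto
    ultimately show ?thesis by (simp add: power2_eq_square flip: power_mult_distrib)
  qed
  have "(\<integral>\<^sup>+x. (\<Sum>i. ennreal (4 ^ i * (f (Suc i) x - f i x)\<^sup>2)) \<partial>lborel)
      = (\<Sum>i. \<integral>\<^sup>+x. ennreal (4 ^ i * (f (Suc i) x - f i x)\<^sup>2) \<partial>lborel)"
    by (intro nn_integral_suminf) measurable
  also have "\<dots> \<le> (\<Sum>i. ennreal ((1/4) ^ i))"
  proof (intro suminf_le allI)
    fix i
    have "(\<integral>\<^sup>+x. ennreal (4 ^ i * (f (Suc i) x - f i x)\<^sup>2) \<partial>lborel)
        = ennreal (4 ^ i) * (\<integral>\<^sup>+x. ennreal ((f (Suc i) x - f i x)\<^sup>2) \<partial>lborel)"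
      by (subst nn_integral_cmult[symmetric]) (auto simp: ennreal_mult)
    also have "\<dots> \<le> ennreal (4 ^ i) * ennreal ((1/16) ^ i)" by (intro mult_left_mono fd) auto
    also have "\<dots> = ennreal ((1/4) ^ i)"
      by (simp add: ennreal_mult[symmetric] power_mult_distrib[symmetric] del: power_one_over)
    finally show "(\<integral>\<^sup>+x. ennreal (4 ^ i * (f (Suc i) x - f i x)\<^sup>2) \<partial>lborel) \<le> ennreal ((1/4) ^ i)" .
  qed auto
  also have "\<dots> = ennreal (\<Sum>i. (1/4) ^ i)"
    by (intro suminf_ennreal2 summable_geometric) auto
  also have "\<dots> < \<infinity>" by simp
  finally have "AE x in lborel. (\<Sum>i. ennreal (4 ^ i * (f (Suc i) x - f i x)\<^sup>2)) \<noteq> \<infinity>"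
    by (intro nn_integral_PInf_AE) auto
  then have conv: "AE x in lborel. convergent (\<lambda>i. f i x)"
  proof eventually_elim
    case (elim x)
    have "summable (\<lambda>i. 4 ^ i * (f (Suc i) x - f i x)\<^sup>2)"
      using elim by (intro summable_suminf_not_top) (auto simp: top_ennreal_def infinity_ennreal_def)
    then have "Bseq (\<lambda>i. 4 ^ i * (f (Suc i) x - f i x)\<^sup>2)"
      by (intro convergent_imp_Bseq) (auto intro: convergentI dest: summable_LIMSEQ_zero)
    then obtain K where K: "K > 0" "\<And>i. norm (4 ^ i * (f (Suc i) x - f i x)\<^sup>2) \<le> K" unfolding Bseq_def by blast
    have bd: "norm (f (Suc i) x - f i x) \<le> sqrt K * (1/2) ^ i" for i
    proof -
      have "((2::real) ^ i)\<^sup>2 = 4 ^ i" by (simp add: power2_eq_square flip: power_mult_distrib)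
      then have "(2 ^ i * \<bar>f (Suc i) x - f i x\<bar>)\<^sup>2 \<le> K"
        using K(2)[of i] by (simp add: power_mult_distrib)
      then have "2 ^ i * \<bar>f (Suc i) x - f i x\<bar> \<le> sqrt K" by (rule real_le_rsqrt)
      then show ?thesis by (simp add: field_simps)
    qed
    have "summable (\<lambda>i. sqrt K * (1/2::real) ^ i)" by (intro summable_mult summable_geometric) simp
    from summable_comparison_test'[OF this bd] have "summable (\<lambda>i. f (Suc i) x - f i x)" .
    then have "convergent (\<lambda>n. \<Sum>i<n. f (Suc i) x - f i x)" by (simp only: summable_iff_convergent)
    then have "convergent (\<lambda>n. f n x - f 0 x)" using sum_lessThan_telescope[of "\<lambda>i. f i x"] by simp
    from convergent_add[OF this convergent_const[of "f 0 x"]] show ?case by simp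
  qed
  define F where "F x = lim (\<lambda>i. f i x)" for x
  have [measurable]: "F \<in> borel_measurable borel"
    unfolding F_def[abs_def] by (rule borel_measurable_lim_metric) simp
  have Fd: "(\<integral>\<^sup>+x. ennreal ((F x - f i x)\<^sup>2) \<partial>lborel) \<le> ennreal ((1/16) ^ i)" for i
  proof -
    have "(\<integral>\<^sup>+x. ennreal ((F x - f i x)\<^sup>2) \<partial>lborel) = (\<integral>\<^sup>+x. liminf (\<lambda>j. ennreal ((f j x - f i x)\<^sup>2)) \<partial>lborel)"
    proof (rule nn_integral_cong_AE)
      show "AE x in lborel. ennreal ((F x - f i x)\<^sup>2) = liminf (\<lambda>j. ennreal ((f j x - f i x)\<^sup>2))"
        using conv
      proof eventually_elim
        case (elim x)
        then have "(\<lambda>j. f j x) \<longlonglongrightarrow> F x" by (simp add: F_def convergent_LIMSEQ_iff)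
        then have "(\<lambda>j. ennreal ((f j x - f i x)\<^sup>2)) \<longlonglongrightarrow> ennreal ((F x - f i x)\<^sup>2)"
          by (intro tendsto_intros)
        then show ?case by (intro lim_imp_Liminf[symmetric]) auto
      qed
    qed
    also have "\<dots> \<le> liminf (\<lambda>j. \<integral>\<^sup>+x. ennreal ((f j x - f i x)\<^sup>2) \<partial>lborel)"
      by (intro nn_integral_liminf) measurable
    also have "\<dots> \<le> liminf (\<lambda>j. ennreal ((1/16) ^ i))"
      by (intro Liminf_mono eventually_sequentiallyI[of i] fd)
    finally show ?thesis by (simp add: Liminf_const)
  qed
  have iF: "integrable lborel (\<lambda>x. (F x - f i x)\<^sup>2)" for i
    using Fd[of i] by (intro integrableI_nonneg) (auto simp: less_top[symmetric] top_unique dest: order_le_less_trans)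
  then have LF': "L2 (\<lambda>x. F x - f i x)" for i by (simp add: L2_def)
  have LF: "L2 F" using L2_add[OF LF'[of 0] fL[of 0]] by simp
  have dF: "norm (abs_l2 F - X (r i)) \<le> (1/4) ^ i" for i
  proof -
    have "abs_l2 F - X (r i) = abs_l2 (\<lambda>x. F x - f i x)"
      using abs_l2_diff[OF LF fL] by (simp add: f_def abs_rep_l2)
    then have "(norm (abs_l2 F - X (r i)))\<^sup>2 = (LINT x|lborel. (F x - f i x)\<^sup>2)"
      by (simp add: norm_abs_l2[OF LF'])
    moreover have "ennreal (LINT x|lborel. (F x - f i x)\<^sup>2) \<le> ennreal ((1/16) ^ i)"
      using Fd[of i] iF[of i] by (subst nn_integral_eq_integral[symmetric]) auto
    ultimately have "(norm (abs_l2 F - X (r i)))\<^sup>2 \<le> ((1/4) ^ i)\<^sup>2"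
      by (simp add: power2_eq_square flip: power_mult_distrib)
    then show ?thesis by (simp add: abs_le_square_iff[symmetric] power2_le_iff_abs_le)
  qed
  have "X \<longlonglongrightarrow> abs_l2 F"
  proof (rule LIMSEQ_I)
    fix e :: real assume "e > 0"
    then obtain i where i: "(1/4) ^ i < e / 2" using real_arch_pow_inv[of "e / 2" "1/4"] by auto
    have "norm (X n - abs_l2 F) < e" if "n \<ge> N i" for n
      using N[OF that rN[OF order_refl]] dF[of i] i norm_triangle_ineq4[of "X n - X (r i)" "abs_l2 F - X (r i)"]
      by simp
    then show "\<exists>no. \<forall>n\<ge>no. norm (X n - abs_l2 F) < e" by blast
  qed
  then show "convergent X" by (rule convergentI)
qed

section \<open>Sobolev norms and products\<close>

declare One_nat_def [simp del]

section \<open>Weak derivatives and their representatives\<close>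

lemma weak_derivative_1:
  "weak_derivative 1 f g \<longleftrightarrow> (\<forall>\<psi>. test_function \<psi> \<longrightarrow>
     (LINT z|lborel. f z * deriv \<psi> z) = - (LINT z|lborel. g z * \<psi> z))"
  by (simp add: weak_derivative_def One_nat_def)

lemma weak_derivative_cong:
  assumes "AE x in lborel. f x = f' x" "f \<in> borel_measurable borel" "f' \<in> borel_measurable borel"
  shows "weak_derivative j f g \<longleftrightarrow> weak_derivative j f' g"
proof -
  have "(LINT z|lborel. f z * (deriv ^^ j) \<psi> z) = (LINT z|lborel. f' z * (deriv ^^ j) \<psi> z)"
    if "test_function \<psi>" for \<psi>
    using assms smooth_measurable[OF smooth_funpow[OF test_function_smooth[OF that]], of j]
    by (intro integral_cong_AE) (auto elim!: eventually_mono)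
  then show ?thesis by (auto simp: weak_derivative_def)
qed

lemma weak_derivative_cong_right:
  assumes "AE x in lborel. g x = g' x" "g \<in> borel_measurable borel" "g' \<in> borel_measurable borel"
  shows "weak_derivative j f g \<longleftrightarrow> weak_derivative j f g'"
proof -
  have "(LINT z|lborel. g z * \<psi> z) = (LINT z|lborel. g' z * \<psi> z)"
    if "test_function \<psi>" for \<psi>
    using assms smooth_measurable[OF test_function_smooth[OF that]]
    by (intro integral_cong_AE) (auto elim!: eventually_mono)
  then show ?thesis by (auto simp: weak_derivative_def)
qed

lemma weak_D_props:
  assumes "L2 g" "weak_derivative j f g"
  shows "L2 (weak_D j f)" "weak_derivative j f (weak_D j f)" "AE x in lborel. weak_D j f x = g x"
proof -
  have *: "L2 (weak_D j f) \<and> weak_derivative j f (weak_D j f)"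
    unfolding weak_D_def by (rule someI[of _ g]) (use assms in auto)
  then show "L2 (weak_D j f)" "weak_derivative j f (weak_D j f)" by auto
  show "AE x in lborel. weak_D j f x = g x"
    using * assms by (intro weak_derivative_unique[of j f]) (auto intro: L2_locally_integrable)
qed

lemma weak_derivative_0: "weak_derivative 0 f f"
  by (simp add: weak_derivative_def)

text \<open>One step of the recursion in k: H^(k+1) consists of those f for which
  \<open>weakly_diff f g\<close> holds with g in H^k. Everything about derivatives of higher order
  is reduced to this relation by induction.\<close>

definition weakly_diff :: "(real \<Rightarrow> real) \<Rightarrow> (real \<Rightarrow> real) \<Rightarrow> bool" where
  "weakly_diff f g \<longleftrightarrow> L2 f \<and> L2 g \<and> weak_derivative 1 f g"

lemma weakly_diffD: "weakly_diff f g \<Longrightarrow> L2 f" "weakly_diff f g \<Longrightarrow> L2 g" "weakly_diff f g \<Longrightarrow> weak_derivative 1 f g"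
  by (auto simp: weakly_diff_def)

lemma weakly_diff_Suc:
  assumes "weakly_diff f g" shows "weak_derivative (Suc j) f h \<longleftrightarrow> weak_derivative j g h"
proof -
  have "(LINT z|lborel. f z * (deriv ^^ Suc j) \<psi> z) = - (LINT z|lborel. g z * (deriv ^^ j) \<psi> z)"
    if "test_function \<psi>" for \<psi>
    using weakly_diffD(3)[OF assms, unfolded weak_derivative_1, rule_format, OF test_function_funpow[OF that, of j]]
    by simp
  then show ?thesis by (simp add: weak_derivative_def)
qed

text \<open>An equality of functions and not only almost everywhere: both sides choose by
  \<open>SOME\<close> from the same set of candidates.\<close>

lemma weakly_diff_weak_D_Suc: "weakly_diff f g \<Longrightarrow> weak_D (Suc j) f = weak_D j g"
  by (simp add: weak_D_def weakly_diff_Suc)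

lemma weakly_diff_cong:
  assumes "weakly_diff f g" "AE x in lborel. f x = f' x" "AE x in lborel. g x = g' x" "L2 f'" "L2 g'"
  shows "weakly_diff f' g'"
  using assms weak_derivative_cong[OF assms(2)] weak_derivative_cong_right[OF assms(3)]
  by (auto simp: weakly_diff_def L2_def)

section \<open>The spaces H^k and their norms\<close>

lemma Hk_0: "Hk 0 f \<longleftrightarrow> L2 f"
  using weak_derivative_0 by (auto simp: Hk_def)

lemma Hk_L2: "Hk k f \<Longrightarrow> L2 f"
  by (simp add: Hk_def)

lemma Hk_mono: "Hk k f \<Longrightarrow> j \<le> k \<Longrightarrow> Hk j f"
  by (auto simp: Hk_def)

lemma Hk_weakly_diff: assumes "Hk (Suc k) f" shows "weakly_diff f (weak_D 1 f)"
proof -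
  obtain g where "L2 g" "weak_derivative 1 f g" using assms unfolding Hk_def by (metis Suc_le_mono le0 One_nat_def)
  from weak_D_props[OF this] assms show ?thesis by (simp add: weakly_diff_def Hk_def)
qed

lemma Hk_Suc_weakly_diff:
  assumes "weakly_diff f g" shows "Hk (Suc k) f \<longleftrightarrow> Hk k g"
proof -
  have "(\<forall>j\<le>Suc k. \<exists>h. L2 h \<and> weak_derivative j f h) \<longleftrightarrow> (\<forall>j\<le>k. \<exists>h. L2 h \<and> weak_derivative (Suc j) f h)"
    unfolding less_Suc_eq_le[symmetric] All_less_Suc2 using weakly_diffD(1)[OF assms] weak_derivative_0[of f] by blast
  then show ?thesis using assms by (simp add: Hk_def weakly_diff_Suc weakly_diffD)
qed

lemma Hk_weak_D: "Hk (Suc k) f \<Longrightarrow> Hk k (weak_D 1 f)"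
  using Hk_Suc_weakly_diff[OF Hk_weakly_diff] by blast

lemma Hk_cong:
  assumes "AE x in lborel. f x = f' x" "L2 f" "L2 f'"
  shows "Hk k f \<longleftrightarrow> Hk k f'" "Hk_norm k f = Hk_norm k f'" "weak_D j f = weak_D j f'"
proof -
  have *: "weak_derivative j f = weak_derivative j f'" for j
    using weak_derivative_cong[OF assms(1)] assms(2,3) by (auto simp: L2_def)
  show "Hk k f \<longleftrightarrow> Hk k f'" using assms by (simp add: Hk_def *)
  show "Hk_norm k f = Hk_norm k f'" by (simp add: Hk_norm_def weak_D_def *)
  show "weak_D j f = weak_D j f'" by (simp add: weak_D_def *)
qed

lemma Hk_norm_nonneg [simp]: "0 \<le> Hk_norm k f"
  by (auto simp: Hk_norm_def intro!: sum_nonneg integral_nonneg_AE)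

lemma Hk_norm_mono: "j \<le> k \<Longrightarrow> Hk_norm j f \<le> Hk_norm k f"
  by (auto simp: Hk_norm_def intro!: sum_mono2 integral_nonneg_AE)

lemma weak_D_0_integral:
  assumes "L2 f" shows "(LINT z|lborel. (weak_D 0 f z)\<^sup>2) = (norm (abs_l2 f))\<^sup>2"
proof -
  have "(LINT z|lborel. (weak_D 0 f z)\<^sup>2) = (LINT z|lborel. (f z)\<^sup>2)"
    using weak_D_props[OF assms weak_derivative_0] assms
    by (intro integral_cong_AE) (auto simp: L2_def elim!: eventually_mono)
  then show ?thesis using assms by (simp add: norm_abs_l2)
qed

lemma Hk_norm_0: "L2 f \<Longrightarrow> Hk_norm 0 f = norm (abs_l2 f)"
  by (simp add: Hk_norm_def weak_D_0_integral)

lemma Hk_norm_Suc: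
  assumes "weakly_diff f g"
  shows "Hk_norm (Suc k) f = sqrt ((norm (abs_l2 f))\<^sup>2 + (Hk_norm k g)\<^sup>2)"
proof -
  have "(\<Sum>j\<le>Suc k. LINT z|lborel. (weak_D j f z)\<^sup>2)
      = (norm (abs_l2 f))\<^sup>2 + (\<Sum>j\<le>k. LINT z|lborel. (weak_D j g z)\<^sup>2)"
    unfolding sum.atMost_Suc_shift using assms by (simp add: weak_D_0_integral weakly_diffD weakly_diff_weak_D_Suc)
  moreover have "(\<Sum>j\<le>k. LINT z|lborel. (weak_D j g z)\<^sup>2) = (Hk_norm k g)\<^sup>2"
    unfolding Hk_norm_def by (rule real_sqrt_pow2[symmetric]) (auto intro!: sum_nonneg integral_nonneg_AE)
  ultimately show ?thesis unfolding Hk_norm_def[of "Suc k" f] by (simp only:)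
qed

lemma Hk_norm_Suc_ge:
  assumes "weakly_diff f g" shows "norm (abs_l2 f) \<le> Hk_norm (Suc k) f" "Hk_norm k g \<le> Hk_norm (Suc k) f"
  by (auto simp: Hk_norm_Suc[OF assms] intro!: real_le_rsqrt)

lemma Hk_norm_Suc_le:
  assumes "weakly_diff f g" shows "Hk_norm (Suc k) f \<le> norm (abs_l2 f) + Hk_norm k g"
  using sqrt_add_le_add_sqrt[of "(norm (abs_l2 f))\<^sup>2" "(Hk_norm k g)\<^sup>2"] by (simp add: Hk_norm_Suc[OF assms])

lemma norm_le_Hk_norm: "L2 f \<Longrightarrow> norm (abs_l2 f) \<le> Hk_norm k f"
  using Hk_norm_mono[of 0 k f] by (simp add: Hk_norm_0)

lemma weakly_diff_add:
  assumes "weakly_diff f f'" "weakly_diff g g'" shows "weakly_diff (\<lambda>x. f x + g x) (\<lambda>x. f' x + g' x)"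
proof -
  note L = assms[THEN weakly_diffD(1)] assms[THEN weakly_diffD(2)]
  have "(LINT z|lborel. (f z + g z) * deriv \<psi> z) = - (LINT z|lborel. (f' z + g' z) * \<psi> z)"
    if t: "test_function \<psi>" for \<psi>
    using assms[THEN weakly_diffD(3), unfolded weak_derivative_1, rule_format, OF t]
      L[THEN L2_locally_integrable, THEN integrable_test_mult, OF t]
      L[THEN L2_locally_integrable, THEN integrable_test_mult, OF test_function_deriv[OF t]]
    by (simp add: distrib_right)
  then show ?thesis using L by (auto simp: weakly_diff_def weak_derivative_1 intro!: L2_add)
qed

lemma weakly_diff_cmult: "weakly_diff f f' \<Longrightarrow> weakly_diff (\<lambda>x. c * f x) (\<lambda>x. c * f' x)"
  by (auto simp: weakly_diff_def weak_derivative_def mult.assoc intro!: L2_cmult)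

lemma weakly_diff_diff: "weakly_diff f f' \<Longrightarrow> weakly_diff g g' \<Longrightarrow> weakly_diff (\<lambda>x. f x - g x) (\<lambda>x. f' x - g' x)"
  using weakly_diff_add[of f f' "\<lambda>x. -1 * g x" "\<lambda>x. -1 * g' x"] weakly_diff_cmult[of g g' "-1"] by simp

lemma Hk_add: "Hk k f \<Longrightarrow> Hk k g \<Longrightarrow> Hk k (\<lambda>x. f x + g x)"
proof (induction k arbitrary: f g)
  case 0
  then show ?case by (simp add: Hk_0 L2_add)
next
  case (Suc k)
  then show ?case by (subst Hk_Suc_weakly_diff[OF weakly_diff_add[OF Hk_weakly_diff Hk_weakly_diff]]) (auto intro!: Suc.IH Hk_weak_D)
qed

lemma Hk_cmult: "Hk k f \<Longrightarrow> Hk k (\<lambda>x. c * f x)"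
proof (induction k arbitrary: f)
  case 0
  then show ?case by (simp add: Hk_0 L2_cmult)
next
  case (Suc k)
  then show ?case by (subst Hk_Suc_weakly_diff[OF weakly_diff_cmult[OF Hk_weakly_diff]]) (auto intro!: Suc.IH Hk_weak_D)
qed

lemma Hk_diff: "Hk k f \<Longrightarrow> Hk k g \<Longrightarrow> Hk k (\<lambda>x. f x - g x)"
  using Hk_add[of k f "\<lambda>x. -1 * g x"] Hk_cmult[of k g "-1"] by simp

lemma Hk_norm_cmult: "Hk k f \<Longrightarrow> Hk_norm k (\<lambda>x. c * f x) = \<bar>c\<bar> * Hk_norm k f"
proof (induction k arbitrary: f)
  case 0
  then show ?case by (simp add: Hk_0 Hk_norm_0 L2_cmult abs_l2_scaleR)
next
  case (Suc k)
  from Hk_weakly_diff[OF Suc.prems] show ?case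
    by (simp add: Hk_norm_Suc[OF weakly_diff_cmult] Hk_norm_Suc Suc.IH[OF Hk_weak_D[OF Suc.prems]] abs_l2_scaleR weakly_diffD power_mult_distrib
        distrib_left[symmetric] real_sqrt_mult)
qed

text \<open>By \<open>Hk_norm_Suc\<close> the norm is the Euclidean length of the pair formed by the
  L^2 norm of f and the norm of f', so the induction step is the triangle inequality in the
  plane.\<close>

lemma Hk_norm_triangle: "Hk k f \<Longrightarrow> Hk k g \<Longrightarrow> Hk_norm k (\<lambda>x. f x + g x) \<le> Hk_norm k f + Hk_norm k g"
proof (induction k arbitrary: f g)
  case 0
  then show ?case by (simp add: Hk_0 Hk_norm_0 L2_add abs_l2_add norm_triangle_ineq)
next
  case (Suc k)
  note w = Suc.prems[THEN Hk_weakly_diff]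
  have "Hk_norm (Suc k) (\<lambda>x. f x + g x) = sqrt ((norm (abs_l2 f + abs_l2 g))\<^sup>2
      + (Hk_norm k (\<lambda>x. weak_D 1 f x + weak_D 1 g x))\<^sup>2)"
    using w by (simp add: Hk_norm_Suc[OF weakly_diff_add[OF w]] abs_l2_add weakly_diffD)
  also have "\<dots> \<le> sqrt ((norm (abs_l2 f) + norm (abs_l2 g))\<^sup>2 + (Hk_norm k (weak_D 1 f) + Hk_norm k (weak_D 1 g))\<^sup>2)"
    by (intro real_sqrt_le_mono add_mono power_mono norm_triangle_ineq Suc.IH Hk_weak_D Suc.prems) auto
  also have "\<dots> \<le> Hk_norm (Suc k) f + Hk_norm (Suc k) g"
    by (simp only: Hk_norm_Suc[OF w(1)] Hk_norm_Suc[OF w(2)] real_sqrt_sum_squares_triangle_ineq)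
  finally show ?case .
qed

lemma Hk_norm_diff_triangle:
  "Hk k f \<Longrightarrow> Hk k g \<Longrightarrow> Hk_norm k (\<lambda>x. f x - g x) \<le> Hk_norm k f + Hk_norm k g"
  using Hk_norm_triangle[of k f "\<lambda>x. -1 * g x"] Hk_cmult[of k g "-1"] Hk_norm_cmult[of k g "-1"] by simp

section \<open>Continuous representatives and the Sobolev embedding\<close>

lemma continuous_AE_eq:
  fixes f g :: "real \<Rightarrow> real"
  assumes "continuous_on UNIV f" "continuous_on UNIV g" "AE x in lborel. f x = g x"
  shows "f x = g x"
proof (rule ccontr)
  assume "f x \<noteq> g x"
  let ?S = "{y. f y \<noteq> g y}"
  have o: "open ?S" using assms(1,2) by (simp add: open_Collect_neq)
  then obtain e where e: "e > 0" "{x - e<..<x + e} \<subseteq> ?S"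
    using \<open>f x \<noteq> g x\<close> by (metis (mono_tags) mem_Collect_eq open_contains_ball ball_eq_greaterThanLessThan)
  have "?S \<in> sets lborel" using o by simp
  then have "emeasure lborel ?S = 0" using assms(3) by (subst (asm) AE_iff_measurable) auto
  then have "emeasure lborel {x - e<..<x + e} = 0"
    using e(2) \<open>?S \<in> sets lborel\<close> by (metis emeasure_mono le_zero_eq)
  then show False using e(1) by simp
qed

lemma primitive_weakly_diff: "primitive f g \<Longrightarrow> L2 f \<Longrightarrow> L2 g \<Longrightarrow> weakly_diff f g"
  by (simp add: weakly_diff_def primitive_weak_derivative)

lemma weakly_diff_continuous_representative:
  assumes "weakly_diff f g" shows "\<exists>F. primitive F g \<and> L2 F \<and> (AE x in lborel. f x = F x)"
proof -
  obtain F where F: "primitive F g" "AE x in lborel. f x = F x"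
    using weak_derivative_primitive[of f g] assms by (auto simp: weakly_diff_def L2_locally_integrable)
  have "F \<in> borel_measurable borel" by (intro borel_measurable_continuous_onI primitive_continuous[OF F(1)])
  then have "L2 F" by (rule L2_bound[OF weakly_diffD(1)[OF assms]]) (use F(2) in \<open>auto elim!: eventually_mono\<close>)
  then show ?thesis using F by blast
qed

lemma weakly_diff_primitive:
  assumes "weakly_diff f g" "continuous_on UNIV f" shows "primitive f g"
proof -
  obtain F where F: "primitive F g" "AE x in lborel. f x = F x"
    using weakly_diff_continuous_representative[OF assms(1)] by blast
  then have "f = F" using continuous_AE_eq[OF assms(2) primitive_continuous[OF F(1)] F(2)] by blast
  then show ?thesis using F by simp
qed

lemma weakly_diff_sup_bound:
  assumes "weakly_diff f g" "continuous_on UNIV f" shows "\<bar>f x\<bar> \<le> 2 * Hk_norm 1 f"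
proof -
  note L = weakly_diffD(1,2)[OF assms(1)]
  have i: "integrable lborel (\<lambda>y. (f y)\<^sup>2 + (g y)\<^sup>2)" using L by (auto simp: L2_integrable_square)
  have n: "(Hk_norm 1 f)\<^sup>2 = (LINT y|lborel. (f y)\<^sup>2 + (g y)\<^sup>2)"
    using L Hk_norm_Suc[OF assms(1), of 0, folded One_nat_def] by (simp add: Hk_norm_0 norm_abs_l2 L2_integrable_square)
  have "(f x)\<^sup>2 \<le> 2 * (LINT y|lborel. indicator {x - 1..x} y * ((f y)\<^sup>2 + (g y)\<^sup>2))"
    by (rule primitive_sup_bound[OF weakly_diff_primitive[OF assms] L])
  also have "(LINT y|lborel. indicator {x - 1..x} y * ((f y)\<^sup>2 + (g y)\<^sup>2)) \<le> (LINT y|lborel. (f y)\<^sup>2 + (g y)\<^sup>2)"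
    using i integrable_mult_indicator[OF _ i, of "{x - 1..x}"]
    by (intro integral_mono) (simp_all add: mult_left_le_one_le)
  \<comment> \<open>The constant sqrt 2 of the unit interval estimate is rounded up to 2.\<close>
  also have "2 * (LINT y|lborel. (f y)\<^sup>2 + (g y)\<^sup>2) \<le> (2 * Hk_norm 1 f)\<^sup>2"
    by (simp add: n[symmetric] power_mult_distrib)
  finally have "\<bar>f x\<bar> \<le> \<bar>2 * Hk_norm 1 f\<bar>" by (simp only: abs_le_square_iff)
  then show ?thesis by simp
qed

lemma Hk_representative:
  assumes "Hk k f" "k \<ge> 1"
  shows "\<exists>F. continuous_on UNIV F \<and> Hk k F \<and> Hk_norm k F = Hk_norm k f \<and> (AE x in lborel. f x = F x)"
proof -
  have "Hk (Suc 0) f" using assms Hk_mono by (simp add: Suc_le_eq)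
  then obtain F where F: "primitive F (weak_D 1 f)" "L2 F" "AE x in lborel. f x = F x"
    using weakly_diff_continuous_representative[OF Hk_weakly_diff] by blast
  then show ?thesis
    using primitive_continuous[OF F(1)] Hk_cong(1,2)[OF F(3) Hk_L2[OF assms(1)] F(2), of k] assms
    by (intro exI[of _ F]) auto
qed

lemma Hk_sup_bound:
  assumes "Hk k f" "k \<ge> 1" "continuous_on UNIV f" shows "\<bar>f x\<bar> \<le> 2 * Hk_norm k f"
proof -
  have "Hk (Suc 0) f" using assms Hk_mono by (simp add: Suc_le_eq)
  from weakly_diff_sup_bound[OF Hk_weakly_diff[OF this] assms(3)] show ?thesis
    using Hk_norm_mono[of 1 k f] assms(2) by (meson mult_left_mono order_trans zero_le_numeral)
qed

lemma Hk_decay: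
  assumes "Hk k f" "k \<ge> 1" "continuous_on UNIV f" "e > 0"
  shows "\<exists>N. \<forall>x. \<bar>x\<bar> \<ge> N \<longrightarrow> \<bar>f x\<bar> < e"
proof -
  have "Hk (Suc 0) f" using assms Hk_mono by (simp add: Suc_le_eq)
  then have w: "weakly_diff f (weak_D 1 f)" by (rule Hk_weakly_diff)
  show ?thesis by (rule primitive_decay[OF weakly_diff_primitive[OF w assms(3)] weakly_diffD(1,2)[OF w] assms(4)])
qed

section \<open>Products in Sobolev spaces\<close>

lemma L2_product:
  assumes "Hk 1 f" "L2 g"
  shows "L2 (\<lambda>x. f x * g x)" "norm (abs_l2 (\<lambda>x. f x * g x)) \<le> 2 * Hk_norm 1 f * norm (abs_l2 g)"
proof -
  obtain F where F: "continuous_on UNIV F" "Hk 1 F" "Hk_norm 1 F = Hk_norm 1 f" "AE x in lborel. f x = F x"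
    using Hk_representative[OF assms(1)] by auto
  have b: "\<bar>F x\<bar> \<le> 2 * Hk_norm 1 f" for x using Hk_sup_bound[OF F(2) _ F(1)] F(3) by simp
  have le: "AE x in lborel. \<bar>f x * g x\<bar> \<le> \<bar>2 * Hk_norm 1 f * g x\<bar>"
    using F(4)
  proof eventually_elim
    case (elim x)
    then show ?case using b[of x] by (auto simp: abs_mult intro!: mult_right_mono)
  qed
  have [measurable]: "f \<in> borel_measurable borel" "g \<in> borel_measurable borel"
    using Hk_L2[OF assms(1)] assms(2) by (auto simp: L2_def)
  show L: "L2 (\<lambda>x. f x * g x)"
    by (rule L2_bound[OF L2_cmult[OF assms(2)] _ le]) simp
  have "(LINT x|lborel. (f x * g x)\<^sup>2) \<le> (LINT x|lborel. (2 * Hk_norm 1 f * g x)\<^sup>2)"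
    using le L2_integrable_square[OF L] L2_integrable_square[OF L2_cmult[OF assms(2)]]
    by (intro integral_mono_AE) (auto simp: abs_le_square_iff elim!: eventually_mono)
  also have "\<dots> = (2 * Hk_norm 1 f * norm (abs_l2 g))\<^sup>2"
    using assms by (simp add: norm_abs_l2 power_mult_distrib)
  finally show "norm (abs_l2 (\<lambda>x. f x * g x)) \<le> 2 * Hk_norm 1 f * norm (abs_l2 g)"
    by (simp add: norm_abs_l2[OF L] real_le_lsqrt)
qed

text \<open>The product rule holds for the continuous representatives as primitives; the result is
  carried back to f and g along almost everywhere equality.\<close>

lemma weakly_diff_mult:
  assumes f: "weakly_diff f f'" and g: "weakly_diff g g'"
  shows "weakly_diff (\<lambda>x. f x * g x) (\<lambda>x. f' x * g x + f x * g' x)"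
proof -
  have H: "Hk 1 f" "Hk 1 g"
    using Hk_Suc_weakly_diff[OF f, of 0, folded One_nat_def] Hk_Suc_weakly_diff[OF g, of 0, folded One_nat_def] assms by (auto simp: Hk_0 weakly_diffD)
  obtain F where F: "primitive F f'" "L2 F" "AE x in lborel. f x = F x" using weakly_diff_continuous_representative[OF f] by blast
  obtain G where G: "primitive G g'" "L2 G" "AE x in lborel. g x = G x" using weakly_diff_continuous_representative[OF g] by blast
  have HF: "Hk 1 F" "Hk 1 G"
    using H Hk_cong(1)[OF F(3) weakly_diffD(1)[OF f] F(2)] Hk_cong(1)[OF G(3) weakly_diffD(1)[OF g] G(2)] by auto
  have a: "L2 (\<lambda>x. f' x * g x)" "L2 (\<lambda>x. f' x * G x)"
    using L2_product(1)[OF H(2) weakly_diffD(2)[OF f]] L2_product(1)[OF HF(2) weakly_diffD(2)[OF f]] by (simp_all only: mult.commute)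
  have L: "L2 (\<lambda>x. f' x * g x + f x * g' x)" "L2 (\<lambda>x. f x * g x)"
     "L2 (\<lambda>x. f' x * G x + F x * g' x)" "L2 (\<lambda>x. F x * G x)"
    by (intro L2_add a L2_product H HF weakly_diffD(2)[OF g] weakly_diffD(1)[OF g] G(2))+
  have "weakly_diff (\<lambda>x. F x * G x) (\<lambda>x. f' x * G x + F x * g' x)" by (intro primitive_weakly_diff primitive_mult F G L)
  then show ?thesis
    by (rule weakly_diff_cong) (use F(3) G(3) L in \<open>auto elim!: eventually_elim2\<close>)
qed

text \<open>For j \<ge> 1 this is the algebra property of H^j. The maximum with 1 covers j = 0,
  where one factor must be bounded. In the induction step each Leibniz term has one undifferentiated
  factor, which lies in both H^1 and H^j; in the constant 2 + 2 C the 2 is that of the sup bound and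
  each term contributes one C.\<close>

lemma Hk_product_ex:
  "\<exists>C\<ge>0. \<forall>f g. Hk (max 1 j) f \<longrightarrow> Hk j g \<longrightarrow>
     Hk j (\<lambda>x. f x * g x) \<and> Hk_norm j (\<lambda>x. f x * g x) \<le> C * Hk_norm (max 1 j) f * Hk_norm j g"
proof (induction j)
  case 0
  show ?case by (rule exI[of _ 2]) (auto simp: Hk_0 Hk_norm_0 L2_product)
next
  case (Suc j)
  then obtain C where C: "C \<ge> 0" "\<And>f g. Hk (max 1 j) f \<Longrightarrow> Hk j g \<Longrightarrow>
     Hk j (\<lambda>x. f x * g x) \<and> Hk_norm j (\<lambda>x. f x * g x) \<le> C * Hk_norm (max 1 j) f * Hk_norm j g"
    by blast
  have "Hk (Suc j) (\<lambda>x. f x * g x) \<and> Hk_norm (Suc j) (\<lambda>x. f x * g x) \<le> (2 + 2 * C) * Hk_norm (Suc j) f * Hk_norm (Suc j) g"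
    if f: "Hk (Suc j) f" and g: "Hk (Suc j) g" for f g
  proof -
    let ?f' = "weak_D 1 f" and ?g' = "weak_D 1 g"
    let ?F = "Hk_norm (Suc j) f" and ?G = "Hk_norm (Suc j) g"
    note w = weakly_diff_mult[OF Hk_weakly_diff[OF f] Hk_weakly_diff[OF g]]
    have m: "Hk (max 1 j) f" "Hk (max 1 j) g" "Hk_norm (max 1 j) f \<le> ?F" "Hk_norm (max 1 j) g \<le> ?G"
      using f g by (auto intro: Hk_mono Hk_norm_mono)
    have le: "Hk_norm j ?f' \<le> ?F" "Hk_norm j ?g' \<le> ?G"
      using Hk_norm_Suc_ge(2)[OF Hk_weakly_diff[OF f]] Hk_norm_Suc_ge(2)[OF Hk_weakly_diff[OF g]] by auto
    have 1: "Hk j (\<lambda>x. ?f' x * g x)" "Hk_norm j (\<lambda>x. ?f' x * g x) \<le> C * Hk_norm (max 1 j) g * Hk_norm j ?f'"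
      using C(2)[OF m(2) Hk_weak_D[OF f]] by (simp_all only: mult.commute)
    have 2: "Hk j (\<lambda>x. f x * ?g' x)" "Hk_norm j (\<lambda>x. f x * ?g' x) \<le> C * Hk_norm (max 1 j) f * Hk_norm j ?g'"
      using C(2)[OF m(1) Hk_weak_D[OF g]] by auto
    have "C * Hk_norm (max 1 j) g * Hk_norm j ?f' \<le> C * ?G * ?F" "C * Hk_norm (max 1 j) f * Hk_norm j ?g' \<le> C * ?F * ?G"
      using C(1) m le by (auto intro!: mult_mono)
    with 1 2 Hk_norm_triangle[OF 1(1) 2(1)]
    have 3: "Hk_norm j (\<lambda>x. ?f' x * g x + f x * ?g' x) \<le> 2 * (C * ?F * ?G)" by (simp add: mult.commute mult.left_commute)
    have "norm (abs_l2 (\<lambda>x. f x * g x)) \<le> 2 * Hk_norm 1 f * norm (abs_l2 g)"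
      using f g by (intro L2_product) (auto intro: Hk_mono Hk_L2)
    also have "\<dots> \<le> 2 * ?F * ?G"
      using f g by (intro mult_mono norm_le_Hk_norm Hk_norm_mono) (auto intro: Hk_L2)
    finally have 4: "norm (abs_l2 (\<lambda>x. f x * g x)) \<le> 2 * ?F * ?G" .
    have "Hk j (\<lambda>x. ?f' x * g x + f x * ?g' x)" by (intro Hk_add 1 2)
    then show ?thesis using 3 4 Hk_norm_Suc_le[OF w, of j] Hk_Suc_weakly_diff[OF w] by (auto simp: algebra_simps)
  qed
  then show ?case using C(1) by (intro exI[of _ "2 + 2 * C"]) auto
qed

section \<open>The first order system in $L^2$\<close>

lemma exp_tail_integrable:
  fixes l :: real assumes "l > 0"
  shows "integrable lborel (\<lambda>s. indicator {0..} s * exp (- l * s) :: real)"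
proof -
  have "(\<integral>\<^sup>+s. ennreal (exp (- l * s)) * indicator {0..} s \<partial>lborel) = ennreal (0 - (- exp (- l * 0) / l))"
  proof (rule nn_integral_FTC_atLeast)
    show "DERIV (\<lambda>s. - exp (- l * s) / l) x :> exp (- l * x)" for x
      using assms by (auto intro!: derivative_eq_intros)
    have "((\<lambda>s. exp (- (l * s))) \<longlongrightarrow> 0) at_top"
      using assms by (intro filterlim_compose[OF exp_at_bot] filterlim_uminus_at_bot_at_top[THEN filterlim_compose]
          filterlim_tendsto_pos_mult_at_top[OF tendsto_const] filterlim_ident)
    from tendsto_divide[OF tendsto_minus[OF this] tendsto_const[of l]] assms
    show "((\<lambda>s. - exp (- l * s) / l) \<longlongrightarrow> 0) at_top" by simp
  qed auto
  also have "(\<integral>\<^sup>+s. ennreal (exp (- l * s)) * indicator {0..} s \<partial>lborel)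
      = (\<integral>\<^sup>+s. ennreal (indicator {0..} s * exp (- l * s)) \<partial>lborel)"
    by (intro nn_integral_cong) (simp add: indicator_def)
  finally have "(\<integral>\<^sup>+s. ennreal (indicator {0..} s * exp (- l * s)) \<partial>lborel) < \<infinity>" by simp
  then show ?thesis by (intro integrableI_nonneg) auto
qed

text \<open>P is the convolution of g with exp(-l s) on s \<ge> 0. A crude product bound shows that
  P is bounded; testing the equation with P on [-N, N] then bounds the integral of P^2 independently
  of N, because the boundary term is controlled by the sup bound.\<close>

lemma forward_solution:
  assumes l: "l > 0" and g: "L2 g"
  shows "\<exists>P. primitive P (\<lambda>x. g x - l * P x) \<and> L2 P"
proof -
  have [measurable]: "g \<in> borel_measurable borel" using g by (simp add: L2_def)
  define E where "E s = indicator {0..} s * exp (- l * s)" for s :: real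
  have [measurable]: "E \<in> borel_measurable borel" unfolding E_def[abs_def] by measurable
  have E2: "(E s)\<^sup>2 = indicator {0..} s * exp (- (2 * l) * s)" for s
    by (auto simp: E_def indicator_def power2_eq_square exp_add[symmetric])
  have E: "L2 E" using exp_tail_integrable[of "2 * l"] l by (simp add: L2_def E2)
  have Ex: "integrable lborel (\<lambda>y. (E (x - y))\<^sup>2)" "(LINT y|lborel. (E (x - y))\<^sup>2) = (LINT y|lborel. (E y)\<^sup>2)" for x
    using lborel_integrable_real_affine[of "\<lambda>y. (E y)\<^sup>2" "-1" x] L2_integrable_square[OF E]
      lborel_integral_real_affine[of "-1" "\<lambda>y. (E y)\<^sup>2" x] by auto
  then have LEx: "L2 (\<lambda>y. E (x - y))" for x by (simp add: L2_def)
  \<comment> \<open>The integrating factor exp(l x) turns P' = g - l P into K' = w, and the decay of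
    the kernel makes w integrable on every half-line to the left.\<close>
  define w where "w y = exp (l * y) * g y" for y
  have lw: "locally_integrable w"
    unfolding w_def[abs_def] using g by (intro locally_integrable_mult_continuous L2_locally_integrable continuous_intros)
  have Ew: "indicator {..x} y * w y = exp (l * x) * (E (x - y) * g y)" for x y
    by (auto simp: E_def w_def indicator_def exp_add[symmetric] algebra_simps)
  have iw: "integrable lborel (\<lambda>y. indicator {..x} y * w y)" for x
    unfolding Ew using L2_integrable_mult[OF LEx g] by simp
  define K where "K x = (LINT y|lborel. indicator {..x} y * w y)" for x
  have pK: "primitive K w"
    unfolding primitive_def
  proof (intro conjI allI impI lw)
    fix a b :: real assume ab: "a \<le> b"
    have "K b - K a = (LINT y|lborel. indicator {..b} y * w y - indicator {..a} y * w y)"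
      unfolding K_def using iw by simp
    also have "\<dots> = (LINT y|lborel. indicator {a..b} y * w y)"
    proof (rule integral_cong_AE)
      show "AE y in lborel. indicator {..b} y * w y - indicator {..a} y * w y = indicator {a..b} y * w y"
        using AE_lborel_singleton[of a] by eventually_elim (use ab in \<open>auto simp: indicator_def\<close>)
    qed (use lw in \<open>auto simp: locally_integrable_def\<close>)
    finally show "(w has_integral K b - K a) {a..b}"
      using locally_integrable_LINT[OF lw] integrable_integral[OF locally_integrable_integrable_on[OF lw]] by simp
  qed
  define P where "P x = exp (- l * x) * K x" for x
  have "primitive P (\<lambda>x. (- l * exp (- l * x)) * K x + exp (- l * x) * w x)"
    unfolding P_def[abs_def]
    by (intro primitive_mult pK primitive_DERIV continuous_intros) (auto intro!: derivative_eq_intros)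
  moreover have "(- l * exp (- l * x)) * K x + exp (- l * x) * w x = g x - l * P x" for x
    by (simp add: P_def w_def mult.assoc[symmetric] exp_add[symmetric])
  ultimately have pP: "primitive P (\<lambda>x. g x - l * P x)" by simp
  \<comment> \<open>From |E g| \<le> E^2 + g^2; the integral of the squared kernel does not depend
    on x, being invariant under translation and reflection.\<close>
  define B where "B = (LINT y|lborel. (E y)\<^sup>2) + (LINT y|lborel. (g y)\<^sup>2)"
  have PB: "\<bar>P x\<bar> \<le> B" for x
  proof -
    have "P x = (LINT y|lborel. E (x - y) * g y)"
    proof -
      have "exp (- l * x) * exp (l * x) = 1" by (simp add: exp_add[symmetric])
      then show ?thesis
        unfolding P_def K_def Ew integral_mult_right_zero by (simp only: mult.assoc[symmetric] mult_1)
    qed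
    also have "\<bar>\<dots>\<bar> \<le> (LINT y|lborel. \<bar>E (x - y) * g y\<bar>)" by (rule integral_abs_bound)
    also have "\<dots> \<le> (LINT y|lborel. (E (x - y))\<^sup>2 + (g y)\<^sup>2)"
    proof (rule integral_mono)
      fix y
      have "2 * \<bar>E (x - y)\<bar> * \<bar>g y\<bar> \<le> (E (x - y))\<^sup>2 + (g y)\<^sup>2"
        using sum_squares_bound[of "\<bar>E (x - y)\<bar>" "\<bar>g y\<bar>"] by simp
      then show "\<bar>E (x - y) * g y\<bar> \<le> (E (x - y))\<^sup>2 + (g y)\<^sup>2"
        using mult_nonneg_nonneg[of "\<bar>E (x - y)\<bar>" "\<bar>g y\<bar>"] unfolding abs_mult by linarith
    qed (use L2_integrable_mult[OF LEx g] Ex L2_integrable_square[OF g] in auto)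
    also have "\<dots> = B" using Ex L2_integrable_square[OF g] by (simp add: B_def)
    finally show ?thesis .
  qed
  have cP: "continuous_on UNIV P" by (rule primitive_continuous[OF pP])
  have [measurable]: "P \<in> borel_measurable borel" by (rule borel_measurable_continuous_onI[OF cP])
  \<comment> \<open>The pointwise bound 2 P (g - l P) \<le> - l P^2 + g^2 / l is integrated over
    [-N, N]; the left side contributes P(N)^2 - P(-N)^2, of which P(-N)^2 \<le> B^2
    survives.\<close>
  define D where "D = (B\<^sup>2 + (LINT y|lborel. (g y)\<^sup>2) / l) / l"
  have lP2: "locally_integrable (\<lambda>x. (P x)\<^sup>2)" by (intro locally_integrable_continuous continuous_intros cP)
  have lg2: "locally_integrable (\<lambda>x. (g x)\<^sup>2)" by (intro locally_integrable_integrable L2_integrable_square g)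
  note on = locally_integrable_integrable_on
  have bd: "integral {-N..N} (\<lambda>x. (P x)\<^sup>2) \<le> D" if "N \<ge> 0" for N
  proof -
    have "2 * P x * (g x - l * P x) \<le> - l * (P x)\<^sup>2 + (g x)\<^sup>2 / l" for x
    proof -
      have "0 \<le> (l * P x - g x)\<^sup>2 / l" using l by simp
      also have "\<dots> = l * (P x)\<^sup>2 - 2 * P x * g x + (g x)\<^sup>2 / l"
        using l by (simp add: power2_eq_square field_simps)
      finally show ?thesis by (simp add: algebra_simps power2_eq_square)
    qed
    then have "integral {-N..N} (\<lambda>x. 2 * P x * (g x - l * P x))
        \<le> integral {-N..N} (\<lambda>x. - l * (P x)\<^sup>2 + (1 / l) * (g x)\<^sup>2)"
      by (intro integral_le on primitive_locally_integrable[OF primitive_square[OF pP]] locally_integrable_add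
          locally_integrable_cmult lP2 lg2) auto
    also have "\<dots> = - l * integral {-N..N} (\<lambda>x. (P x)\<^sup>2) + (1 / l) * integral {-N..N} (\<lambda>x. (g x)\<^sup>2)"
      by (subst Henstock_Kurzweil_Integration.integral_add) (auto intro!: on locally_integrable_cmult[of _ "1/l", simplified]
          locally_integrable_cmult[of _ "-l", simplified] lP2 lg2)
    also have "integral {-N..N} (\<lambda>x. 2 * P x * (g x - l * P x)) = (P N)\<^sup>2 - (P (-N))\<^sup>2"
      using that by (simp add: primitive_integral[OF primitive_square[OF pP]])
    finally have "l * integral {-N..N} (\<lambda>x. (P x)\<^sup>2) \<le> (P (-N))\<^sup>2 - (P N)\<^sup>2 + (1 / l) * integral {-N..N} (\<lambda>x. (g x)\<^sup>2)"
      by simp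
    also have "\<dots> \<le> B\<^sup>2 + (1 / l) * (LINT y|lborel. (g y)\<^sup>2)"
    proof -
      have "(P (-N))\<^sup>2 \<le> B\<^sup>2" using PB[of "-N"] by (metis abs_ge_zero abs_le_square_iff abs_of_nonneg order_trans)
      moreover have "integral {-N..N} (\<lambda>x. (g x)\<^sup>2) \<le> (LINT y|lborel. (g y)\<^sup>2)"
        unfolding locally_integrable_LINT[OF lg2, symmetric]
        using L2_integrable_square[OF g] integrable_mult_indicator[OF _ L2_integrable_square[OF g], of "{-N..N}"]
        by (intro integral_mono) (auto simp: indicator_def)
      ultimately show ?thesis using l zero_le_power2[of "P N"] by (smt (verit) divide_nonneg_pos mult_left_mono)
    qed
    finally show ?thesis using l by (simp add: D_def field_simps)
  qed
  have nb: "(\<integral>\<^sup>+x. ennreal ((P x)\<^sup>2) * indicator {- real i..real i} x \<partial>lborel) \<le> ennreal D" for i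
  proof -
    have "(\<integral>\<^sup>+x. ennreal ((P x)\<^sup>2) * indicator {- real i..real i} x \<partial>lborel)
        = (\<integral>\<^sup>+x. ennreal (indicator {- real i..real i} x * (P x)\<^sup>2) \<partial>lborel)"
      by (intro nn_integral_cong) (auto simp: indicator_def)
    also have "\<dots> = ennreal (LINT x|lborel. indicator {- real i..real i} x * (P x)\<^sup>2)"
      using lP2 by (intro nn_integral_eq_integral) (auto simp: locally_integrable_def set_integrable_def)
    also have "\<dots> \<le> ennreal D" using bd[of "real i"] by (simp add: locally_integrable_LINT[OF lP2] ennreal_leI)
    finally show ?thesis .
  qed
  have "(\<integral>\<^sup>+x. ennreal ((P x)\<^sup>2) \<partial>lborel) = (\<integral>\<^sup>+x. (SUP i. ennreal ((P x)\<^sup>2) * indicator {- real i..real i} x) \<partial>lborel)"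
  proof (intro nn_integral_cong antisym)
    fix x :: real
    obtain i :: nat where "\<bar>x\<bar> \<le> real i" using real_arch_simple by blast
    then have "ennreal ((P x)\<^sup>2) \<le> ennreal ((P x)\<^sup>2) * indicator {- real i..real i} x"
      by (auto simp: indicator_def abs_le_iff)
    also have "\<dots> \<le> (SUP i. ennreal ((P x)\<^sup>2) * indicator {- real i..real i} x)" by (rule SUP_upper) simp
    finally show "ennreal ((P x)\<^sup>2) \<le> (SUP i. ennreal ((P x)\<^sup>2) * indicator {- real i..real i} x)" .
  qed (auto intro!: SUP_least simp: indicator_def)
  also have "\<dots> = (SUP i. \<integral>\<^sup>+x. ennreal ((P x)\<^sup>2) * indicator {- real i..real i} x \<partial>lborel)"
    by (intro nn_integral_monotone_convergence_SUP) (auto simp: incseq_def le_fun_def indicator_def)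
  also have "\<dots> \<le> ennreal D" by (intro SUP_least nb)
  finally have "integrable lborel (\<lambda>x. (P x)\<^sup>2)"
    by (intro integrableI_nonneg) (auto simp: le_less_trans)
  then show ?thesis using pP by (auto simp: L2_def)
qed

lemma L2_reflect: assumes "L2 g" shows "L2 (\<lambda>x. g (- x))"
  using assms lborel_integrable_real_affine[of "\<lambda>x. (g x)\<^sup>2" "-1" 0] by (auto simp: L2_def)

text \<open>The reflection of the line exchanges growth and decay, so the convolution from the right
  is the reflected \<open>forward_solution\<close> with data - g(-x).\<close>

lemma backward_solution:
  assumes l: "l > 0" and g: "L2 g"
  shows "\<exists>P. primitive P (\<lambda>x. l * P x + g x) \<and> L2 P"
proof -
  obtain Q where Q: "primitive Q (\<lambda>x. - 1 * g (- x) - l * Q x)" "L2 Q"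
    using forward_solution[OF l L2_cmult[OF L2_reflect[OF g]]] by blast
  have "primitive (\<lambda>x. Q (- x)) (\<lambda>x. - (- 1 * g (- (- x)) - l * Q (- x)))" by (rule primitive_reflect[OF Q(1)])
  then show ?thesis using L2_reflect[OF Q(2)] by (intro exI[of _ "\<lambda>x. Q (- x)"]) (simp add: algebra_simps)
qed

text \<open>Diagonalisation: P = u + v satisfies P' = l P + (g + h) and Q = u - v satisfies Q' = - l
  Q + (g - h). The two modes are solved from opposite ends of the line.\<close>

lemma constant_system_solution:
  assumes l: "l > 0" and g: "L2 g" and h: "L2 h"
  shows "\<exists>u v. primitive u (\<lambda>x. l * v x + g x) \<and> primitive v (\<lambda>x. l * u x + h x) \<and> L2 u \<and> L2 v"
proof -
  obtain P where P: "primitive P (\<lambda>x. l * P x + (g x + h x))" "L2 P"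
    using backward_solution[OF l L2_add[OF g h]] by blast
  obtain Q where Q: "primitive Q (\<lambda>x. (g x - h x) - l * Q x)" "L2 Q"
    using forward_solution[OF l L2_diff[OF g h]] by blast
  define u where "u x = 1/2 * (P x + Q x)" for x
  define v where "v x = 1/2 * (P x - Q x)" for x
  have u: "primitive u (\<lambda>x. 1/2 * ((l * P x + (g x + h x)) + ((g x - h x) - l * Q x)))"
    unfolding u_def[abs_def] by (intro primitive_cmult primitive_add P Q)
  have u': "(\<lambda>x. 1/2 * ((l * P x + (g x + h x)) + ((g x - h x) - l * Q x))) = (\<lambda>x. l * v x + g x)"
    unfolding v_def by (rule ext) algebra
  have v: "primitive v (\<lambda>x. 1/2 * ((l * P x + (g x + h x)) - ((g x - h x) - l * Q x)))"
    unfolding v_def[abs_def] by (intro primitive_cmult primitive_diff P Q)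
  have v': "(\<lambda>x. 1/2 * ((l * P x + (g x + h x)) - ((g x - h x) - l * Q x))) = (\<lambda>x. l * u x + h x)"
    unfolding u_def by (rule ext) algebra
  have "L2 u" "L2 v"
    unfolding u_def[abs_def] v_def[abs_def] by (intro L2_cmult L2_add L2_diff P Q)+
  then show ?thesis using u[unfolded u'] v[unfolded v'] by blast
qed

text \<open>Testing \<open>u' = a v + g\<close> with \<open>v\<close> and \<open>v' = b u + h\<close> with \<open>u\<close> gives
  \<open>\<integral> a v\<^sup>2 + b u\<^sup>2 = - \<integral> g v + h u\<close>, since \<open>\<integral> (u v)' = 0\<close>.\<close>

lemma system_energy:
  assumes p: "primitive u (\<lambda>x. a x * v x + g x)" "primitive v (\<lambda>x. b x * u x + h x)"
    and L: "L2 u" "L2 v" "L2 g" "L2 h"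
    and ab: "a \<in> borel_measurable borel" "b \<in> borel_measurable borel"
      "\<And>x. c \<le> a x" "\<And>x. c \<le> b x" "\<And>x. a x \<le> C" "\<And>x. b x \<le> C" and c: "c > 0"
  shows "c\<^sup>2 * ((norm (abs_l2 u))\<^sup>2 + (norm (abs_l2 v))\<^sup>2) \<le> (norm (abs_l2 g))\<^sup>2 + (norm (abs_l2 h))\<^sup>2"
proof -
  have bd: "\<bar>a x\<bar> \<le> C" "\<bar>b x\<bar> \<le> C" for x using ab(3-6)[of x] c by auto
  have La: "L2 (\<lambda>x. a x * v x + g x)" "L2 (\<lambda>x. b x * u x + h x)"
    by (intro L2_add L2_mult_bounded[where B = C] L ab bd)+
  have 0: "(LINT x|lborel. (a x * v x + g x) * v x + u x * (b x * u x + h x)) = 0"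
    by (rule integral_product_derivative_zero[OF p L(1) La(1) L(2) La(2)])
  note sq = L[THEN L2_integrable_square]
  \<comment> \<open>The vanishing integral \<open>0\<close> is added with the factor 2 c. After a
    and b are bounded below by c, what remains of the difference of the integrands is (c v + g)^2 +
    (c u + h)^2.\<close>
  have "(LINT x|lborel. c\<^sup>2 * ((u x)\<^sup>2 + (v x)\<^sup>2)) \<le>
     (LINT x|lborel. 2 * c * ((a x * v x + g x) * v x + u x * (b x * u x + h x)) + ((g x)\<^sup>2 + (h x)\<^sup>2))"
  proof (rule integral_mono)
    show "integrable lborel (\<lambda>x. c\<^sup>2 * ((u x)\<^sup>2 + (v x)\<^sup>2))" using sq by auto
    show "integrable lborel (\<lambda>x. 2 * c * ((a x * v x + g x) * v x + u x * (b x * u x + h x)) + ((g x)\<^sup>2 + (h x)\<^sup>2))"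
      using sq L2_integrable_mult[OF La(1) L(2)] L2_integrable_mult[OF L(1) La(2)] by auto
    fix x
    have "c * (v x)\<^sup>2 \<le> a x * (v x)\<^sup>2" "c * (u x)\<^sup>2 \<le> b x * (u x)\<^sup>2"
      using ab by (auto intro!: mult_right_mono)
    then have "2 * c * (c * (v x)\<^sup>2 + c * (u x)\<^sup>2) \<le> 2 * c * (a x * (v x)\<^sup>2 + b x * (u x)\<^sup>2)"
      using c by (intro mult_left_mono) auto
    moreover have "0 \<le> (c * v x + g x)\<^sup>2" "0 \<le> (c * u x + h x)\<^sup>2" by auto
    ultimately show "c\<^sup>2 * ((u x)\<^sup>2 + (v x)\<^sup>2) \<le>
       2 * c * ((a x * v x + g x) * v x + u x * (b x * u x + h x)) + ((g x)\<^sup>2 + (h x)\<^sup>2)"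
      by (simp add: power2_eq_square algebra_simps)
  qed
  also have "\<dots> = (LINT x|lborel. (g x)\<^sup>2) + (LINT x|lborel. (h x)\<^sup>2)"
  proof -
    have "integrable lborel (\<lambda>x. (a x * v x + g x) * v x + u x * (b x * u x + h x))"
      using L2_integrable_mult[OF La(1) L(2)] L2_integrable_mult[OF L(1) La(2)] by auto
    then show ?thesis using sq by (subst Bochner_Integration.integral_add) (auto simp: 0)
  qed
  finally show ?thesis using sq L by (simp add: norm_abs_l2)
qed

text \<open>With \<open>l\<close> an upper bound for the coefficients, \<open>a = l - (l - a)\<close> and the energy estimate for
  coefficient \<open>l\<close> makes the perturbation a contraction of ratio \<open>(l - c) / l\<close>.\<close>

lemma system_solution:
  assumes g: "L2 g" and h: "L2 h"
    and ab: "a \<in> borel_measurable borel" "b \<in> borel_measurable borel"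
      "\<And>x. c \<le> a x" "\<And>x. c \<le> b x" "\<And>x. a x \<le> l" "\<And>x. b x \<le> l" and c: "c > 0"
  shows "\<exists>u v. primitive u (\<lambda>x. a x * v x + g x) \<and> primitive v (\<lambda>x. b x * u x + h x) \<and> L2 u \<and> L2 v"
proof -
  have cl: "c \<le> l" using ab(3,5) by (rule order_trans)
  have l: "l > 0" using cl c by simp
  define \<alpha> \<beta> where "\<alpha> x = a x - l" and "\<beta> x = b x - l" for x
  have m: "\<alpha> \<in> borel_measurable borel" "\<beta> \<in> borel_measurable borel"
    unfolding \<alpha>_def[abs_def] \<beta>_def[abs_def] using ab by auto
  have bd: "\<bar>\<alpha> x\<bar> \<le> l - c" "\<bar>\<beta> x\<bar> \<le> l - c" for x
    using ab(3-6)[of x] by (auto simp: \<alpha>_def \<beta>_def)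
  \<comment> \<open>One step of the iteration: the previous pair p enters only through the bounded
    perturbations \<alpha> and \<beta>, the new pair through the constant coefficient l.\<close>
  define R where "R p u v \<longleftrightarrow> primitive u (\<lambda>x. l * v x + (\<alpha> x * rep_l2 (snd p) x + g x))
     \<and> primitive v (\<lambda>x. l * u x + (\<beta> x * rep_l2 (fst p) x + h x)) \<and> L2 u \<and> L2 v" for p u v
  have "\<exists>u v. R p u v" for p :: "l2 \<times> l2"
    unfolding R_def
    by (intro constant_system_solution[OF l] L2_add L2_mult_bounded[where B = "l - c"] L2_rep m bd g h)
  then obtain U V where "\<And>p. R p (U p) (V p)" by metis
  then have UV:
    "\<And>p. primitive (U p) (\<lambda>x. l * V p x + (\<alpha> x * rep_l2 (snd p) x + g x))"
    "\<And>p. primitive (V p) (\<lambda>x. l * U p x + (\<beta> x * rep_l2 (fst p) x + h x))" "\<And>p. L2 (U p)" "\<And>p. L2 (V p)"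
    unfolding R_def by blast+
  define \<Psi> where "\<Psi> p = (abs_l2 (U p), abs_l2 (V p))" for p
  have "dist (\<Psi> p) (\<Psi> q) \<le> ((l - c) / l) * dist p q" for p q
  proof -
    define r s where "r x = rep_l2 (fst p) x - rep_l2 (fst q) x" and "s x = rep_l2 (snd p) x - rep_l2 (snd q) x" for x
    have Lrs: "L2 r" "L2 s" unfolding r_def[abs_def] s_def[abs_def] by (intro L2_diff L2_rep)+
    have ars: "abs_l2 r = fst p - fst q" "abs_l2 s = snd p - snd q"
      unfolding r_def[abs_def] s_def[abs_def] by (simp_all add: abs_l2_diff L2_rep abs_rep_l2)
    have Lm: "L2 (\<lambda>x. \<alpha> x * s x)" "L2 (\<lambda>x. \<beta> x * r x)"
      by (intro L2_mult_bounded[where B = "l - c"] m bd Lrs)+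
    have mul: "(norm (abs_l2 (\<lambda>x. \<gamma> x * t x)))\<^sup>2 \<le> (l - c)\<^sup>2 * (norm (abs_l2 t))\<^sup>2"
      if "L2 t" "L2 (\<lambda>x. \<gamma> x * t x)" "\<And>x. \<bar>\<gamma> x\<bar> \<le> l - c" for \<gamma> t
    proof -
      have "(LINT x|lborel. (\<gamma> x * t x)\<^sup>2) \<le> (LINT x|lborel. (l - c)\<^sup>2 * (t x)\<^sup>2)"
      proof (rule integral_mono)
        fix x
        have "(\<gamma> x)\<^sup>2 \<le> (l - c)\<^sup>2" using that(3)[of x] cl by (simp flip: abs_le_square_iff)
        then show "(\<gamma> x * t x)\<^sup>2 \<le> (l - c)\<^sup>2 * (t x)\<^sup>2" by (simp add: power_mult_distrib mult_right_mono)
      qed (use that L2_integrable_square in auto)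
      then show ?thesis using that by (simp add: norm_abs_l2)
    qed
    have "primitive (\<lambda>x. U p x - U q x) (\<lambda>x. (l * V p x + (\<alpha> x * rep_l2 (snd p) x + g x)) - (l * V q x + (\<alpha> x * rep_l2 (snd q) x + g x)))"
      by (intro primitive_diff UV)
    then have 1: "primitive (\<lambda>x. U p x - U q x) (\<lambda>x. l * (V p x - V q x) + \<alpha> x * s x)"
      by (simp add: s_def algebra_simps)
    have "primitive (\<lambda>x. V p x - V q x) (\<lambda>x. (l * U p x + (\<beta> x * rep_l2 (fst p) x + h x)) - (l * U q x + (\<beta> x * rep_l2 (fst q) x + h x)))"
      by (intro primitive_diff UV)
    then have 2: "primitive (\<lambda>x. V p x - V q x) (\<lambda>x. l * (U p x - U q x) + \<beta> x * r x)"
      by (simp add: r_def algebra_simps)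
    have "l\<^sup>2 * ((norm (abs_l2 (\<lambda>x. U p x - U q x)))\<^sup>2 + (norm (abs_l2 (\<lambda>x. V p x - V q x)))\<^sup>2)
       \<le> (norm (abs_l2 (\<lambda>x. \<alpha> x * s x)))\<^sup>2 + (norm (abs_l2 (\<lambda>x. \<beta> x * r x)))\<^sup>2"
      by (rule system_energy[OF 1 2 _ _ Lm, of l l]) (use l in \<open>auto intro!: L2_diff UV\<close>)
    also have "\<dots> \<le> (l - c)\<^sup>2 * (norm (abs_l2 s))\<^sup>2 + (l - c)\<^sup>2 * (norm (abs_l2 r))\<^sup>2"
      by (intro add_mono mul Lrs Lm bd)
    also have "\<dots> = (l - c)\<^sup>2 * (dist p q)\<^sup>2"
      by (simp add: dist_norm norm_prod_def ars distrib_left)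
    also have "l\<^sup>2 * ((norm (abs_l2 (\<lambda>x. U p x - U q x)))\<^sup>2 + (norm (abs_l2 (\<lambda>x. V p x - V q x)))\<^sup>2)
        = l\<^sup>2 * (dist (\<Psi> p) (\<Psi> q))\<^sup>2"
      by (simp add: \<Psi>_def dist_norm norm_Pair abs_l2_diff UV)
    finally have "(l * dist (\<Psi> p) (\<Psi> q))\<^sup>2 \<le> ((l - c) * dist p q)\<^sup>2"
      unfolding power_mult_distrib .
    then have "l * dist (\<Psi> p) (\<Psi> q) \<le> (l - c) * dist p q"
      by (rule power2_le_imp_le) (use cl in auto)
    then show ?thesis using l by (simp add: field_simps)
  qed
  then have "\<exists>!p. \<Psi> p = p"
    using cl c l by (intro banach_fix_type[of "(l - c) / l"]) (auto simp: field_simps)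
  then obtain p where p: "\<Psi> p = p" by blast
  let ?u = "U p" and ?v = "V p"
  have ae: "AE x in lborel. rep_l2 (fst p) x = ?u x" "AE x in lborel. rep_l2 (snd p) x = ?v x"
    using rep_abs_l2[OF UV(3)[of p]] rep_abs_l2[OF UV(4)[of p]] arg_cong[OF p, of fst] arg_cong[OF p, of snd]
    by (simp_all add: \<Psi>_def)
  have L1: "L2 (\<lambda>x. l * ?v x + (\<alpha> x * rep_l2 (snd p) x + g x))" "L2 (\<lambda>x. l * ?u x + (\<beta> x * rep_l2 (fst p) x + h x))"
    "L2 (\<lambda>x. l * ?v x + (\<alpha> x * ?v x + g x))" "L2 (\<lambda>x. l * ?u x + (\<beta> x * ?u x + h x))"
    by (intro L2_add L2_cmult L2_mult_bounded[where B = "l - c"] L2_rep m bd g h UV)+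
  \<comment> \<open>The fixed point identifies the representatives of p with ?u and ?v only almost
    everywhere. The exchange is made in the weak derivative, and continuity of ?u gives back a
    primitive.\<close>
  have "weakly_diff ?u (\<lambda>x. l * ?v x + (\<alpha> x * ?v x + g x))"
  proof (rule weakly_diff_cong[OF primitive_weakly_diff[OF UV(1,3) L1(1)] _ _ UV(3) L1(3)])
    show "AE x in lborel. l * ?v x + (\<alpha> x * rep_l2 (snd p) x + g x) = l * ?v x + (\<alpha> x * ?v x + g x)"
      using ae(2) by eventually_elim simp
  qed simp
  then have "primitive ?u (\<lambda>x. l * ?v x + (\<alpha> x * ?v x + g x))" by (rule weakly_diff_primitive[OF _ primitive_continuous[OF UV(1)]])
  then have U': "primitive ?u (\<lambda>x. a x * ?v x + g x)" by (simp add: \<alpha>_def algebra_simps)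
  have "weakly_diff ?v (\<lambda>x. l * ?u x + (\<beta> x * ?u x + h x))"
  proof (rule weakly_diff_cong[OF primitive_weakly_diff[OF UV(2,4) L1(2)] _ _ UV(4) L1(4)])
    show "AE x in lborel. l * ?u x + (\<beta> x * rep_l2 (fst p) x + h x) = l * ?u x + (\<beta> x * ?u x + h x)"
      using ae(1) by eventually_elim simp
  qed simp
  then have "primitive ?v (\<lambda>x. l * ?u x + (\<beta> x * ?u x + h x))" by (rule weakly_diff_primitive[OF _ primitive_continuous[OF UV(2)]])
  then have "primitive ?v (\<lambda>x. b x * ?u x + h x)" by (simp add: \<beta>_def algebra_simps)
  with U' show ?thesis using UV(3,4) by blast
qed

section \<open>Identification of $H^k$ with $L^2$\<close>

text \<open>\<open>resolvent\<close> is the inverse of \<open>1 + d/dz\<close>, which maps \<open>H\<^sup>k\<^sup>+\<^sup>1\<close> isomorphically onto \<open>H\<^sup>k\<close>.\<close>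

definition resolvent :: "(real \<Rightarrow> real) \<Rightarrow> real \<Rightarrow> real" where
  "resolvent g = (SOME P. primitive P (\<lambda>x. g x - P x) \<and> L2 P)"

lemma resolvent:
  assumes "L2 g" shows "primitive (resolvent g) (\<lambda>x. g x - resolvent g x)" "L2 (resolvent g)"
proof -
  have "\<exists>P. primitive P (\<lambda>x. g x - P x) \<and> L2 P" using forward_solution[OF zero_less_one assms] by simp
  from someI_ex[OF this] show "primitive (resolvent g) (\<lambda>x. g x - resolvent g x)" "L2 (resolvent g)" by (simp_all add: resolvent_def)
qed

lemma resolvent_weakly_diff: "L2 g \<Longrightarrow> weakly_diff (resolvent g) (\<lambda>x. g x - resolvent g x)"
  by (intro primitive_weakly_diff resolvent L2_diff)

text \<open>Testing P' = g - P with P: the integral of P P' vanishes, so the square of the norm of P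
  is the inner product of P and g.\<close>

lemma resolvent_energy:
  assumes p: "primitive P (\<lambda>x. g x - P x)" and L: "L2 P" "L2 g"
  shows "norm (abs_l2 P) \<le> norm (abs_l2 g)"
proof -
  have 0: "(LINT x|lborel. (g x - P x) * P x + P x * (g x - P x)) = 0"
    by (rule integral_product_derivative_zero[OF p p]) (use L L2_diff in auto)
  have "(LINT x|lborel. (g x - P x) * P x + P x * (g x - P x)) = 2 * (LINT x|lborel. P x * g x) - 2 * (LINT x|lborel. P x * P x)"
  proof -
    have "(g x - P x) * P x + P x * (g x - P x) = 2 * (P x * g x) - 2 * (P x * P x)" for x
      by (simp add: algebra_simps)
    then show ?thesis using L2_integrable_mult[OF L] L2_integrable_mult[OF L(1) L(1)] by simp
  qed
  then have "inner (abs_l2 P) (abs_l2 P) = inner (abs_l2 P) (abs_l2 g)"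
    using 0 L by (simp add: inner_abs_l2)
  also have "\<dots> \<le> norm (abs_l2 P) * norm (abs_l2 g)" by (rule norm_cauchy_schwarz)
  finally have "norm (abs_l2 P) * norm (abs_l2 P) \<le> norm (abs_l2 P) * norm (abs_l2 g)"
    by (simp add: power2_norm_eq_inner[symmetric] power2_eq_square)
  then show ?thesis by (cases "norm (abs_l2 P) = 0") auto
qed

text \<open>The difference solves the equation with data that vanish almost everywhere, so its norm
  is 0; both functions are continuous, which upgrades the conclusion to equality at every
  point.\<close>

lemma resolvent_unique:
  assumes P: "primitive P (\<lambda>x. g x - P x)" "L2 P" and g: "L2 g" "L2 g'" and ae: "AE x in lborel. g x = g' x"
  shows "P = resolvent g'"
proof -
  let ?Q = "resolvent g'" and ?d = "\<lambda>x. g x - g' x"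
  have "primitive (\<lambda>x. P x - ?Q x) (\<lambda>x. (g x - P x) - (g' x - ?Q x))" by (intro primitive_diff P resolvent g)
  then have p: "primitive (\<lambda>x. P x - ?Q x) (\<lambda>x. ?d x - (P x - ?Q x))" by (simp add: algebra_simps)
  have L: "L2 (\<lambda>x. P x - ?Q x)" "L2 ?d" by (intro L2_diff P resolvent g)+
  have "abs_l2 ?d = abs_l2 (\<lambda>x. 0)" using ae L(2) L2_zero by (subst abs_l2_eq_iff) (auto elim!: eventually_mono)
  then have "abs_l2 ?d = 0" by (simp add: zero_l2.abs_eq)
  then have "abs_l2 (\<lambda>x. P x - ?Q x) = 0" using resolvent_energy[OF p L] by simp
  then have "abs_l2 P = abs_l2 ?Q" using P resolvent g by (simp add: abs_l2_diff)
  then have "AE x in lborel. P x = ?Q x" using abs_l2_eq_iff P resolvent g by blast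
  then show ?thesis by (intro ext continuous_AE_eq primitive_continuous[OF P(1)] primitive_continuous[OF resolvent(1)[OF g(2)]])
qed

lemma resolvent_cong: "L2 g \<Longrightarrow> L2 g' \<Longrightarrow> AE x in lborel. g x = g' x \<Longrightarrow> resolvent g = resolvent g'"
  by (intro resolvent_unique[of _ g] resolvent)

lemma resolvent_add:
  assumes "L2 f" "L2 g" shows "resolvent (\<lambda>x. f x + g x) = (\<lambda>x. resolvent f x + resolvent g x)"
proof -
  have "primitive (\<lambda>x. resolvent f x + resolvent g x) (\<lambda>x. (f x - resolvent f x) + (g x - resolvent g x))" by (intro primitive_add resolvent assms)
  then have "primitive (\<lambda>x. resolvent f x + resolvent g x) (\<lambda>x. (f x + g x) - (resolvent f x + resolvent g x))" by (simp add: algebra_simps)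
  from resolvent_unique[OF this, of "\<lambda>x. f x + g x"] show ?thesis using assms by (simp add: L2_add resolvent)
qed

lemma resolvent_cmult:
  assumes "L2 f" shows "resolvent (\<lambda>x. c * f x) = (\<lambda>x. c * resolvent f x)"
proof -
  have "primitive (\<lambda>x. c * resolvent f x) (\<lambda>x. c * (f x - resolvent f x))" by (intro primitive_cmult resolvent assms)
  then have "primitive (\<lambda>x. c * resolvent f x) (\<lambda>x. c * f x - c * resolvent f x)" by (simp add: algebra_simps)
  from resolvent_unique[OF this, of "\<lambda>x. c * f x"] show ?thesis using assms by (simp add: L2_cmult resolvent)
qed

text \<open>With P the resolvent of g, P' = g - P is as regular as the worse of g and P, so each
  derivative of g gives one more derivative of P. The constant is 3 for k = 0 (once for P, twice for
  g - P) and grows by 2 in each step, once for the L^2 norm of P and once for g.\<close>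

lemma resolvent_Hk: "Hk k g \<Longrightarrow> Hk (Suc k) (resolvent g) \<and> Hk_norm (Suc k) (resolvent g) \<le> (3 + 2 * real k) * Hk_norm k g"
proof (induction k)
  case 0
  then have L: "L2 g" by (simp add: Hk_0)
  have "Hk_norm (Suc 0) (resolvent g) \<le> norm (abs_l2 (resolvent g)) + norm (abs_l2 (\<lambda>x. g x - resolvent g x))"
    using Hk_norm_Suc_le[OF resolvent_weakly_diff[OF L], of 0] by (simp add: Hk_norm_0 L2_diff L resolvent)
  also have "\<dots> \<le> 3 * norm (abs_l2 g)"
    using resolvent_energy[OF resolvent(1)[OF L] resolvent(2)[OF L] L] norm_triangle_ineq4[of "abs_l2 g" "abs_l2 (resolvent g)"] L
    by (simp add: abs_l2_diff resolvent)
  finally show ?case using Hk_Suc_weakly_diff[OF resolvent_weakly_diff[OF L], of 0] L by (simp add: Hk_0 Hk_norm_0 L2_diff resolvent)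
next
  case (Suc k)
  then have H: "Hk k g" "L2 g" using Hk_mono[of "Suc k" g k] Hk_L2 by auto
  note IH = Suc.IH[OF H(1)]
  have d: "Hk (Suc k) (\<lambda>x. g x - resolvent g x)" using IH Suc.prems by (auto intro: Hk_diff)
  have "Hk_norm (Suc (Suc k)) (resolvent g) \<le> norm (abs_l2 (resolvent g)) + Hk_norm (Suc k) (\<lambda>x. g x - resolvent g x)"
    by (rule Hk_norm_Suc_le[OF resolvent_weakly_diff[OF H(2)]])
  also have "norm (abs_l2 (resolvent g)) \<le> Hk_norm (Suc k) g"
    using resolvent_energy[OF resolvent(1)[OF H(2)] resolvent(2)[OF H(2)] H(2)] norm_le_Hk_norm[OF H(2), of "Suc k"] by simp
  also have "Hk_norm (Suc k) (\<lambda>x. g x - resolvent g x) \<le> Hk_norm (Suc k) g + Hk_norm (Suc k) (resolvent g)"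
    using IH Suc.prems by (intro Hk_norm_diff_triangle) auto
  also have "Hk_norm (Suc k) (resolvent g) \<le> (3 + 2 * real k) * Hk_norm (Suc k) g"
    using IH Hk_norm_mono[of k "Suc k" g] by (meson mult_left_mono order_trans add_nonneg_nonneg of_nat_0_le_iff
        mult_nonneg_nonneg zero_le_numeral le_SucI order_refl)
  finally show ?case using Hk_Suc_weakly_diff[OF resolvent_weakly_diff[OF H(2)]] d by (simp add: algebra_simps)
qed

text \<open>g = P + P' with P the resolvent of g, and both summands are bounded by the norm of P in
  H^(k+1).\<close>

lemma resolvent_Hk_inverse:
  assumes "Hk k g" shows "Hk_norm k g \<le> 2 * Hk_norm (Suc k) (resolvent g)"
proof -
  have L: "L2 g" using assms by (rule Hk_L2)
  have P: "Hk (Suc k) (resolvent g)" using resolvent_Hk[OF assms] by blast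
  have "Hk_norm k (\<lambda>x. resolvent g x + (g x - resolvent g x)) \<le> Hk_norm k (resolvent g) + Hk_norm k (\<lambda>x. g x - resolvent g x)"
    using P assms by (intro Hk_norm_triangle Hk_diff) (auto intro: Hk_mono)
  also have "\<dots> \<le> 2 * Hk_norm (Suc k) (resolvent g)"
    using Hk_norm_mono[of k "Suc k" "resolvent g"] Hk_norm_Suc_ge(2)[OF resolvent_weakly_diff[OF L], of k] by simp
  finally show ?thesis by simp
qed

lemma resolvent_surj:
  assumes "Hk (Suc k) f" shows "\<exists>g. Hk k g \<and> (AE x in lborel. f x = resolvent g x)"
proof -
  note w = Hk_weakly_diff[OF assms]
  obtain F where F: "primitive F (weak_D 1 f)" "L2 F" "AE x in lborel. f x = F x"
    using weakly_diff_continuous_representative[OF w] by blast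
  let ?g = "\<lambda>x. F x + weak_D 1 f x"
  have "Hk k F" using assms Hk_mono[of "Suc k" f k] Hk_cong(1)[OF F(3) weakly_diffD(1)[OF w] F(2)] by auto
  then have H: "Hk k ?g" using assms by (intro Hk_add Hk_weak_D)
  have "F = resolvent ?g" using F(1,2) Hk_L2[OF H] by (intro resolvent_unique[of _ ?g]) auto
  then show ?thesis using F(3) H by metis
qed

text \<open>For k \<ge> 1 the value is the continuous representative and does not depend on the
  choice made by \<open>rep_l2\<close>; identities then hold at every point. For k = 0 they hold
  almost everywhere only.\<close>

definition \<iota> :: "nat \<Rightarrow> l2 \<Rightarrow> real \<Rightarrow> real" where
  "\<iota> k e = (resolvent ^^ k) (rep_l2 e)"

lemma iota_Suc: "\<iota> (Suc k) e = resolvent (\<iota> k e)"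
  by (simp add: \<iota>_def)

lemma iota_0: "\<iota> 0 e = rep_l2 e"
  by (simp add: \<iota>_def)

lemma iota_Hk: "Hk k (\<iota> k e)"
  by (induction k) (auto simp: iota_Suc iota_0 Hk_0 L2_rep resolvent_Hk)

lemma iota_norm_le: "\<exists>C>0. \<forall>e. Hk_norm k (\<iota> k e) \<le> C * norm e"
proof (induction k)
  case 0
  show ?case by (rule exI[of _ 1]) (simp add: iota_0 Hk_norm_0 L2_rep abs_rep_l2)
next
  case (Suc k)
  then obtain C where C: "C > 0" "\<And>e. Hk_norm k (\<iota> k e) \<le> C * norm e" by blast
  have "Hk_norm (Suc k) (\<iota> (Suc k) e) \<le> (3 + 2 * real k) * C * norm e" for e
  proof -
    have "Hk_norm (Suc k) (\<iota> (Suc k) e) \<le> (3 + 2 * real k) * Hk_norm k (\<iota> k e)"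
      using resolvent_Hk[OF iota_Hk] by (simp add: iota_Suc)
    also have "\<dots> \<le> (3 + 2 * real k) * (C * norm e)" by (intro mult_left_mono C) auto
    finally show ?thesis by (simp add: mult.assoc)
  qed
  then show ?case using C(1) by (intro exI[of _ "(3 + 2 * real k) * C"]) auto
qed

text \<open>One factor 2 from \<open>resolvent_Hk_inverse\<close> for each of the k steps. Together
  with \<open>iota_norm_le\<close> this makes the identification an isomorphism, though not an
  isometry.\<close>

lemma norm_le_iota: "norm e \<le> 2 ^ k * Hk_norm k (\<iota> k e)"
proof (induction k)
  case 0
  show ?case by (simp add: iota_0 Hk_norm_0 L2_rep abs_rep_l2)
next
  case (Suc k)
  also have "2 ^ k * Hk_norm k (\<iota> k e) \<le> 2 ^ k * (2 * Hk_norm (Suc k) (\<iota> (Suc k) e))"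
    using resolvent_Hk_inverse[OF iota_Hk] by (simp add: iota_Suc)
  finally show ?case by simp
qed

lemma iota_surj: "Hk k f \<Longrightarrow> \<exists>e. AE x in lborel. f x = \<iota> k e x"
proof (induction k arbitrary: f)
  case 0
  then show ?case using rep_abs_l2[of f] by (auto simp: Hk_0 iota_0 intro!: exI[of _ "abs_l2 f"] elim!: eventually_mono)
next
  case (Suc k)
  obtain g where g: "Hk k g" "AE x in lborel. f x = resolvent g x" using resolvent_surj[OF Suc.prems] by blast
  then obtain e where e: "AE x in lborel. g x = \<iota> k e x" using Suc.IH by blast
  have "resolvent g = resolvent (\<iota> k e)" using e g Hk_L2 iota_Hk by (intro resolvent_cong) blast+
  then show ?case using g(2) by (auto simp: iota_Suc intro!: exI[of _ e])
qed

text \<open>At level 0 the representatives are arbitrary choices, so linearity can start only almost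
  everywhere; the resolvent ignores null sets, which carries it upwards.\<close>

lemma iota_add_AE: "AE x in lborel. \<iota> k (d + e) x = \<iota> k d x + \<iota> k e x"
  and iota_scaleR_AE: "AE x in lborel. \<iota> k (c *\<^sub>R e) x = c * \<iota> k e x"
proof (induction k)
  case 0
  {
    case 1
    have "abs_l2 (\<lambda>x. rep_l2 d x + rep_l2 e x) = d + e" by (simp add: abs_l2_add L2_rep abs_rep_l2)
    then show ?case using rep_abs_l2[OF L2_add[OF L2_rep L2_rep], of d e] by (simp add: iota_0)
  next
    case 2
    have "abs_l2 (\<lambda>x. c * rep_l2 e x) = c *\<^sub>R e" by (simp add: abs_l2_scaleR L2_rep abs_rep_l2)
    then show ?case using rep_abs_l2[OF L2_cmult[OF L2_rep], of c e] by (simp add: iota_0)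
  }
next
  case (Suc k)
  note L = Hk_L2[OF iota_Hk[of k]]
  {
    case 1
    have "resolvent (\<iota> k (d + e)) = resolvent (\<lambda>x. \<iota> k d x + \<iota> k e x)"
      by (intro resolvent_cong L L2_add Suc)
    then show ?case by (simp add: iota_Suc resolvent_add L)
  next
    case 2
    have "resolvent (\<iota> k (c *\<^sub>R e)) = resolvent (\<lambda>x. c * \<iota> k e x)"
      by (intro resolvent_cong L L2_cmult Suc)
    then show ?case by (simp add: iota_Suc resolvent_cmult L)
  }
qed

lemma iota_continuous: "k \<ge> 1 \<Longrightarrow> continuous_on UNIV (\<iota> k e)"
  by (cases k) (auto simp: iota_Suc intro!: primitive_continuous resolvent Hk_L2[OF iota_Hk])

lemma iota_add: "k \<ge> 1 \<Longrightarrow> \<iota> k (d + e) x = \<iota> k d x + \<iota> k e x"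
  by (rule continuous_AE_eq[OF _ _ iota_add_AE]) (intro continuous_intros iota_continuous; simp)+

lemma iota_scaleR: "k \<ge> 1 \<Longrightarrow> \<iota> k (c *\<^sub>R e) x = c * \<iota> k e x"
  by (rule continuous_AE_eq[OF _ _ iota_scaleR_AE]) (intro continuous_intros iota_continuous; simp)+

lemma iota_diff: "k \<ge> 1 \<Longrightarrow> \<iota> k (d - e) x = \<iota> k d x - \<iota> k e x"
  using iota_add[of k d "-1 *\<^sub>R e" x] iota_scaleR[of k "-1" e x] by simp

lemma iota_inj: "k \<ge> 1 \<Longrightarrow> (AE x in lborel. \<iota> k d x = \<iota> k e x) \<Longrightarrow> d = e"
proof -
  assume k: "k \<ge> 1" and ae: "AE x in lborel. \<iota> k d x = \<iota> k e x"
  have "Hk_norm k (\<iota> k (d - e)) = Hk_norm k (\<lambda>x. 0 * \<iota> k e x)"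
    using ae k Hk_L2[OF iota_Hk] by (intro Hk_cong(2) L2_cmult) (auto simp: iota_diff elim!: eventually_mono)
  also have "\<dots> = 0" using Hk_norm_cmult[OF iota_Hk[of k e], of 0] by simp
  finally show ?thesis using norm_le_iota[of "d - e" k] by simp
qed

lemma iota_surj_continuous:
  assumes "k \<ge> 1" "Hk k f" "continuous_on UNIV f" shows "\<exists>e. f = \<iota> k e"
proof -
  obtain e where "AE x in lborel. f x = \<iota> k e x" using iota_surj[OF assms(2)] by blast
  then have "f = \<iota> k e" by (intro ext continuous_AE_eq assms iota_continuous)
  then show ?thesis by blast
qed

section \<open>Locally Lipschitz maps between Sobolev spaces\<close>

text \<open>f stands for \<phi> - 1. These are the sets on which the constants of all estimates are
  uniform; continuity of f gives the lower bound a meaning at every point.\<close>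

definition admissible :: "nat \<Rightarrow> real \<Rightarrow> real \<Rightarrow> (real \<Rightarrow> real) \<Rightarrow> bool" where
  "admissible k r \<delta> f \<longleftrightarrow> continuous_on UNIV f \<and> Hk k f \<and> Hk_norm k f \<le> r \<and> (\<forall>z. \<delta> \<le> 1 + f z)"

text \<open>A single C bounds both the values and the Lipschitz quotient, which keeps the constants
  of sums and products manageable. Differences of arguments are measured in H^k throughout, while j
  climbs from 0 to k by induction.\<close>

definition Lip_on :: "nat \<Rightarrow> nat \<Rightarrow> real \<Rightarrow> real \<Rightarrow> ((real \<Rightarrow> real) \<Rightarrow> real \<Rightarrow> real) \<Rightarrow> real \<Rightarrow> bool" where
  "Lip_on k j r \<delta> G C \<longleftrightarrow> 0 \<le> C \<and> (\<forall>f. admissible k r \<delta> f \<longrightarrow> Hk j (G f) \<and> Hk_norm j (G f) \<le> C) \<and>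
     (\<forall>f g. admissible k r \<delta> f \<longrightarrow> admissible k r \<delta> g \<longrightarrow>
        Hk_norm j (\<lambda>z. G f z - G g z) \<le> C * Hk_norm k (\<lambda>z. f z - g z))"

definition Lip :: "nat \<Rightarrow> nat \<Rightarrow> ((real \<Rightarrow> real) \<Rightarrow> real \<Rightarrow> real) \<Rightarrow> bool" where
  "Lip k j G \<longleftrightarrow> (\<forall>r \<delta>. 0 < \<delta> \<longrightarrow> (\<exists>C. Lip_on k j r \<delta> G C))"

text \<open>The analogue in the sup norm, for coefficients such as \<phi>^p: they tend to a nonzero
  limit at infinity and act on L^2 as bounded multipliers.\<close>

definition LipSup_on :: "nat \<Rightarrow> real \<Rightarrow> real \<Rightarrow> ((real \<Rightarrow> real) \<Rightarrow> real \<Rightarrow> real) \<Rightarrow> real \<Rightarrow> bool" where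
  "LipSup_on k r \<delta> G C \<longleftrightarrow> 0 \<le> C \<and>
     (\<forall>f. admissible k r \<delta> f \<longrightarrow> G f \<in> borel_measurable borel \<and> (\<forall>z. \<bar>G f z\<bar> \<le> C)) \<and>
     (\<forall>f g z. admissible k r \<delta> f \<longrightarrow> admissible k r \<delta> g \<longrightarrow> \<bar>G f z - G g z\<bar> \<le> C * Hk_norm k (\<lambda>z. f z - g z))"

definition LipSup :: "nat \<Rightarrow> ((real \<Rightarrow> real) \<Rightarrow> real \<Rightarrow> real) \<Rightarrow> bool" where
  "LipSup k G \<longleftrightarrow> (\<forall>r \<delta>. 0 < \<delta> \<longrightarrow> (\<exists>C. LipSup_on k r \<delta> G C))"

section \<open>Calculus of Lipschitz maps between Sobolev spaces\<close>

lemma LipI: "(\<And>r \<delta>. 0 < \<delta> \<Longrightarrow> \<exists>C. Lip_on k j r \<delta> G C) \<Longrightarrow> Lip k j G"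
  by (simp add: Lip_def)

lemma Lip_onI:
  assumes "0 \<le> C" "\<And>f. admissible k r \<delta> f \<Longrightarrow> Hk j (G f)" "\<And>f. admissible k r \<delta> f \<Longrightarrow> Hk_norm j (G f) \<le> C"
    "\<And>f g. admissible k r \<delta> f \<Longrightarrow> admissible k r \<delta> g \<Longrightarrow>
      Hk_norm j (\<lambda>z. G f z - G g z) \<le> C * Hk_norm k (\<lambda>z. f z - g z)"
  shows "Lip_on k j r \<delta> G C"
  using assms by (simp add: Lip_on_def)

lemma Lip_onD:
  assumes "Lip_on k j r \<delta> G C"
  shows "0 \<le> C" "\<And>f. admissible k r \<delta> f \<Longrightarrow> Hk j (G f)" "\<And>f. admissible k r \<delta> f \<Longrightarrow> Hk_norm j (G f) \<le> C"
    "\<And>f g. admissible k r \<delta> f \<Longrightarrow> admissible k r \<delta> g \<Longrightarrow>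
      Hk_norm j (\<lambda>z. G f z - G g z) \<le> C * Hk_norm k (\<lambda>z. f z - g z)"
  using assms by (simp_all add: Lip_on_def)

lemma LipSup_onD:
  assumes "LipSup_on k r \<delta> G C"
  shows "0 \<le> C" "\<And>f. admissible k r \<delta> f \<Longrightarrow> G f \<in> borel_measurable borel"
    "\<And>f z. admissible k r \<delta> f \<Longrightarrow> \<bar>G f z\<bar> \<le> C"
    "\<And>f g z. admissible k r \<delta> f \<Longrightarrow> admissible k r \<delta> g \<Longrightarrow> \<bar>G f z - G g z\<bar> \<le> C * Hk_norm k (\<lambda>z. f z - g z)"
  using assms by (simp_all add: LipSup_on_def)

lemma Lip_bound: "Lip k j G \<Longrightarrow> 0 < \<delta> \<Longrightarrow> \<exists>C. Lip_on k j r \<delta> G C"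
  and LipSup_bound: "LipSup k H \<Longrightarrow> 0 < \<delta> \<Longrightarrow> \<exists>C. LipSup_on k r \<delta> H C"
  by (simp_all add: Lip_def LipSup_def)

lemma Lip_Hk: "Lip k j G \<Longrightarrow> 0 < \<delta> \<Longrightarrow> admissible k r \<delta> f \<Longrightarrow> Hk j (G f)"
  using Lip_bound Lip_onD(2) by blast

lemma Lip_mono:
  assumes G: "Lip k i G" and j: "j \<le> i" shows "Lip k j G"
proof (rule LipI)
  fix r \<delta> :: real assume "0 < \<delta>"
  then obtain C where "Lip_on k i r \<delta> G C" using Lip_bound[OF G] by blast
  note C = Lip_onD[OF this]
  have "Lip_on k j r \<delta> G C"
    by (rule Lip_onI) (use C j in \<open>auto intro: Hk_mono order_trans[OF Hk_norm_mono]\<close>)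
  then show "\<exists>C. Lip_on k j r \<delta> G C" by blast
qed

lemma Lip_id: assumes "j \<le> k" shows "Lip k j (\<lambda>f. f)"
proof (rule Lip_mono[OF LipI assms])
  fix r \<delta> :: real
  have "Lip_on k k r \<delta> (\<lambda>f. f) (max 1 r)"
  proof (rule Lip_onI)
    show "Hk_norm k (\<lambda>z. f z - g z) \<le> max 1 r * Hk_norm k (\<lambda>z. f z - g z)" for f g
      using mult_right_mono[of 1 "max 1 r" "Hk_norm k (\<lambda>z. f z - g z)"] by simp
  qed (auto simp: admissible_def)
  then show "\<exists>C. Lip_on k k r \<delta> (\<lambda>f. f) C" by blast
qed

lemma Lip_add:
  assumes G: "Lip k j G" and H: "Lip k j H" shows "Lip k j (\<lambda>f z. G f z + H f z)"
proof (rule LipI)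
  fix r \<delta> :: real assume d: "0 < \<delta>"
  obtain C D where "Lip_on k j r \<delta> G C" "Lip_on k j r \<delta> H D" using Lip_bound[OF G d] Lip_bound[OF H d] by blast
  note C = Lip_onD[OF this(1)] and D = Lip_onD[OF this(2)]
  have "Lip_on k j r \<delta> (\<lambda>f z. G f z + H f z) (C + D)"
  proof (rule Lip_onI)
    fix f g assume fg: "admissible k r \<delta> f" "admissible k r \<delta> g"
    have "Hk_norm j (\<lambda>z. (G f z - G g z) + (H f z - H g z)) \<le> Hk_norm j (\<lambda>z. G f z - G g z) + Hk_norm j (\<lambda>z. H f z - H g z)"
      by (intro Hk_norm_triangle Hk_diff C D fg)
    with C(4)[OF fg] D(4)[OF fg]
    show "Hk_norm j (\<lambda>z. (G f z + H f z) - (G g z + H g z)) \<le> (C + D) * Hk_norm k (\<lambda>z. f z - g z)"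
      by (simp add: algebra_simps)
  next
    fix f assume f: "admissible k r \<delta> f"
    show "Hk_norm j (\<lambda>z. G f z + H f z) \<le> C + D"
      using Hk_norm_triangle[OF C(2)[OF f] D(2)[OF f]] C(3)[OF f] D(3)[OF f] by simp
  qed (use C(1) D(1) Hk_add[OF C(2) D(2)] in auto)
  then show "\<exists>C. Lip_on k j r \<delta> (\<lambda>f z. G f z + H f z) C" by blast
qed

lemma Lip_cmult:
  assumes G: "Lip k j G" shows "Lip k j (\<lambda>f z. c * G f z)"
proof (rule LipI)
  fix r \<delta> :: real assume d: "0 < \<delta>"
  obtain C where "Lip_on k j r \<delta> G C" using Lip_bound[OF G d] by blast
  note C = Lip_onD[OF this]
  have "Lip_on k j r \<delta> (\<lambda>f z. c * G f z) (\<bar>c\<bar> * C)"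
  proof (rule Lip_onI)
    fix f g assume fg: "admissible k r \<delta> f" "admissible k r \<delta> g"
    have "Hk_norm j (\<lambda>z. c * (G f z - G g z)) = \<bar>c\<bar> * Hk_norm j (\<lambda>z. G f z - G g z)"
      by (intro Hk_norm_cmult Hk_diff C fg)
    also have "\<dots> \<le> \<bar>c\<bar> * (C * Hk_norm k (\<lambda>z. f z - g z))" by (intro mult_left_mono C fg) auto
    finally show "Hk_norm j (\<lambda>z. c * G f z - c * G g z) \<le> (\<bar>c\<bar> * C) * Hk_norm k (\<lambda>z. f z - g z)"
      by (simp add: algebra_simps)
  next
    fix f assume f: "admissible k r \<delta> f"
    show "Hk_norm j (\<lambda>z. c * G f z) \<le> \<bar>c\<bar> * C"
      using C(3)[OF f] by (simp add: Hk_norm_cmult[OF C(2)[OF f]] mult_left_mono)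
  qed (use C(1) Hk_cmult[OF C(2)] in auto)
  then show "\<exists>C. Lip_on k j r \<delta> (\<lambda>f z. c * G f z) C" by blast
qed

lemma Lip_diff: "Lip k j G \<Longrightarrow> Lip k j H \<Longrightarrow> Lip k j (\<lambda>f z. G f z - H f z)"
  using Lip_add[of k j G "\<lambda>f z. -1 * H f z"] Lip_cmult[of k j H "-1"] by simp

text \<open>With G, H taken at f and G', H' at g, G H - G' H' = (G - G') H + G' (H - H'), and the
  product estimate applies to both terms. Since i \<ge> 1 and i \<ge> j, G is available in H^(max 1
  j), as that estimate requires.\<close>

lemma Lip_mult:
  assumes G: "Lip k i G" and H: "Lip k j H" and ij: "1 \<le> i" "j \<le> i"
  shows "Lip k j (\<lambda>f z. G f z * H f z)"
proof (rule LipI)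
  fix r \<delta> :: real assume d: "0 < \<delta>"
  let ?i = "max 1 j"
  have G': "Lip k ?i G" by (rule Lip_mono[OF G]) (use ij in auto)
  obtain C D where "Lip_on k ?i r \<delta> G C" "Lip_on k j r \<delta> H D" using Lip_bound[OF G' d] Lip_bound[OF H d] by blast
  note C = Lip_onD[OF this(1)] and D = Lip_onD[OF this(2)]
  obtain E where E: "E \<ge> 0" "\<And>f g. Hk ?i f \<Longrightarrow> Hk j g \<Longrightarrow> Hk j (\<lambda>x. f x * g x)"
    "\<And>f g. Hk ?i f \<Longrightarrow> Hk j g \<Longrightarrow> Hk_norm j (\<lambda>x. f x * g x) \<le> E * Hk_norm ?i f * Hk_norm j g"
    using Hk_product_ex[of j] by blast
  have nn: "0 \<le> E * C * D" using C(1) D(1) E(1) by simp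
  have "Lip_on k j r \<delta> (\<lambda>f z. G f z * H f z) (E * C * D + E * C * D)"
  proof (rule Lip_onI)
    fix f g assume fg: "admissible k r \<delta> f" "admissible k r \<delta> g"
    let ?N = "Hk_norm k (\<lambda>z. f z - g z)"
    note dG = Hk_diff[OF C(2)[OF fg(1)] C(2)[OF fg(2)]] and dH = Hk_diff[OF D(2)[OF fg(1)] D(2)[OF fg(2)]]
    have eq: "(\<lambda>z. G f z * H f z - G g z * H g z) = (\<lambda>z. (G f z - G g z) * H f z + G g z * (H f z - H g z))"
      by (rule ext) algebra
    have "Hk_norm j (\<lambda>z. (G f z - G g z) * H f z + G g z * (H f z - H g z))
      \<le> Hk_norm j (\<lambda>z. (G f z - G g z) * H f z) + Hk_norm j (\<lambda>z. G g z * (H f z - H g z))"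
      by (intro Hk_norm_triangle E dG dH C D fg)
    also have "Hk_norm j (\<lambda>z. (G f z - G g z) * H f z) \<le> E * Hk_norm ?i (\<lambda>z. G f z - G g z) * Hk_norm j (H f)"
      by (intro E dG D fg)
    also have "\<dots> \<le> E * (C * ?N) * D" using C(1) D(1) E(1) by (intro mult_mono C D fg) auto
    also have "Hk_norm j (\<lambda>z. G g z * (H f z - H g z)) \<le> E * Hk_norm ?i (G g) * Hk_norm j (\<lambda>z. H f z - H g z)"
      by (intro E dH C fg)
    also have "\<dots> \<le> E * C * (D * ?N)" using C(1) D(1) E(1) by (intro mult_mono C D fg) auto
    finally show "Hk_norm j (\<lambda>z. G f z * H f z - G g z * H g z) \<le> (E * C * D + E * C * D) * ?N"
      unfolding eq by (simp add: algebra_simps)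
  next
    fix f assume f: "admissible k r \<delta> f"
    have "Hk_norm j (\<lambda>z. G f z * H f z) \<le> E * Hk_norm ?i (G f) * Hk_norm j (H f)" by (intro E C D f)
    also have "\<dots> \<le> E * C * D" using C(1) D(1) E(1) by (intro mult_mono C D f) auto
    finally show "Hk_norm j (\<lambda>z. G f z * H f z) \<le> E * C * D + E * C * D" using nn by linarith
    show "Hk j (\<lambda>z. G f z * H f z)" by (intro E C D f)
  qed (use nn in linarith)
  then show "\<exists>C. Lip_on k j r \<delta> (\<lambda>f z. G f z * H f z) C" by blast
qed

text \<open>The step of the inductions on j: an L^2 estimate of G and an estimate at level j of the
  map to its derivative combine through \<open>Hk_norm_Suc_le\<close>.\<close>

lemma Lip_Suc:
  assumes G: "Lip k 0 G" and G': "Lip k j G'"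
    and w: "\<And>r \<delta> f. 0 < \<delta> \<Longrightarrow> admissible k r \<delta> f \<Longrightarrow> weakly_diff (G f) (G' f)"
  shows "Lip k (Suc j) G"
proof (rule LipI)
  fix r \<delta> :: real assume d: "0 < \<delta>"
  obtain C D where "Lip_on k 0 r \<delta> G C" "Lip_on k j r \<delta> G' D" using Lip_bound[OF G d] Lip_bound[OF G' d] by blast
  note C = Lip_onD[OF this(1)] and D = Lip_onD[OF this(2)]
  have "Lip_on k (Suc j) r \<delta> G (C + D)"
  proof (rule Lip_onI)
    fix f g assume fg: "admissible k r \<delta> f" "admissible k r \<delta> g"
    note w' = weakly_diff_diff[OF w[OF d fg(1)] w[OF d fg(2)]]
    show "Hk_norm (Suc j) (\<lambda>z. G f z - G g z) \<le> (C + D) * Hk_norm k (\<lambda>z. f z - g z)"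
      using Hk_norm_Suc_le[OF w', of j] C(4)[OF fg] D(4)[OF fg] weakly_diffD(1)[OF w']
      by (simp add: Hk_norm_0 distrib_right)
  next
    fix f assume f: "admissible k r \<delta> f"
    show "Hk (Suc j) (G f)" "Hk_norm (Suc j) (G f) \<le> C + D"
      using Hk_Suc_weakly_diff[OF w[OF d f], of j] D(2)[OF f] D(3)[OF f] C(3)[OF f] Hk_norm_Suc_le[OF w[OF d f], of j]
        weakly_diffD(1)[OF w[OF d f]] by (auto simp: Hk_norm_0)
  qed (use C(1) D(1) in auto)
  then show "\<exists>C. Lip_on k (Suc j) r \<delta> G C" by blast
qed

lemma Lip_weak_D:
  assumes G: "Lip k (Suc j) G" shows "Lip k j (\<lambda>f. weak_D 1 (G f))"
proof (rule LipI)
  fix r \<delta> :: real assume d: "0 < \<delta>"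
  obtain C where "Lip_on k (Suc j) r \<delta> G C" using Lip_bound[OF G d] by blast
  note C = Lip_onD[OF this]
  have "Lip_on k j r \<delta> (\<lambda>f. weak_D 1 (G f)) C"
  proof (rule Lip_onI)
    fix f g assume fg: "admissible k r \<delta> f" "admissible k r \<delta> g"
    show "Hk_norm j (\<lambda>z. weak_D 1 (G f) z - weak_D 1 (G g) z) \<le> C * Hk_norm k (\<lambda>z. f z - g z)"
      using Hk_norm_Suc_ge(2)[OF weakly_diff_diff[OF Hk_weakly_diff[OF C(2)[OF fg(1)]] Hk_weakly_diff[OF C(2)[OF fg(2)]]], of j] C(4)[OF fg] by simp
  next
    fix f assume f: "admissible k r \<delta> f"
    show "Hk j (weak_D 1 (G f))" "Hk_norm j (weak_D 1 (G f)) \<le> C"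
      using Hk_weak_D[OF C(2)[OF f]] C(3)[OF f] Hk_norm_Suc_ge(2)[OF Hk_weakly_diff[OF C(2)[OF f]], of j] by auto
  qed (rule C)
  then show "\<exists>C. Lip_on k j r \<delta> (\<lambda>f. weak_D 1 (G f)) C" by blast
qed

lemma L2_le:
  assumes g: "L2 g" and f: "f \<in> borel_measurable borel" and b: "\<And>x. \<bar>f x\<bar> \<le> B * \<bar>g x\<bar>" and B: "B \<ge> 0"
  shows "L2 f" "norm (abs_l2 f) \<le> B * norm (abs_l2 g)"
proof -
  have b': "\<bar>f x\<bar> \<le> \<bar>B * g x\<bar>" for x using b[of x] B by (simp add: abs_mult)
  show L: "L2 f" by (rule L2_bound[OF L2_cmult[OF g, of B] f]) (use b' in auto)
  have "(LINT x|lborel. (f x)\<^sup>2) \<le> (LINT x|lborel. (B * g x)\<^sup>2)"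
    using b' L2_integrable_square[OF L] L2_integrable_square[OF L2_cmult[OF g, of B]]
    by (intro integral_mono) (auto simp: abs_le_square_iff)
  also have "\<dots> = (B * norm (abs_l2 g))\<^sup>2" using g by (simp add: norm_abs_l2 power_mult_distrib)
  finally show "norm (abs_l2 f) \<le> B * norm (abs_l2 g)"
    using B by (simp add: norm_abs_l2[OF L] real_le_lsqrt)
qed

text \<open>The counterpart of \<open>Lip_mult\<close> at level 0 with a bounded multiplier in place
  of a Sobolev factor; the same splitting of the difference is used.\<close>

lemma LipSup_mult:
  assumes G: "LipSup k G" and H: "Lip k 0 H" shows "Lip k 0 (\<lambda>f z. G f z * H f z)"
proof (rule LipI)
  fix r \<delta> :: real assume d: "0 < \<delta>"
  obtain C D where "LipSup_on k r \<delta> G C" "Lip_on k 0 r \<delta> H D" using LipSup_bound[OF G d] Lip_bound[OF H d] by blast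
  note C = LipSup_onD[OF this(1)] and D = Lip_onD[OF this(2)]
  have L: "L2 (H f)" "norm (abs_l2 (H f)) \<le> D" if "admissible k r \<delta> f" for f
    using D(2,3)[OF that] by (auto simp: Hk_0 Hk_norm_0)
  have 1: "L2 (\<lambda>z. G f z * H f z)" "norm (abs_l2 (\<lambda>z. G f z * H f z)) \<le> C * D" if f: "admissible k r \<delta> f" for f
  proof -
    have m: "(\<lambda>z. G f z * H f z) \<in> borel_measurable borel" using C(2)[OF f] L(1)[OF f] by (auto simp: L2_def)
    have b: "\<bar>G f z * H f z\<bar> \<le> C * \<bar>H f z\<bar>" for z using C(3)[OF f] by (simp add: abs_mult mult_right_mono)
    note l = L2_le[OF L(1)[OF f] m b C(1)]
    show "L2 (\<lambda>z. G f z * H f z)" by (rule l(1))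
    show "norm (abs_l2 (\<lambda>z. G f z * H f z)) \<le> C * D"
      by (rule order_trans[OF l(2)]) (intro mult_left_mono L f C)
  qed
  have nn: "0 \<le> C * D" using C(1) D(1) by simp
  have "Lip_on k 0 r \<delta> (\<lambda>f z. G f z * H f z) (C * D + C * D)"
  proof (rule Lip_onI)
    fix f g assume f: "admissible k r \<delta> f" and g: "admissible k r \<delta> g"
    let ?N = "Hk_norm k (\<lambda>z. f z - g z)"
    have eq: "(\<lambda>z. G f z * H f z - G g z * H g z) = (\<lambda>z. (G f z - G g z) * H f z + G g z * (H f z - H g z))"
      by (rule ext) algebra
    have m: "(\<lambda>z. (G f z - G g z) * H f z) \<in> borel_measurable borel" "(\<lambda>z. G g z * (H f z - H g z)) \<in> borel_measurable borel"
      using C(2)[OF f] C(2)[OF g] L(1)[OF f] L(1)[OF g] by (auto simp: L2_def)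
    have b: "\<bar>(G f z - G g z) * H f z\<bar> \<le> C * ?N * \<bar>H f z\<bar>" "\<bar>G g z * (H f z - H g z)\<bar> \<le> C * \<bar>H f z - H g z\<bar>" for z
      using C(3)[OF g] C(4)[OF f g] by (simp_all add: abs_mult mult_right_mono)
    have CN: "C * ?N \<ge> 0" using C(1) by simp
    note Ld = L2_diff[OF L(1)[OF f] L(1)[OF g]]
    note a1 = L2_le[OF L(1)[OF f] m(1) b(1) CN] and a2 = L2_le[OF Ld m(2) b(2) C(1)]
    have "norm (abs_l2 (\<lambda>z. (G f z - G g z) * H f z)) \<le> C * ?N * D"
      by (rule order_trans[OF a1(2)]) (intro mult_left_mono L f CN)
    moreover have "norm (abs_l2 (\<lambda>z. H f z - H g z)) \<le> D * ?N"
      using D(4)[OF f g] Ld by (simp add: Hk_norm_0)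
    then have "norm (abs_l2 (\<lambda>z. G g z * (H f z - H g z))) \<le> C * (D * ?N)"
      using a2(2) C(1) by (meson mult_left_mono order_trans)
    ultimately have "norm (abs_l2 (\<lambda>z. G f z * H f z - G g z * H g z)) \<le> (C * D + C * D) * ?N"
      unfolding eq abs_l2_add[OF a1(1) a2(1)]
      using norm_triangle_ineq[of "abs_l2 (\<lambda>z. (G f z - G g z) * H f z)" "abs_l2 (\<lambda>z. G g z * (H f z - H g z))"]
      by (simp add: algebra_simps)
    then show "Hk_norm 0 (\<lambda>z. G f z * H f z - G g z * H g z) \<le> (C * D + C * D) * ?N"
      using L2_diff[OF 1(1)[OF f] 1(1)[OF g]] by (simp add: Hk_norm_0)
  next
    fix f assume f: "admissible k r \<delta> f"
    show "Hk 0 (\<lambda>z. G f z * H f z)" "Hk_norm 0 (\<lambda>z. G f z * H f z) \<le> C * D + C * D"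
      using 1[OF f] nn by (simp_all add: Hk_0 Hk_norm_0)
  qed (use nn in simp)
  then show "\<exists>C. Lip_on k 0 r \<delta> (\<lambda>f z. G f z * H f z) C" by blast
qed

section \<open>Powers of \<phi> as Lipschitz maps\<close>

lemma powr_lipschitz:
  assumes "0 < d"
  shows "\<exists>L\<ge>0. \<forall>x\<in>{d..M}. \<forall>y\<in>{d..M}. \<bar>x powr p - y powr p\<bar> \<le> L * \<bar>x - y :: real\<bar>"
proof -
  have "continuous_on {d..M} (\<lambda>x. p * x powr (p - 1))" using assms by (intro continuous_intros) auto
  then have "bounded ((\<lambda>x. p * x powr (p - 1)) ` {d..M})"
    by (intro compact_imp_bounded compact_continuous_image) auto
  then obtain L where L: "\<And>x. x \<in> {d..M} \<Longrightarrow> \<bar>p * x powr (p - 1)\<bar> \<le> L" unfolding bounded_iff by force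
  have "\<bar>x powr p - y powr p\<bar> \<le> \<bar>L\<bar> * \<bar>x - y\<bar>" if xy: "x \<in> {d..M}" "y \<in> {d..M}" for x y
  proof -
    have "norm (x powr p - y powr p) \<le> L * norm (x - y)"
    proof (rule field_differentiable_bound[of "{d..M}" _ "\<lambda>x. p * x powr (p - 1)"])
      fix z assume "z \<in> {d..M}"
      then show "((\<lambda>x. x powr p) has_field_derivative p * z powr (p - 1)) (at z within {d..M})"
        using assms by (auto intro!: derivative_eq_intros has_field_derivative_at_within[OF has_real_derivative_powr])
    qed (use xy L in auto)
    also have "\<dots> \<le> \<bar>L\<bar> * norm (x - y)" by (intro mult_right_mono) auto
    finally show ?thesis by simp
  qed
  then show ?thesis by (intro exI[of _ "\<bar>L\<bar>"]) auto
qed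

text \<open>The lower end is \<open>min \<delta> 1\<close> and not \<delta>, so that the interval
  also contains 1, the value of \<phi> at infinity. Comparing with it bounds \<phi>^p - 1 by a
  multiple of \<phi> - 1.\<close>

lemma admissible_range:
  assumes "admissible k r \<delta> f" "k \<ge> 1" shows "1 + f z \<in> {min \<delta> 1..1 + 2 * \<bar>r\<bar>}" "0 \<le> r"
proof -
  have "\<bar>f z\<bar> \<le> 2 * Hk_norm k f" using assms by (intro Hk_sup_bound) (auto simp: admissible_def)
  then show "1 + f z \<in> {min \<delta> 1..1 + 2 * \<bar>r\<bar>}" using assms by (auto simp: admissible_def min_le_iff_disj)
  show "0 \<le> r" using assms Hk_norm_nonneg[of k f] unfolding admissible_def by linarith
qed

lemma admissible_powr_continuous:
  assumes "admissible k r \<delta> f" "0 < \<delta>" shows "continuous_on UNIV (\<lambda>z. (1 + f z) powr p)"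
proof -
  have "1 + f z \<noteq> 0" for z using assms unfolding admissible_def by (metis less_le_not_le)
  then show ?thesis using assms by (intro continuous_on_powr continuous_intros) (auto simp: admissible_def)
qed

lemma admissible_powr_measurable:
  "admissible k r \<delta> f \<Longrightarrow> 0 < \<delta> \<Longrightarrow> (\<lambda>z. (1 + f z) powr p) \<in> borel_measurable borel"
  by (intro borel_measurable_continuous_onI admissible_powr_continuous)

lemma admissible_powr_lipschitz:
  assumes "k \<ge> 1" "0 < \<delta>"
  shows "\<exists>L\<ge>0. (\<forall>f g z. admissible k r \<delta> f \<longrightarrow> admissible k r \<delta> g \<longrightarrow> \<bar>(1 + f z) powr p - (1 + g z) powr p\<bar> \<le> L * \<bar>f z - g z\<bar>)
    \<and> (\<forall>f z. admissible k r \<delta> f \<longrightarrow> \<bar>(1 + f z) powr p - 1\<bar> \<le> L * \<bar>f z\<bar>)"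
proof -
  obtain L where L: "L \<ge> 0" "\<And>x y. x \<in> {min \<delta> 1..1 + 2 * \<bar>r\<bar>} \<Longrightarrow> y \<in> {min \<delta> 1..1 + 2 * \<bar>r\<bar>} \<Longrightarrow> \<bar>x powr p - y powr p\<bar> \<le> L * \<bar>x - y\<bar>"
    using powr_lipschitz[of "min \<delta> 1" "1 + 2 * \<bar>r\<bar>" p] assms by auto
  have "\<bar>(1 + f z) powr p - (1 + g z) powr p\<bar> \<le> L * \<bar>f z - g z\<bar>" if "admissible k r \<delta> f" "admissible k r \<delta> g" for f g z
    using L(2)[OF admissible_range(1)[OF that(1) assms(1)] admissible_range(1)[OF that(2) assms(1)], of z z] by simp
  moreover have "\<bar>(1 + f z) powr p - 1\<bar> \<le> L * \<bar>f z\<bar>" if "admissible k r \<delta> f" for f z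
    using L(2)[OF admissible_range(1)[OF that assms(1)], of 1 z] by simp
  ultimately show ?thesis using L(1) by blast
qed

lemma LipSup_powr:
  assumes "k \<ge> 1" shows "LipSup k (\<lambda>f z. c * (1 + f z) powr p)"
  unfolding LipSup_def
proof (intro allI impI)
  fix r \<delta> :: real assume d: "0 < \<delta>"
  obtain L where L: "L \<ge> 0" "\<And>f g z. admissible k r \<delta> f \<Longrightarrow> admissible k r \<delta> g \<Longrightarrow> \<bar>(1 + f z) powr p - (1 + g z) powr p\<bar> \<le> L * \<bar>f z - g z\<bar>"
    "\<And>f z. admissible k r \<delta> f \<Longrightarrow> \<bar>(1 + f z) powr p - 1\<bar> \<le> L * \<bar>f z\<bar>"
    using admissible_powr_lipschitz[OF assms d, of r p] by blast
  \<comment> \<open>The first two terms bound \<phi>^p = 1 + (\<phi>^p - 1); the last is the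
    Lipschitz constant L times the factor 2 of the Sobolev embedding.\<close>
  define K where "K = 1 + L * (2 * \<bar>r\<bar>) + L * 2"
  have K: "0 \<le> K" using L(1) by (simp add: K_def)
  have sup: "\<bar>f z\<bar> \<le> 2 * Hk_norm k f" if "Hk k f" "continuous_on UNIV f" for f z using Hk_sup_bound[OF that(1) assms that(2)] .
  have 1: "\<bar>(1 + f z) powr p\<bar> \<le> K" if f: "admissible k r \<delta> f" for f z
  proof -
    have "\<bar>f z\<bar> \<le> 2 * \<bar>r\<bar>" using sup[of f z] f by (auto simp: admissible_def)
    then have "L * \<bar>f z\<bar> \<le> L * (2 * \<bar>r\<bar>)" using L(1) by (intro mult_left_mono) auto
    then show ?thesis using L(3)[OF f, of z] L(1) unfolding K_def by linarith
  qed
  have 2: "\<bar>(1 + f z) powr p - (1 + g z) powr p\<bar> \<le> K * Hk_norm k (\<lambda>z. f z - g z)"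
    if f: "admissible k r \<delta> f" and g: "admissible k r \<delta> g" for f g z
  proof -
    let ?N = "Hk_norm k (\<lambda>z. f z - g z)"
    have "\<bar>f z - g z\<bar> \<le> 2 * ?N" using f g by (intro sup[of "\<lambda>z. f z - g z"] Hk_diff continuous_intros) (auto simp: admissible_def)
    then have "L * \<bar>f z - g z\<bar> \<le> L * (2 * ?N)" using L(1) by (intro mult_left_mono) auto
    also have "\<dots> \<le> K * ?N" using L(1) by (simp add: K_def distrib_right mult.assoc)
    finally show ?thesis using L(2)[OF f g, of z] by simp
  qed
  have "LipSup_on k r \<delta> (\<lambda>f z. c * (1 + f z) powr p) (\<bar>c\<bar> * K)"
    unfolding LipSup_on_def
    using K 1 2 admissible_powr_measurable[OF _ d]
    by (auto simp: abs_mult right_diff_distrib[symmetric] mult.assoc intro!: mult_left_mono)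
  then show "\<exists>C. LipSup_on k r \<delta> (\<lambda>f z. c * (1 + f z) powr p) C" by blast
qed

lemma Lip_powr_0:
  assumes "k \<ge> 1" shows "Lip k 0 (\<lambda>f z. (1 + f z) powr p - 1)"
proof (rule LipI)
  fix r \<delta> :: real assume d: "0 < \<delta>"
  obtain L where L: "L \<ge> 0" "\<And>f g z. admissible k r \<delta> f \<Longrightarrow> admissible k r \<delta> g \<Longrightarrow> \<bar>(1 + f z) powr p - (1 + g z) powr p\<bar> \<le> L * \<bar>f z - g z\<bar>"
    "\<And>f z. admissible k r \<delta> f \<Longrightarrow> \<bar>(1 + f z) powr p - 1\<bar> \<le> L * \<bar>f z\<bar>"
    using admissible_powr_lipschitz[OF assms d, of r p] by blast
  have 1: "L2 (\<lambda>z. (1 + f z) powr p - 1)" "norm (abs_l2 (\<lambda>z. (1 + f z) powr p - 1)) \<le> L * norm (abs_l2 f)" if f: "admissible k r \<delta> f" for f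
  proof -
    have Lf: "L2 f" using f Hk_L2 unfolding admissible_def by blast
    have m: "(\<lambda>z. (1 + f z) powr p - 1) \<in> borel_measurable borel" using admissible_powr_measurable[OF f d] by simp
    show "L2 (\<lambda>z. (1 + f z) powr p - 1)" "norm (abs_l2 (\<lambda>z. (1 + f z) powr p - 1)) \<le> L * norm (abs_l2 f)"
      by (rule L2_le[OF Lf m L(3)[OF f] L(1)])+
  qed
  have "Lip_on k 0 r \<delta> (\<lambda>f z. (1 + f z) powr p - 1) (L * \<bar>r\<bar> + L)"
  proof (rule Lip_onI)
    fix f g assume f: "admissible k r \<delta> f" and g: "admissible k r \<delta> g"
    let ?d = "\<lambda>z. ((1 + f z) powr p - 1) - ((1 + g z) powr p - 1)" and ?N = "Hk_norm k (\<lambda>z. f z - g z)"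
    have Ld: "L2 (\<lambda>z. f z - g z)" using f g by (intro L2_diff) (simp_all add: admissible_def Hk_L2[of k])
    have "L2 ?d" by (intro L2_diff 1 f g)
    moreover from this have "norm (abs_l2 ?d) \<le> L * norm (abs_l2 (\<lambda>z. f z - g z))"
      using L(2)[OF f g] by (intro L2_le(2)[OF Ld _ _ L(1)]) (simp_all add: L2_def)
    moreover have "L * norm (abs_l2 (\<lambda>z. f z - g z)) \<le> L * ?N"
      using L(1) norm_le_Hk_norm[OF Ld] by (intro mult_left_mono) auto
    moreover have "\<dots> \<le> (L * \<bar>r\<bar> + L) * ?N" using L(1) by (intro mult_right_mono) auto
    ultimately show "Hk_norm 0 ?d \<le> (L * \<bar>r\<bar> + L) * ?N" by (simp add: Hk_norm_0)
  next
    fix f assume f: "admissible k r \<delta> f"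
    have "norm (abs_l2 f) \<le> \<bar>r\<bar>" using norm_le_Hk_norm[of f k] f Hk_L2[of k f] by (auto simp: admissible_def)
    then have "L * norm (abs_l2 f) \<le> L * \<bar>r\<bar>" using L(1) by (intro mult_left_mono) auto
    then show "Hk 0 (\<lambda>z. (1 + f z) powr p - 1)" "Hk_norm 0 (\<lambda>z. (1 + f z) powr p - 1) \<le> L * \<bar>r\<bar> + L"
      using 1[OF f] L(1) by (simp_all add: Hk_0 Hk_norm_0)
  qed (use L(1) in simp)
  then show "\<exists>C. Lip_on k 0 r \<delta> (\<lambda>f z. (1 + f z) powr p - 1) C" by blast
qed

lemma admissible_primitive:
  assumes "admissible k r \<delta> f" "k \<ge> 1" shows "primitive f (weak_D 1 f)"
proof -
  have "Hk (Suc 0) f" using assms by (auto simp: admissible_def Suc_le_eq intro: Hk_mono)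
  then show ?thesis using assms(1) by (intro weakly_diff_primitive Hk_weakly_diff) (auto simp: admissible_def)
qed

lemma admissible_powr_primitive:
  assumes "admissible k r \<delta> f" "k \<ge> 1" "0 < \<delta>"
  shows "primitive (\<lambda>z. (1 + f z) powr p - 1) (\<lambda>z. (p * (1 + f z) powr (p - 1)) * weak_D 1 f z)"
proof -
  have pos: "1 + f z > 0" for z using assms(1,3) less_le_trans unfolding admissible_def by blast
  have "((\<lambda>y. (1 + y) powr p - 1) has_real_derivative p * (1 + f z) powr (p - 1)) (at (f z))" for z
    using pos[of z] by (auto intro!: derivative_eq_intros)
  moreover have "continuous_on UNIV (\<lambda>z. p * (1 + f z) powr (p - 1))"
    by (intro continuous_intros admissible_powr_continuous[OF assms(1,3)])
  ultimately show ?thesis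
    using primitive_chain[OF admissible_primitive[OF assms(1,2)], of "\<lambda>y. (1 + y) powr p - 1" "\<lambda>y. p * (1 + y) powr (p - 1)"] by blast
qed

text \<open>The derivative of \<phi>^p involves \<phi>^(p-1), so the induction on j runs over all
  exponents at once. If the derivative is to be controlled in L^2 only, its coefficient acts as a
  bounded multiplier; beyond that it is split as (\<phi>^(p-1) - 1) + 1, so that only factors from
  Sobolev spaces are multiplied.\<close>

lemma Lip_powr:
  assumes k: "k \<ge> 1" shows "j \<le> k \<Longrightarrow> Lip k j (\<lambda>f z. (1 + f z) powr p - 1)"
proof (induction j arbitrary: p)
  case 0
  show ?case by (rule Lip_powr_0[OF k])
next
  case (Suc j)
  have D: "Lip k j (\<lambda>f. weak_D 1 f)" by (intro Lip_weak_D Lip_id Suc.prems)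
  have "Lip k j (\<lambda>f z. (p * (1 + f z) powr (p - 1)) * weak_D 1 f z)"
  proof (cases "j = 0")
    case True
    then show ?thesis using D by (auto intro!: LipSup_mult LipSup_powr k)
  next
    case False
    have "Lip k j (\<lambda>f z. p * (((1 + f z) powr (p - 1) - 1) * weak_D 1 f z) + p * weak_D 1 f z)"
      using False Suc by (intro Lip_add Lip_cmult Lip_mult[where i = j] D) auto
    moreover have "(\<lambda>f z. p * (((1 + f z) powr (p - 1) - 1) * weak_D 1 f z) + p * weak_D 1 f z)
        = (\<lambda>f z. (p * (1 + f z) powr (p - 1)) * weak_D 1 f z)"
      by (intro ext) algebra
    ultimately show ?thesis by (simp only:)
  qed
  note D1 = this
  show ?case
  proof (rule Lip_Suc[OF Lip_powr_0[OF k] D1])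
    fix r \<delta> f assume d: "0 < \<delta>" and f: "admissible k r \<delta> f"
    show "weakly_diff (\<lambda>z. (1 + f z) powr p - 1) (\<lambda>z. (p * (1 + f z) powr (p - 1)) * weak_D 1 f z)"
      using Lip_Hk[OF Lip_powr_0[OF k] d f, of p] Lip_Hk[OF D1 d f]
      by (intro primitive_weakly_diff admissible_powr_primitive[OF f k d] Hk_L2)
  qed
qed

section \<open>The flux system in $H^k$\<close>

text \<open>The system of \<open>system_energy\<close> with a = \<phi>^(-n), b = \<phi>^m and data g
  = 1 - \<phi>^(-n), h = 0. The data are square integrable because \<phi> - 1 is.\<close>

definition flux_system :: "real \<Rightarrow> real \<Rightarrow> (real \<Rightarrow> real) \<Rightarrow> (real \<Rightarrow> real) \<Rightarrow> (real \<Rightarrow> real) \<Rightarrow> bool" where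
  "flux_system n m f u v \<longleftrightarrow>
     primitive u (\<lambda>z. (1 + f z) powr (- n) * v z + (1 - (1 + f z) powr (- n))) \<and>
     primitive v (\<lambda>z. (1 + f z) powr m * u z) \<and> L2 u \<and> L2 v"

text \<open>Extrema of a continuous function on the compact range of \<phi> serve both signs of p;
  the minimum is positive since the range stays away from 0.\<close>

lemma admissible_powr_bounds:
  assumes "k \<ge> 1" "0 < \<delta>"
  shows "\<exists>c C. 0 < c \<and> (\<forall>f z. admissible k r \<delta> f \<longrightarrow> c \<le> (1 + f z) powr p \<and> (1 + f z) powr p \<le> C)"
proof -
  let ?I = "{min \<delta> 1..1 + 2 * \<bar>r\<bar>}"
  have c: "continuous_on ?I (\<lambda>x. x powr p)" using assms by (intro continuous_intros) auto
  have ne: "?I \<noteq> {}" by (auto simp: min_le_iff_disj)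
  obtain x where x: "x \<in> ?I" "\<And>y. y \<in> ?I \<Longrightarrow> x powr p \<le> y powr p"
    using continuous_attains_inf[OF compact_Icc ne c] by blast
  obtain w where w: "w \<in> ?I" "\<And>y. y \<in> ?I \<Longrightarrow> y powr p \<le> w powr p"
    using continuous_attains_sup[OF compact_Icc ne c] by blast
  have "0 < x" using x(1) assms(2) by auto
  then show ?thesis
    using x(2) w(2) admissible_range(1)[OF _ assms(1), of r \<delta>] by (intro exI[of _ "x powr p"] exI[of _ "w powr p"]) auto
qed

lemma admissible_coefficient_bounds:
  assumes "k \<ge> 1" "0 < \<delta>"
  shows "\<exists>c C. 0 < c \<and> (\<forall>f z. admissible k r \<delta> f \<longrightarrow>
    c \<le> (1 + f z) powr p \<and> (1 + f z) powr p \<le> C \<and> c \<le> (1 + f z) powr q \<and> (1 + f z) powr q \<le> C)"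
proof -
  obtain c C where c: "0 < c" "\<And>f z. admissible k r \<delta> f \<Longrightarrow> c \<le> (1 + f z) powr p \<and> (1 + f z) powr p \<le> C"
    using admissible_powr_bounds[OF assms, of r p] by blast
  obtain d D where d: "0 < d" "\<And>f z. admissible k r \<delta> f \<Longrightarrow> d \<le> (1 + f z) powr q \<and> (1 + f z) powr q \<le> D"
    using admissible_powr_bounds[OF assms, of r q] by blast
  have "min c d \<le> (1 + f z) powr p \<and> (1 + f z) powr p \<le> max C D \<and> min c d \<le> (1 + f z) powr q \<and> (1 + f z) powr q \<le> max C D"
    if "admissible k r \<delta> f" for f z
    using c(2)[OF that, of z] d(2)[OF that, of z] by (simp add: min_le_iff_disj le_max_iff_disj)
  then show ?thesis using c(1) d(1) by (intro exI[of _ "min c d"] exI[of _ "max C D"]) simp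
qed

lemma system_energy_sum:
  assumes p: "primitive u (\<lambda>x. a x * v x + g x)" "primitive v (\<lambda>x. b x * u x + h x)"
    and L: "L2 u" "L2 v" "L2 g" "L2 h"
    and ab: "a \<in> borel_measurable borel" "b \<in> borel_measurable borel"
      "\<And>x. c \<le> a x" "\<And>x. c \<le> b x" "\<And>x. a x \<le> C" "\<And>x. b x \<le> C" and c: "c > 0"
  shows "c * norm (abs_l2 u) \<le> norm (abs_l2 g) + norm (abs_l2 h)"
    "c * norm (abs_l2 v) \<le> norm (abs_l2 g) + norm (abs_l2 h)"
proof -
  note e = system_energy[OF p L ab c]
  have le: "(c * x)\<^sup>2 \<le> (norm (abs_l2 g) + norm (abs_l2 h))\<^sup>2"
    if "x\<^sup>2 \<le> (norm (abs_l2 u))\<^sup>2 + (norm (abs_l2 v))\<^sup>2" for x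
  proof -
    have "(c * x)\<^sup>2 \<le> c\<^sup>2 * ((norm (abs_l2 u))\<^sup>2 + (norm (abs_l2 v))\<^sup>2)"
      unfolding power_mult_distrib by (intro mult_left_mono that) auto
    also have "\<dots> \<le> (norm (abs_l2 g) + norm (abs_l2 h))\<^sup>2" using e by (simp add: power2_sum add_increasing2)
    finally show ?thesis .
  qed
  show "c * norm (abs_l2 u) \<le> norm (abs_l2 g) + norm (abs_l2 h)"
    by (rule power2_le_imp_le[OF le]) auto
  show "c * norm (abs_l2 v) \<le> norm (abs_l2 g) + norm (abs_l2 h)"
    by (rule power2_le_imp_le[OF le]) auto
qed

lemma admissible_powr_L2:
  "admissible k r \<delta> f \<Longrightarrow> k \<ge> 1 \<Longrightarrow> 0 < \<delta> \<Longrightarrow> L2 (\<lambda>z. 1 - (1 + f z) powr p)"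
  using Lip_Hk[OF Lip_powr_0] L2_cmult[of "\<lambda>z. (1 + f z) powr p - 1" "-1"] by (simp add: Hk_0)

lemma flux_system_exists:
  assumes f: "admissible k r \<delta> f" and k: "k \<ge> 1" and d: "0 < \<delta>"
  shows "\<exists>u v. flux_system n m f u v"
proof -
  obtain c C where c: "0 < c" and b: "\<And>z. c \<le> (1 + f z) powr (-n) \<and> (1 + f z) powr (-n) \<le> C \<and> c \<le> (1 + f z) powr m \<and> (1 + f z) powr m \<le> C"
    using admissible_coefficient_bounds[OF k d, of r "-n" m] f by blast
  have "\<exists>u v. primitive u (\<lambda>z. (1 + f z) powr (- n) * v z + (1 - (1 + f z) powr (- n))) \<and>
     primitive v (\<lambda>z. (1 + f z) powr m * u z + 0) \<and> L2 u \<and> L2 v"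
    by (rule system_solution[where c = c and l = C])
       (use b c admissible_powr_measurable[OF f d] admissible_powr_L2[OF f k d] L2_zero in simp_all)
  then show ?thesis by (simp add: flux_system_def)
qed

text \<open>The difference of two solutions solves the system with zero data, so the energy estimate
  makes its norm vanish; continuity turns this into equality of functions.\<close>

lemma flux_system_unique:
  assumes f: "admissible k r \<delta> f" and k: "k \<ge> 1" and d: "0 < \<delta>"
    and s: "flux_system n m f u v" "flux_system n m f u' v'"
  shows "u = u'" "v = v'"
proof -
  obtain c C where c: "0 < c" and b: "\<And>z. c \<le> (1 + f z) powr (-n) \<and> (1 + f z) powr (-n) \<le> C \<and> c \<le> (1 + f z) powr m \<and> (1 + f z) powr m \<le> C"
    using admissible_coefficient_bounds[OF k d, of r "-n" m] f by blast
  note s1 = s(1)[unfolded flux_system_def] and s2 = s(2)[unfolded flux_system_def]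
  have L: "L2 u" "L2 v" "L2 u'" "L2 v'" using s1 s2 by auto
  have "primitive (\<lambda>z. u z - u' z) (\<lambda>z. ((1 + f z) powr (- n) * v z + (1 - (1 + f z) powr (- n))) - ((1 + f z) powr (- n) * v' z + (1 - (1 + f z) powr (- n))))"
    using s1 s2 by (intro primitive_diff) auto
  then have p1: "primitive (\<lambda>z. u z - u' z) (\<lambda>z. (1 + f z) powr (- n) * (v z - v' z) + 0)" by (simp add: algebra_simps)
  have "primitive (\<lambda>z. v z - v' z) (\<lambda>z. (1 + f z) powr m * u z - (1 + f z) powr m * u' z)"
    using s1 s2 by (intro primitive_diff) auto
  then have p2: "primitive (\<lambda>z. v z - v' z) (\<lambda>z. (1 + f z) powr m * (u z - u' z) + 0)" by (simp add: algebra_simps)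
  have z: "norm (abs_l2 (\<lambda>x. 0)) = 0" by (simp add: norm_abs_l2 L2_zero)
  have "c * norm (abs_l2 (\<lambda>z. u z - u' z)) \<le> norm (abs_l2 (\<lambda>x. 0)) + norm (abs_l2 (\<lambda>x. 0))"
    "c * norm (abs_l2 (\<lambda>z. v z - v' z)) \<le> norm (abs_l2 (\<lambda>x. 0)) + norm (abs_l2 (\<lambda>x. 0))"
    by (rule system_energy_sum[OF p1 p2, where C = C];
        use b c admissible_powr_measurable[OF f d] L in \<open>simp add: L2_zero L2_diff\<close>)+
  moreover have "x = 0" if "c * norm x \<le> norm (abs_l2 (\<lambda>x. 0)) + norm (abs_l2 (\<lambda>x. 0))" for x :: l2
  proof (rule ccontr)
    assume "x \<noteq> 0"
    then have "c * norm x > 0" using c by simp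
    with that show False unfolding z by linarith
  qed
  ultimately have "abs_l2 (\<lambda>z. u z - u' z) = 0" "abs_l2 (\<lambda>z. v z - v' z) = 0" by blast+
  then have "abs_l2 u = abs_l2 u'" "abs_l2 v = abs_l2 v'"
    unfolding abs_l2_diff[OF L(1,3)] abs_l2_diff[OF L(2,4)] by auto
  then have ae: "AE z in lborel. u z = u' z" "AE z in lborel. v z = v' z"
    unfolding abs_l2_eq_iff[OF L(1,3)] abs_l2_eq_iff[OF L(2,4)] by blast+
  have "continuous_on UNIV u" "continuous_on UNIV u'" "continuous_on UNIV v" "continuous_on UNIV v'"
    using s1 s2 primitive_continuous by auto
  then show "u = u'" "v = v'" using ae continuous_AE_eq by blast+
qed

definition flux_solution :: "real \<Rightarrow> real \<Rightarrow> (real \<Rightarrow> real) \<Rightarrow> (real \<Rightarrow> real) \<times> (real \<Rightarrow> real)" where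
  "flux_solution n m f = (SOME p. flux_system n m f (fst p) (snd p))"

abbreviation ell_u :: "real \<Rightarrow> real \<Rightarrow> (real \<Rightarrow> real) \<Rightarrow> real \<Rightarrow> real" where "ell_u n m f \<equiv> fst (flux_solution n m f)"
abbreviation ell_v :: "real \<Rightarrow> real \<Rightarrow> (real \<Rightarrow> real) \<Rightarrow> real \<Rightarrow> real" where "ell_v n m f \<equiv> snd (flux_solution n m f)"

lemma flux_solution:
  assumes "admissible k r \<delta> f" "k \<ge> 1" "0 < \<delta>"
  shows "flux_system n m f (ell_u n m f) (ell_v n m f)"
proof -
  have "\<exists>p. flux_system n m f (fst p) (snd p)" using flux_system_exists[OF assms, of n m] by simp
  from someI_ex[OF this] show ?thesis unfolding flux_solution_def .
qed

text \<open>The energy estimate is used twice: for the solution itself, and for the difference of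
  the solutions for f and g. The latter solves the system of f, with data made of coefficient
  differences, small in the sup norm, times the solution for g, plus a difference of powers that is
  small in L^2.\<close>

lemma flux_solution_Lip_0:
  assumes k: "k \<ge> 1"
  shows "Lip k 0 (ell_u n m)" "Lip k 0 (ell_v n m)"
proof -
  have main: "\<exists>K. Lip_on k 0 r \<delta> (ell_u n m) K \<and> Lip_on k 0 r \<delta> (ell_v n m) K" if d: "0 < \<delta>" for r \<delta>
  proof -
    obtain c C where c: "0 < c" and b: "\<And>f z. admissible k r \<delta> f \<Longrightarrow>
        c \<le> (1 + f z) powr (-n) \<and> (1 + f z) powr (-n) \<le> C \<and> c \<le> (1 + f z) powr m \<and> (1 + f z) powr m \<le> C"
      using admissible_coefficient_bounds[OF k d, of r "-n" m] by blast
    obtain A B where "LipSup_on k r \<delta> (\<lambda>f z. 1 * (1 + f z) powr (-n)) A" "LipSup_on k r \<delta> (\<lambda>f z. 1 * (1 + f z) powr m) B"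
      using LipSup_bound[OF LipSup_powr[OF k] d] by blast
    note A = LipSup_onD(1,4)[OF this(1), unfolded mult_1] and B = LipSup_onD(1,4)[OF this(2), unfolded mult_1]
    obtain D where "Lip_on k 0 r \<delta> (\<lambda>f z. -1 * ((1 + f z) powr (-n) - 1)) D"
      using Lip_bound[OF Lip_cmult[OF Lip_powr_0[OF k]] d] by blast
    note D = Lip_onD(1,3,4)[OF this]
    have D1: "norm (abs_l2 (\<lambda>z. 1 - (1 + f z) powr (-n))) \<le> D" if "admissible k r \<delta> f" for f
      using D(2)[OF that] admissible_powr_L2[OF that k d, of "-n"] by (simp add: Hk_norm_0)
    have D2: "norm (abs_l2 (\<lambda>z. (1 + g z) powr (-n) - (1 + f z) powr (-n))) \<le> D * Hk_norm k (\<lambda>z. f z - g z)"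
      if "admissible k r \<delta> f" "admissible k r \<delta> g" for f g
      using D(3)[OF that] L2_diff[OF admissible_powr_L2[OF that(1) k d, of "-n"] admissible_powr_L2[OF that(2) k d, of "-n"]]
      by (simp add: Hk_norm_0)
    define M where "M = D / c"
    have M: "M \<ge> 0" using D(1) c by (simp add: M_def)
    note sol = flux_solution[OF _ k d, of r _ n m, unfolded flux_system_def]
    have L: "L2 (ell_u n m f)" "L2 (ell_v n m f)" if "admissible k r \<delta> f" for f using sol[OF that] by auto
    have bu: "norm (abs_l2 (ell_u n m f)) \<le> M" "norm (abs_l2 (ell_v n m f)) \<le> M" if f: "admissible k r \<delta> f" for f
    proof -
      have p1: "primitive (ell_u n m f) (\<lambda>z. (1 + f z) powr (- n) * ell_v n m f z + (1 - (1 + f z) powr (- n)))"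
        and p2: "primitive (ell_v n m f) (\<lambda>z. (1 + f z) powr m * ell_u n m f z + 0)" using sol[OF f] by auto
      have z: "norm (abs_l2 (\<lambda>x. 0)) = 0" by (simp add: norm_abs_l2 L2_zero)
      have "c * norm (abs_l2 (ell_u n m f)) \<le> norm (abs_l2 (\<lambda>z. 1 - (1 + f z) powr (-n))) + norm (abs_l2 (\<lambda>x. 0))"
        "c * norm (abs_l2 (ell_v n m f)) \<le> norm (abs_l2 (\<lambda>z. 1 - (1 + f z) powr (-n))) + norm (abs_l2 (\<lambda>x. 0))"
        by (rule system_energy_sum[OF p1 p2, where C = C];
            use b[OF f] c admissible_powr_measurable[OF f d] L[OF f] admissible_powr_L2[OF f k d] in \<open>simp add: L2_zero\<close>)+
      then show "norm (abs_l2 (ell_u n m f)) \<le> M" "norm (abs_l2 (ell_v n m f)) \<le> M"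
        using D1[OF f] c unfolding z by (auto simp: M_def field_simps)
    qed
    \<comment> \<open>M bounds the solutions; the quotient is the Lipschitz constant, where A M + D
      comes from the data of the first row and B M from those of the second. The sum serves both
      purposes.\<close>
    define K where "K = M + (A * M + D + B * M) / c"
    have bd: "norm (abs_l2 (\<lambda>z. ell_u n m f z - ell_u n m g z)) \<le> K * Hk_norm k (\<lambda>z. f z - g z)"
        "norm (abs_l2 (\<lambda>z. ell_v n m f z - ell_v n m g z)) \<le> K * Hk_norm k (\<lambda>z. f z - g z)"
      if f: "admissible k r \<delta> f" and g: "admissible k r \<delta> g" for f g
    proof -
      let ?N = "Hk_norm k (\<lambda>z. f z - g z)"
      let ?u = "ell_u n m f" and ?v = "ell_v n m f" and ?x = "ell_u n m g" and ?y = "ell_v n m g"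
      \<comment> \<open>Writing the difference of the rows with the coefficients of f leaves ?G1 and
        ?G2 as data of the first row and ?H as data of the second.\<close>
      let ?G1 = "\<lambda>z. ((1 + f z) powr (-n) - (1 + g z) powr (-n)) * ?y z"
      let ?G2 = "\<lambda>z. (1 + g z) powr (-n) - (1 + f z) powr (-n)"
      let ?H = "\<lambda>z. ((1 + f z) powr m - (1 + g z) powr m) * ?x z"
      have "primitive (\<lambda>z. ?u z - ?x z) (\<lambda>z. ((1 + f z) powr (- n) * ?v z + (1 - (1 + f z) powr (- n))) - ((1 + g z) powr (- n) * ?y z + (1 - (1 + g z) powr (- n))))"
        using sol[OF f] sol[OF g] by (intro primitive_diff) auto
      moreover have "(\<lambda>z. ((1 + f z) powr (- n) * ?v z + (1 - (1 + f z) powr (- n))) - ((1 + g z) powr (- n) * ?y z + (1 - (1 + g z) powr (- n))))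
          = (\<lambda>z. (1 + f z) powr (- n) * (?v z - ?y z) + (?G1 z + ?G2 z))"
        by (rule ext) algebra
      ultimately have p1: "primitive (\<lambda>z. ?u z - ?x z) (\<lambda>z. (1 + f z) powr (- n) * (?v z - ?y z) + (?G1 z + ?G2 z))" by (simp only:)
      have "primitive (\<lambda>z. ?v z - ?y z) (\<lambda>z. (1 + f z) powr m * ?u z - (1 + g z) powr m * ?x z)"
        using sol[OF f] sol[OF g] by (intro primitive_diff) auto
      moreover have "(\<lambda>z. (1 + f z) powr m * ?u z - (1 + g z) powr m * ?x z) = (\<lambda>z. (1 + f z) powr m * (?u z - ?x z) + ?H z)"
        by (rule ext) algebra
      ultimately have p2: "primitive (\<lambda>z. ?v z - ?y z) (\<lambda>z. (1 + f z) powr m * (?u z - ?x z) + ?H z)" by (simp only:)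
      note ms = admissible_powr_measurable[OF f d] admissible_powr_measurable[OF g d]
      have m1: "?G1 \<in> borel_measurable borel" and m2: "?H \<in> borel_measurable borel"
        using ms[of "-n"] ms[of m] L[OF g] by (auto simp: L2_def)
      have AN: "A * ?N \<ge> 0" "B * ?N \<ge> 0" using A(1) B(1) by auto
      have e1: "\<bar>?G1 z\<bar> \<le> A * ?N * \<bar>?y z\<bar>" and e2: "\<bar>?H z\<bar> \<le> B * ?N * \<bar>?x z\<bar>" for z
        using A(2)[OF f g] B(2)[OF f g] unfolding abs_mult by (intro mult_right_mono; simp)+
      note l1 = L2_le[OF L(2)[OF g] m1 e1 AN(1)] and l2 = L2_le[OF L(1)[OF g] m2 e2 AN(2)]
      have LG2: "L2 ?G2"
        using L2_diff[OF admissible_powr_L2[OF f k d, of "-n"] admissible_powr_L2[OF g k d, of "-n"]] by simp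
      have "norm (abs_l2 (\<lambda>z. ?G1 z + ?G2 z)) \<le> norm (abs_l2 ?G1) + norm (abs_l2 ?G2)"
        unfolding abs_l2_add[OF l1(1) LG2] by (rule norm_triangle_ineq)
      also have "\<dots> \<le> A * ?N * M + D * ?N"
        by (intro add_mono order_trans[OF l1(2)] mult_left_mono bu g AN D2 f)
      finally have g1: "norm (abs_l2 (\<lambda>z. ?G1 z + ?G2 z)) \<le> A * ?N * M + D * ?N" .
      have h1: "norm (abs_l2 ?H) \<le> B * ?N * M" by (intro order_trans[OF l2(2)] mult_left_mono bu g AN)
      have "c * norm (abs_l2 (\<lambda>z. ?u z - ?x z)) \<le> norm (abs_l2 (\<lambda>z. ?G1 z + ?G2 z)) + norm (abs_l2 ?H)"
        "c * norm (abs_l2 (\<lambda>z. ?v z - ?y z)) \<le> norm (abs_l2 (\<lambda>z. ?G1 z + ?G2 z)) + norm (abs_l2 ?H)"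
        by (rule system_energy_sum[OF p1 p2, where C = C];
            use b[OF f] c ms L[OF f] L[OF g] L2_add[OF l1(1) LG2] l2(1) in \<open>simp add: L2_diff\<close>)+
      then have *: "c * norm (abs_l2 (\<lambda>z. ?u z - ?x z)) \<le> (A * M + D + B * M) * ?N"
        "c * norm (abs_l2 (\<lambda>z. ?v z - ?y z)) \<le> (A * M + D + B * M) * ?N"
        using g1 h1 by (simp_all add: algebra_simps)
      have MN: "0 \<le> M * ?N" using M by simp
      have fin: "x \<le> K * ?N" if "c * x \<le> (A * M + D + B * M) * ?N" for x
      proof -
        have "x \<le> (A * M + D + B * M) * ?N / c" using that c by (simp add: field_simps)
        then show ?thesis using MN by (simp add: K_def distrib_right)
      qed
      show "norm (abs_l2 (\<lambda>z. ?u z - ?x z)) \<le> K * ?N" "norm (abs_l2 (\<lambda>z. ?v z - ?y z)) \<le> K * ?N"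
        by (intro fin *)+
    qed
    have "(A * M + D + B * M) / c \<ge> 0" using A(1) B(1) D(1) M c by simp
    then have KM: "M \<le> K" by (simp add: K_def)
    have "Lip_on k 0 r \<delta> (ell_u n m) K" "Lip_on k 0 r \<delta> (ell_v n m) K"
      using M KM L bu[THEN order_trans, OF _ KM] bd
      by (auto intro!: Lip_onI simp: Hk_0 Hk_norm_0 L2_diff)
    then show ?thesis by blast
  qed
  show "Lip k 0 (ell_u n m)" "Lip k 0 (ell_v n m)"
    using main by (auto intro!: LipI)
qed

text \<open>The right-hand sides of the system have no derivatives, so each derivative of \<open>(u, v)\<close> is
  controlled by the ones below it.\<close>

lemma flux_solution_Lip:
  assumes k: "k \<ge> 1"
  shows "j \<le> k \<Longrightarrow> Lip k j (ell_u n m) \<and> Lip k j (ell_v n m)"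
proof (induction j)
  case 0
  show ?case using flux_solution_Lip_0[OF k] by blast
next
  case (Suc j)
  then have IH: "Lip k j (ell_u n m)" "Lip k j (ell_v n m)" by auto
  have P: "Lip k k (\<lambda>f z. (1 + f z) powr p - 1)" for p by (rule Lip_powr[OF k order_refl])
  \<comment> \<open>The coefficient is written as (\<phi>^(-n) - 1) + 1, since only the bracket lies
    in a Sobolev space.\<close>
  have "Lip k j (\<lambda>f z. ((1 + f z) powr (- n) - 1) * ell_v n m f z + ell_v n m f z - ((1 + f z) powr (- n) - 1))"
    using Suc.prems k by (intro Lip_diff Lip_add Lip_mult[where i = k] P IH Lip_mono[OF P]) auto
  moreover have "(\<lambda>f z. ((1 + f z) powr (- n) - 1) * ell_v n m f z + ell_v n m f z - ((1 + f z) powr (- n) - 1))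
      = (\<lambda>f z. (1 + f z) powr (- n) * ell_v n m f z + (1 - (1 + f z) powr (- n)))"
    by (intro ext) algebra
  ultimately have 1: "Lip k j (\<lambda>f z. (1 + f z) powr (- n) * ell_v n m f z + (1 - (1 + f z) powr (- n)))" by (simp only:)
  have "Lip k j (\<lambda>f z. ((1 + f z) powr m - 1) * ell_u n m f z + ell_u n m f z)"
    using Suc.prems k by (intro Lip_diff Lip_add Lip_mult[where i = k] P IH) auto
  moreover have "(\<lambda>f z. ((1 + f z) powr m - 1) * ell_u n m f z + ell_u n m f z) = (\<lambda>f z. (1 + f z) powr m * ell_u n m f z)"
    by (intro ext) algebra
  ultimately have 2: "Lip k j (\<lambda>f z. (1 + f z) powr m * ell_u n m f z)" by (simp only:)
  show ?case
  proof (intro conjI Lip_Suc[OF flux_solution_Lip_0(1)[OF k] 1] Lip_Suc[OF flux_solution_Lip_0(2)[OF k] 2])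
    fix r \<delta> f assume d: "0 < \<delta>" and f: "admissible k r \<delta> f"
    note s = flux_solution[OF f k d, of n m, unfolded flux_system_def]
    show "weakly_diff (ell_u n m f) (\<lambda>z. (1 + f z) powr (- n) * ell_v n m f z + (1 - (1 + f z) powr (- n)))"
      using s Hk_L2[OF Lip_Hk[OF 1 d f]] by (intro primitive_weakly_diff) auto
    show "weakly_diff (ell_v n m f) (\<lambda>z. (1 + f z) powr m * ell_u n m f z)"
      using s Hk_L2[OF Lip_Hk[OF 2 d f]] by (intro primitive_weakly_diff) auto
  qed
qed

definition velocity :: "real \<Rightarrow> real \<Rightarrow> (real \<Rightarrow> real) \<Rightarrow> real \<Rightarrow> real" where
  "velocity n m f z = (1 + f z) powr m * ell_u n m f z"

lemma velocity_Lip: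
  assumes k: "k \<ge> 1" shows "Lip k k (velocity n m)"
proof -
  have "Lip k k (\<lambda>f z. ((1 + f z) powr m - 1) * ell_u n m f z + ell_u n m f z)"
    using k flux_solution_Lip[OF k order_refl] by (intro Lip_add Lip_mult[where i = k] Lip_powr) auto
  moreover have "(\<lambda>f z. ((1 + f z) powr m - 1) * ell_u n m f z + ell_u n m f z) = velocity n m"
    unfolding velocity_def[abs_def] by (intro ext) algebra
  ultimately show ?thesis by (simp only:)
qed

lemma velocity_continuous:
  assumes "admissible k r \<delta> f" "k \<ge> 1" "0 < \<delta>" shows "continuous_on UNIV (velocity n m f)"
  unfolding velocity_def[abs_def] using flux_solution[OF assms, of n m]
  by (intro continuous_intros admissible_powr_continuous[OF assms(1,3)]) (auto simp: flux_system_def intro: primitive_continuous)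

section \<open>Ordinary differential equations with a constraint\<close>

text \<open>The bound on \<tau> M keeps the integral operator inside the closed ball, and that on
  \<tau> L makes it a contraction in the sup metric.\<close>

lemma picard_iteration:
  fixes F :: "'a::banach \<Rightarrow> 'a"
  assumes \<eta>: "\<eta> \<ge> 0" and L: "L \<ge> 0" "\<And>x y. x \<in> cball e0 \<eta> \<Longrightarrow> y \<in> cball e0 \<eta> \<Longrightarrow> norm (F x - F y) \<le> L * norm (x - y)"
    and M: "\<And>x. x \<in> cball e0 \<eta> \<Longrightarrow> norm (F x) \<le> M" and \<tau>: "\<tau> \<ge> 0" "\<tau> * M \<le> \<eta>" "\<tau> * L < 1"
  shows "\<exists>x. x 0 = e0 \<and> (\<forall>t\<in>{0..\<tau>}. x t \<in> cball e0 \<eta> \<and> (x has_vector_derivative F (x t)) (at t within {0..\<tau>}))"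
proof -
  let ?B = "cball e0 \<eta>"
  have M0: "M \<ge> 0" using M[of e0] \<eta> norm_ge_zero[of "F e0"] by (simp del: norm_ge_zero)
  have cF: "continuous_on ?B F"
  proof -
    have "L-lipschitz_on ?B F" using L by (intro lipschitz_onI) (auto simp: dist_norm)
    then show ?thesis by (rule lipschitz_on_continuous_on)
  qed
  \<comment> \<open>Clamping time to [0, \<tau>] makes the iterates bounded continuous functions on
    the whole line, so the complete space of such functions can be used.\<close>
  define c where "c t = max 0 (min \<tau> t)" for t
  have c: "0 \<le> c t" "c t \<le> \<tau>" for t using \<tau>(1) by (auto simp: c_def)
  have cc: "continuous_on UNIV c" unfolding c_def[abs_def] by (intro continuous_intros)
  define S where "S = PiC (UNIV :: real set) (\<lambda>_. ?B)"
  have S: "g \<in> S \<longleftrightarrow> (\<forall>t. g t \<in> ?B)" for g :: "real \<Rightarrow>\<^sub>C 'a" by (auto simp: S_def mem_PiC_iff)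
  define G where "G g t = e0 + integral {0..c t} (\<lambda>s. F (apply_bcontfun g s))" for g t
  have cont: "continuous_on A (\<lambda>s. F (apply_bcontfun g s))" if "g \<in> S" for g A
    using that by (intro continuous_on_compose2[OF cF]) (auto simp: S)
  have int: "(\<lambda>s. F (apply_bcontfun g s)) integrable_on {a..b}" if "g \<in> S" for g a b
    by (intro integrable_continuous_real cont that)
  have GB: "G g t \<in> ?B" if "g \<in> S" for g t
  proof -
    have "norm (integral {0..c t} (\<lambda>s. F (apply_bcontfun g s))) \<le> M * (c t - 0)"
      using that c by (intro integral_bound cont M) (auto simp: S)
    also have "\<dots> \<le> M * \<tau>" using M0 c by (intro mult_left_mono) auto
    also have "\<dots> \<le> \<eta>" using \<tau>(2) by (simp add: mult.commute)
    finally show ?thesis by (simp add: G_def dist_norm)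
  qed
  have Gc: "continuous_on UNIV (G g)" if "g \<in> S" for g
  proof -
    have "continuous_on {0..\<tau>} (\<lambda>t. integral {0..t} (\<lambda>s. F (apply_bcontfun g s)))"
      by (intro indefinite_integral_continuous_1 int that)
    then have "continuous_on UNIV (\<lambda>t. integral {0..c t} (\<lambda>s. F (apply_bcontfun g s)))"
      by (rule continuous_on_compose2[OF _ cc]) (use c in auto)
    then show ?thesis unfolding G_def[abs_def] by (intro continuous_intros)
  qed
  have Gb: "G g \<in> bcontfun" if "g \<in> S" for g
  proof (rule bcontfun_normI[OF Gc[OF that], of "norm e0 + \<eta>"])
    fix t
    have "norm (G g t) \<le> norm e0 + norm (G g t - e0)" by (rule norm_triangle_sub)
    then show "norm (G g t) \<le> norm e0 + \<eta>"
      using GB[OF that, of t] by (simp add: dist_norm norm_minus_commute)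
  qed
  define T where "T g = Bcontfun (G g)" for g
  have T: "apply_bcontfun (T g) = G g" if "g \<in> S" for g
    unfolding T_def by (rule Bcontfun_inverse[OF Gb[OF that]])
  have "\<exists>!g\<in>S. T g = g"
  proof (rule Banach_fix)
    show "complete S" unfolding S_def complete_eq_closed by (intro closed_PiC closed_cball)
    have "const_bcontfun e0 \<in> S" using \<eta> by (simp add: S)
    then show "S \<noteq> {}" by blast
    show "0 \<le> \<tau> * L" "\<tau> * L < 1" using \<tau> L by auto
    show "T ` S \<subseteq> S" using GB T by (auto simp: S)
    fix g h assume gh: "g \<in> S" "h \<in> S"
    show "dist (T g) (T h) \<le> \<tau> * L * dist g h"
    proof (rule dist_bound)
      fix t
      have "G g t - G h t = integral {0..c t} (\<lambda>s. F (apply_bcontfun g s) - F (apply_bcontfun h s))"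
        by (simp add: G_def Henstock_Kurzweil_Integration.integral_diff int gh)
      also have "norm \<dots> \<le> (L * dist g h) * (c t - 0)"
      proof (rule integral_bound)
        fix s
        have "norm (F (apply_bcontfun g s) - F (apply_bcontfun h s)) \<le> L * norm (apply_bcontfun g s - apply_bcontfun h s)"
          using gh by (intro L) (simp_all add: S)
        also have "\<dots> \<le> L * dist g h"
          using L(1) dist_bounded[of g s h] by (intro mult_left_mono) (simp_all add: dist_norm)
        finally show "norm (F (apply_bcontfun g s) - F (apply_bcontfun h s)) \<le> L * dist g h" .
      qed (use c gh cont in \<open>auto intro!: continuous_on_diff\<close>)
      also have "\<dots> \<le> (L * dist g h) * \<tau>" using c L(1) by (intro mult_left_mono) auto
      finally show "dist (apply_bcontfun (T g) t) (apply_bcontfun (T h) t) \<le> \<tau> * L * dist g h"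
        by (simp add: T gh dist_norm algebra_simps)
    qed
  qed
  then obtain g where g: "g \<in> S" "T g = g" by blast
  have fix_eq: "apply_bcontfun g t = e0 + integral {0..t} (\<lambda>s. F (apply_bcontfun g s))" if "t \<in> {0..\<tau>}" for t
  proof -
    have "c t = t" using that by (simp add: c_def)
    then show ?thesis using fun_cong[OF T[OF g(1)], of t] unfolding g(2) G_def by (simp only:)
  qed
  have "(apply_bcontfun g has_vector_derivative F (apply_bcontfun g t)) (at t within {0..\<tau>})" if t: "t \<in> {0..\<tau>}" for t
  proof -
    have "((\<lambda>t. e0 + integral {0..t} (\<lambda>s. F (apply_bcontfun g s))) has_vector_derivative (0 + F (apply_bcontfun g t))) (at t within {0..\<tau>})"
      by (intro has_vector_derivative_add has_vector_derivative_const integral_has_vector_derivative cont g t)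
    from this[unfolded add_0] show ?thesis
      by (rule has_vector_derivative_transform[OF t, rotated]) (rule fix_eq)
  qed
  moreover have "apply_bcontfun g 0 = e0" using fix_eq[of 0] \<tau>(1) by simp
  ultimately show ?thesis using g(1) by (intro exI[of _ "apply_bcontfun g"]) (simp add: S)
qed

lemma time_interval_ereal: "time_interval (ereal T) = {0..<T}"
  by (auto simp: time_interval_def)

lemma time_interval_mono: "S \<le> T \<Longrightarrow> time_interval S \<subseteq> time_interval T"
  by (auto simp: time_interval_def intro: less_le_trans)

lemma time_interval_pos: "t \<in> time_interval T \<Longrightarrow> 0 < T"
  by (auto simp: time_interval_def intro: le_less_trans[of 0 "ereal t" T])

lemma time_interval_Icc_subset: "t \<in> time_interval T \<Longrightarrow> {0..t} \<subseteq> time_interval T"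
  by (auto simp: time_interval_def intro: le_less_trans[of "ereal _" "ereal t"])

text \<open>An autonomous equation on the open set where d > 0. The function d measures the distance
  from the boundary of this set: F is bounded and Lipschitz wherever the norm is bounded and d is
  bounded away from 0.\<close>

locale ode =
  fixes F :: "'a::{real_inner, banach} \<Rightarrow> 'a" and d :: "'a \<Rightarrow> real" and Cd :: real
  assumes d_lipschitz: "\<bar>d x - d y\<bar> \<le> Cd * norm (x - y)" and Cd: "Cd > 0"
    and F_lipschitz: "0 < \<delta> \<Longrightarrow> \<exists>L\<ge>0. \<forall>x y. norm x \<le> r \<longrightarrow> norm y \<le> r \<longrightarrow> \<delta> \<le> d x \<longrightarrow> \<delta> \<le> d y \<longrightarrow> norm (F x - F y) \<le> L * norm (x - y)"
    and F_bounded: "0 < \<delta> \<Longrightarrow> \<exists>M\<ge>0. \<forall>x. norm x \<le> r \<longrightarrow> \<delta> \<le> d x \<longrightarrow> norm (F x) \<le> M"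
begin

text \<open>For T \<le> 0 the time interval is empty and the condition is vacuous, exactly as in
  \<open>local_solution\<close>; so the two notions correspond for every extended real T.\<close>

definition sol :: "'a \<Rightarrow> ereal \<Rightarrow> (real \<Rightarrow> 'a) \<Rightarrow> bool" where
  "sol e0 T x \<longleftrightarrow> (0 < T \<longrightarrow> x 0 = e0) \<and>
     (\<forall>t\<in>time_interval T. 0 < d (x t) \<and> (x has_vector_derivative F (x t)) (at t within time_interval T))"

lemma d_continuous: "continuous_on A d"
proof -
  have "Cd-lipschitz_on A d" using d_lipschitz Cd by (intro lipschitz_onI) (auto simp: dist_norm)
  then show ?thesis by (rule lipschitz_on_continuous_on)
qed

text \<open>The Picard time is determined by the constants L and M of the region, so the same \<tau>
  serves every initial point whose \<eta>-ball lies in it.\<close>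

lemma uniform_local_solution:
  assumes "0 < \<delta>" "0 < \<eta>"
  shows "\<exists>\<tau>>0. \<forall>e0. (\<forall>e\<in>cball e0 \<eta>. norm e \<le> r \<and> \<delta> \<le> d e) \<longrightarrow>
    (\<exists>x. x 0 = e0 \<and> (\<forall>t\<in>{0..\<tau>}. x t \<in> cball e0 \<eta> \<and> (x has_vector_derivative F (x t)) (at t within {0..\<tau>})))"
proof -
  obtain L where L: "L \<ge> 0" "\<And>x y. norm x \<le> r \<Longrightarrow> norm y \<le> r \<Longrightarrow> \<delta> \<le> d x \<Longrightarrow> \<delta> \<le> d y \<Longrightarrow> norm (F x - F y) \<le> L * norm (x - y)"
    using F_lipschitz[OF assms(1), of r] by blast
  obtain M where M: "M \<ge> 0" "\<And>x. norm x \<le> r \<Longrightarrow> \<delta> \<le> d x \<Longrightarrow> norm (F x) \<le> M"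
    using F_bounded[OF assms(1), of r] by blast
  \<comment> \<open>The first entry gives \<tau> M \<le> \<eta>, the second \<tau> L < 1; the added
    1 avoids division by 0 and makes the latter strict.\<close>
  define \<tau> where "\<tau> = min (\<eta> / (M + 1)) (1 / (L + 1))"
  have \<tau>: "\<tau> > 0" using assms M L by (simp add: \<tau>_def)
  have "\<tau> * M \<le> (\<eta> / (M + 1)) * M" using M by (intro mult_right_mono) (auto simp: \<tau>_def)
  also have "\<dots> \<le> \<eta>" using M assms by (simp add: field_simps)
  finally have \<tau>M: "\<tau> * M \<le> \<eta>" .
  have "\<tau> * L \<le> (1 / (L + 1)) * L" using L by (intro mult_right_mono) (auto simp: \<tau>_def)
  also have "\<dots> < 1" using L by (simp add: field_simps)
  finally have \<tau>L: "\<tau> * L < 1" .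
  have "\<exists>x. x 0 = e0 \<and> (\<forall>t\<in>{0..\<tau>}. x t \<in> cball e0 \<eta> \<and> (x has_vector_derivative F (x t)) (at t within {0..\<tau>}))"
    if "\<forall>e\<in>cball e0 \<eta>. norm e \<le> r \<and> \<delta> \<le> d e" for e0
    by (rule picard_iteration[where L = L and M = M]) (use that L M \<tau> \<tau>M \<tau>L assms in auto)
  then show ?thesis using \<tau> by blast
qed

lemma sol_restrict:
  assumes "sol e0 T x" "S \<le> T" shows "sol e0 S x"
  using assms time_interval_mono[OF assms(2)] unfolding sol_def
  by (auto intro: has_vector_derivative_within_subset less_le_trans)

lemma sol_continuous: "sol e0 T x \<Longrightarrow> continuous_on (time_interval T) x"
  unfolding sol_def by (auto simp: continuous_on_eq_continuous_within intro: has_vector_derivative_continuous)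

text \<open>Gronwall's inequality for the squared distance of two solutions.\<close>

lemma sol_unique:
  assumes x: "sol e0 T x" and y: "sol e0 T y" and t: "t \<in> time_interval T"
  shows "x t = y t"
proof (cases "t = 0")
  case True
  then show ?thesis using x y time_interval_pos[OF t] by (simp add: sol_def)
next
  case False
  then have t0: "t > 0" using t by (auto simp: time_interval_def)
  have sub: "{0..t} \<subseteq> time_interval T" by (rule time_interval_Icc_subset[OF t])
  have c: "continuous_on {0..t} x" "continuous_on {0..t} y"
    using sol_continuous[OF x] sol_continuous[OF y] continuous_on_subset sub by blast+
  have ne: "{0..t} \<noteq> {}" using t0 by auto
  obtain a where a: "a \<in> {0..t}" "\<And>s. s \<in> {0..t} \<Longrightarrow> d (x a) \<le> d (x s)"
    using continuous_attains_inf[OF compact_Icc ne continuous_on_compose2[OF d_continuous c(1) subset_UNIV]] by blast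
  obtain b where b: "b \<in> {0..t}" "\<And>s. s \<in> {0..t} \<Longrightarrow> d (y b) \<le> d (y s)"
    using continuous_attains_inf[OF compact_Icc ne continuous_on_compose2[OF d_continuous c(2) subset_UNIV]] by blast
  define \<delta> where "\<delta> = min (d (x a)) (d (y b))"
  have \<delta>: "\<delta> > 0" using x y a(1) b(1) sub by (auto simp: \<delta>_def sol_def)
  have "bounded (x ` {0..t} \<union> y ` {0..t})"
    using c by (auto intro!: compact_imp_bounded compact_continuous_image)
  then obtain r where r: "\<And>z. z \<in> x ` {0..t} \<union> y ` {0..t} \<Longrightarrow> norm z \<le> r" unfolding bounded_iff by blast
  obtain L where L: "L \<ge> 0" "\<And>p q. norm p \<le> r \<Longrightarrow> norm q \<le> r \<Longrightarrow> \<delta> \<le> d p \<Longrightarrow> \<delta> \<le> d q \<Longrightarrow> norm (F p - F q) \<le> L * norm (p - q)"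
    using F_lipschitz[OF \<delta>, of r] by blast
  have Lxy: "norm (F (x s) - F (y s)) \<le> L * norm (x s - y s)" if "s \<in> {0..t}" for s
    using that r a(2) b(2) by (intro L(2)) (auto simp: \<delta>_def min_le_iff_disj)
  \<comment> \<open>The squared distance grows at most at rate 2 L, so the exponential weight makes
    w decreasing.\<close>
  define w where "w s = inner (x s - y s) (x s - y s) * exp (- (2 * L) * s)" for s
  have "w t \<le> w 0"
  proof (rule DERIV_nonpos_imp_decreasing_open[of 0 t w])
    show "0 \<le> t" using t0 by simp
    show "continuous_on {0..t} w" unfolding w_def[abs_def] by (intro continuous_intros c)
    fix s assume s: "0 < s" "s < t"
    then have sT: "s \<in> time_interval T" and sI: "s \<in> {0..t}" using sub by auto
    have o: "at s within {0<..<t} = at s" using s by (intro at_within_open) auto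
    have sub': "{0<..<t} \<subseteq> time_interval T" using sub by auto
    have "(x has_vector_derivative F (x s)) (at s within time_interval T)"
      "(y has_vector_derivative F (y s)) (at s within time_interval T)"
      using x y sT by (auto simp: sol_def)
    from this[THEN has_vector_derivative_within_subset[OF _ sub']]
    have dx: "(x has_vector_derivative F (x s)) (at s)" "(y has_vector_derivative F (y s)) (at s)"
      unfolding o .
    let ?z = "x s - y s" and ?D = "F (x s) - F (y s)"
    have "((\<lambda>s. x s - y s) has_vector_derivative ?D) (at s)" by (intro has_vector_derivative_diff dx)
    from bounded_bilinear.has_vector_derivative[OF bounded_bilinear_inner this this]
    have "((\<lambda>s. inner (x s - y s) (x s - y s)) has_real_derivative (inner ?z ?D + inner ?D ?z)) (at s)"
      by (simp add: has_real_derivative_iff_has_vector_derivative)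
    then have "(w has_real_derivative ((inner ?z ?D + inner ?D ?z) * exp (- (2 * L) * s) + inner ?z ?z * (exp (- (2 * L) * s) * (- (2 * L))))) (at s)"
      unfolding w_def[abs_def] by (auto intro!: derivative_eq_intros)
    moreover have "(inner ?z ?D + inner ?D ?z) * exp (- (2 * L) * s) + inner ?z ?z * (exp (- (2 * L) * s) * (- (2 * L))) \<le> 0"
    proof -
      have "inner ?z ?D \<le> norm ?z * norm ?D" by (rule norm_cauchy_schwarz)
      also have "\<dots> \<le> norm ?z * (L * norm ?z)" by (intro mult_left_mono Lxy sI) auto
      also have "\<dots> = L * inner ?z ?z" by (simp add: power2_norm_eq_inner[symmetric] power2_eq_square)
      finally have "2 * inner ?z ?D - 2 * L * inner ?z ?z \<le> 0" by simp
      then have "(2 * inner ?z ?D - 2 * L * inner ?z ?z) * exp (- (2 * L) * s) \<le> 0"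
        by (rule mult_nonpos_nonneg) simp
      then show ?thesis by (simp add: inner_commute algebra_simps)
    qed
    ultimately show "\<exists>y. DERIV w s :> y \<and> y \<le> 0" by blast
  qed
  also have "w 0 = 0" using x y time_interval_pos[OF t] by (simp add: w_def sol_def)
  finally have "inner (x t - y t) (x t - y t) \<le> 0" by (simp add: w_def mult_le_0_iff)
  then have "inner (x t - y t) (x t - y t) = 0" by (intro antisym inner_ge_zero)
  then show ?thesis by simp
qed

definition life :: "'a \<Rightarrow> ereal" where
  "life e0 = Sup {T. \<exists>x. sol e0 T x}"

text \<open>At each t the value of any solution that lives beyond t; by uniqueness all of them agree
  there.\<close>

definition max_sol :: "'a \<Rightarrow> real \<Rightarrow> 'a" where
  "max_sol e0 t = (SOME x. \<exists>T. ereal t < T \<and> sol e0 T x) t"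

lemma life_upper: "sol e0 T x \<Longrightarrow> T \<le> life e0"
  unfolding life_def by (intro Sup_upper) auto

lemma max_sol_eq:
  assumes x: "sol e0 T x" and t: "t \<in> time_interval T" shows "max_sol e0 t = x t"
proof -
  have tT: "ereal t < T" "0 \<le> t" using t by (auto simp: time_interval_def)
  define y where "y = (SOME x. \<exists>T. ereal t < T \<and> sol e0 T x)"
  have "\<exists>S. ereal t < S \<and> sol e0 S y"
    unfolding y_def by (rule someI[where x = x]) (use x tT in blast)
  then obtain S where S: "ereal t < S" "sol e0 S y" by blast
  have "x t = y t"
    by (rule sol_unique[OF sol_restrict[OF x] sol_restrict[OF S(2)], of "min S T"])
       (use tT S in \<open>auto simp: time_interval_def\<close>)
  then show ?thesis by (simp add: max_sol_def y_def)
qed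

lemma sol_cong:
  assumes "sol e0 T x" "\<And>t. t \<in> time_interval T \<Longrightarrow> y t = x t" shows "sol e0 T y"
  unfolding sol_def
proof (intro conjI impI ballI)
  assume "0 < T"
  then have "0 \<in> time_interval T" by (simp add: time_interval_def zero_ereal_def[symmetric])
  then show "y 0 = e0" using assms \<open>0 < T\<close> by (simp add: sol_def)
next
  fix t assume t: "t \<in> time_interval T"
  then show "0 < d (y t)" using assms by (simp add: sol_def)
  have "(x has_vector_derivative F (y t)) (at t within time_interval T)" using assms t by (simp add: sol_def)
  then show "(y has_vector_derivative F (y t)) (at t within time_interval T)"
    by (rule has_vector_derivative_transform[OF t, rotated]) (rule assms(2))
qed

lemma max_sol: "sol e0 (life e0) (max_sol e0)"
  unfolding sol_def
proof (intro conjI impI ballI)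
  have ex: "\<exists>T x. ereal t < T \<and> sol e0 T x" if "ereal t < life e0" for t
    using that unfolding life_def less_Sup_iff by blast
  {
    assume "0 < life e0"
    then obtain T x where T: "ereal 0 < T" "sol e0 T x" using ex[of 0] by (auto simp: zero_ereal_def)
    then have "max_sol e0 0 = x 0" by (intro max_sol_eq[OF T(2)]) (auto simp: time_interval_def)
    then show "max_sol e0 0 = e0" using T by (simp add: sol_def zero_ereal_def)
  next
    fix t assume t: "t \<in> time_interval (life e0)"
    then obtain T x where T: "ereal t < T" "sol e0 T x" using ex[of t] by (auto simp: time_interval_def)
    have s: "sol e0 T (max_sol e0)" by (rule sol_cong[OF T(2) max_sol_eq[OF T(2)]])
    have tT: "t \<in> time_interval T" using t T by (auto simp: time_interval_def)
    then show "0 < d (max_sol e0 t)" using s by (simp add: sol_def)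
    have D: "(max_sol e0 has_vector_derivative F (max_sol e0 t)) (at t within time_interval T)" using s tT by (simp add: sol_def)
    obtain t' where t': "t < t'" "ereal t' < T" using ereal_dense2[OF T(1)] by auto
    \<comment> \<open>Below t' the two intervals coincide, so t has the same one-sided or two-sided
      neighbourhoods in both.\<close>
    have "at t within time_interval (life e0) = at t within time_interval T"
      by (rule at_within_nhd[of t "{..<t'}"])
         (use t' life_upper[OF T(2)] in \<open>auto simp: time_interval_def intro: less_le_trans less_trans[of "ereal _" "ereal t'"]\<close>)
    then show "(max_sol e0 has_vector_derivative F (max_sol e0 t)) (at t within time_interval (life e0))"
      using D by simp
  }
qed

text \<open>The closures of the two pieces meet in the single time t. There the values agree by y 0
  = x t, and hence also the derivatives, as the equation is autonomous.\<close>

lemma sol_extend: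
  assumes x: "sol e0 T x" and t: "t \<in> time_interval T" and \<tau>: "\<tau> > 0"
    and y: "y 0 = x t" "\<And>s. s \<in> {0..\<tau>} \<Longrightarrow> 0 < d (y s) \<and> (y has_vector_derivative F (y s)) (at s within {0..\<tau>})"
  shows "sol e0 (ereal (t + \<tau>)) (\<lambda>s. if s \<in> {0..t} then x s else y (s - t))"
  unfolding sol_def
proof (intro conjI impI ballI)
  have t0: "0 \<le> t" "ereal t < T" using t by (auto simp: time_interval_def)
  have sub: "{0..t} \<subseteq> time_interval T" by (rule time_interval_Icc_subset[OF t])
  have "0 < T" by (rule time_interval_pos[OF t])
  then show "(if (0::real) \<in> {0..t} then x 0 else y (0 - t)) = e0" using x t0 by (simp add: sol_def)
  fix s assume "s \<in> time_interval (ereal (t + \<tau>))"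
  then have s: "s \<in> {0..<t + \<tau>}" by (simp add: time_interval_ereal)
  show "0 < d (if s \<in> {0..t} then x s else y (s - t))" using x y(2) sub s by (auto simp: sol_def)
  have cl: "closure {t..<t + \<tau>} = {t..t + \<tau>}" using \<tau> by simp
  have un: "{0..<t + \<tau>} = {0..t} \<union> {t..<t + \<tau>}" using t0 \<tau> by auto
  have i1: "{0..t} \<union> (closure {0..t} \<inter> closure {t..<t + \<tau>}) = {0..t}" using t0 \<tau> by (auto simp: cl)
  have i2: "{t..<t + \<tau>} \<union> (closure {0..t} \<inter> closure {t..<t + \<tau>}) = {t..<t + \<tau>}" using t0 \<tau> by (auto simp: cl)
  have "((\<lambda>s. if s \<in> {0..t} then x s else y (s - t)) has_vector_derivative
     (if s \<in> {0..t} then F (x s) else F (y (s - t)))) (at s within {0..<t + \<tau>})"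
  proof (rule has_vector_derivative_If_within_closures[where T = "{t..<t + \<tau>}"])
    show "s \<in> {0..t} \<union> {t..<t + \<tau>}" "{0..<t + \<tau>} = {0..t} \<union> {t..<t + \<tau>}" using s un by auto
    show "(x has_vector_derivative F (x s)) (at s within {0..t} \<union> (closure {0..t} \<inter> closure {t..<t + \<tau>}))"
      if "s \<in> {0..t} \<union> (closure {0..t} \<inter> closure {t..<t + \<tau>})"
    proof -
      have "s \<in> time_interval T" using that sub unfolding i1 by blast
      then have "(x has_vector_derivative F (x s)) (at s within time_interval T)" using x by (simp add: sol_def)
      from has_vector_derivative_within_subset[OF this sub] show ?thesis unfolding i1 .
    qed
    show "((\<lambda>s. y (s - t)) has_vector_derivative F (y (s - t))) (at s within {t..<t + \<tau>} \<union> (closure {0..t} \<inter> closure {t..<t + \<tau>}))"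
      if "s \<in> {t..<t + \<tau>} \<union> (closure {0..t} \<inter> closure {t..<t + \<tau>})"
    proof -
      have st: "s \<in> {t..<t + \<tau>}" using that unfolding i2 .
      have 1: "((\<lambda>s. s - t) has_vector_derivative 1) (at s within {t..<t + \<tau>})"
        by (auto intro!: derivative_eq_intros)
      have "(y has_vector_derivative F (y (s - t))) (at (s - t) within {0..\<tau>})" using y(2) st by auto
      then have 2: "(y has_vector_derivative F (y (s - t))) (at (s - t) within (\<lambda>s. s - t) ` {t..<t + \<tau>})"
        by (rule has_vector_derivative_within_subset) auto
      from vector_diff_chain_within[OF 1 2] show ?thesis unfolding i2 by (simp add: o_def)
    qed
    assume "s \<in> closure {0..t}" "s \<in> closure {t..<t + \<tau>}"
    then have "s = t" unfolding cl by auto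
    then show "x s = y (s - t)" "F (x s) = F (y (s - t))" using y(1) by auto
  qed
  then show "((\<lambda>s. if s \<in> {0..t} then x s else y (s - t)) has_vector_derivative
     F (if s \<in> {0..t} then x s else y (s - t))) (at s within time_interval (ereal (t + \<tau>)))"
    unfolding time_interval_ereal by (simp add: if_distrib[of F])
qed

section \<open>Lower bounds for the lifespan, and blow-up\<close>

lemma F_continuous:
  assumes "0 < d e" shows "isCont F e"
proof -
  have "0 < d e / 2" using assms by simp
  from F_lipschitz[OF this, of "norm e + 1"] obtain L where L: "L \<ge> 0"
    "\<And>x y. norm x \<le> norm e + 1 \<Longrightarrow> norm y \<le> norm e + 1 \<Longrightarrow> d e / 2 \<le> d x \<Longrightarrow> d e / 2 \<le> d y \<Longrightarrow> norm (F x - F y) \<le> L * norm (x - y)"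
    by blast
  have "(d \<longlongrightarrow> d e) (at e)" using d_continuous[of UNIV] by (simp add: continuous_on_def)
  then have 1: "\<forall>\<^sub>F y in at e. d e / 2 < d y" using assms by (intro order_tendstoD) auto
  have "((\<lambda>y. norm y) \<longlongrightarrow> norm e) (at e)" by (intro tendsto_intros)
  then have 2: "\<forall>\<^sub>F y in at e. norm y < norm e + 1" by (intro order_tendstoD) auto
  have 3: "\<forall>\<^sub>F y in at e. norm (F y - F e) \<le> L * norm (y - e)"
    using 1 2 by eventually_elim (use assms in \<open>intro L(2); simp\<close>)
  have "((\<lambda>y. L * norm (y - e)) \<longlongrightarrow> L * norm (e - e)) (at e)" by (intro tendsto_intros)
  then have "((\<lambda>y. F y - F e) \<longlongrightarrow> 0) (at e)" by (intro Lim_null_comparison[OF 3]) simp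
  then show ?thesis by (simp add: isCont_def LIM_zero_iff)
qed

lemma ball_in_region:
  assumes "norm e0 \<le> r" "\<delta> \<le> d e0" "\<eta> \<le> 1" "Cd * \<eta> \<le> \<delta> / 2" "e \<in> cball e0 \<eta>"
  shows "norm e \<le> r + 1" "\<delta> / 2 \<le> d e"
proof -
  have n: "norm (e - e0) \<le> \<eta>" using assms(5) by (simp add: dist_norm norm_minus_commute)
  show "norm e \<le> r + 1" using norm_triangle_sub[of e e0] n assms by linarith
  have "\<bar>d e - d e0\<bar> \<le> Cd * \<eta>" using d_lipschitz[of e e0] n Cd by (meson less_imp_le mult_left_mono order_trans)
  then show "\<delta> / 2 \<le> d e" using assms by linarith
qed

lemma uniform_time:
  assumes "0 < \<delta>"
  shows "\<exists>\<tau>>0. \<forall>e0. norm e0 \<le> r \<longrightarrow> \<delta> \<le> d e0 \<longrightarrow>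
    (\<exists>x. x 0 = e0 \<and> (\<forall>t\<in>{0..\<tau>}. 0 < d (x t) \<and> (x has_vector_derivative F (x t)) (at t within {0..\<tau>})))"
proof -
  \<comment> \<open>Within distance \<eta> the norm grows by at most 1 and d drops by at most
    \<delta> / 2, so the ball lies in a slightly larger region of the same kind.\<close>
  define \<eta> where "\<eta> = min 1 (\<delta> / (2 * Cd))"
  have \<eta>: "0 < \<eta>" "\<eta> \<le> 1" using assms Cd by (auto simp: \<eta>_def)
  have "Cd * \<eta> \<le> Cd * (\<delta> / (2 * Cd))" using Cd by (intro mult_left_mono) (auto simp: \<eta>_def)
  then have \<eta>2: "Cd * \<eta> \<le> \<delta> / 2" using Cd by simp
  obtain \<tau> where \<tau>: "\<tau> > 0" "\<And>e0. (\<forall>e\<in>cball e0 \<eta>. norm e \<le> r + 1 \<and> \<delta> / 2 \<le> d e) \<Longrightarrow>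
    (\<exists>x. x 0 = e0 \<and> (\<forall>t\<in>{0..\<tau>}. x t \<in> cball e0 \<eta> \<and> (x has_vector_derivative F (x t)) (at t within {0..\<tau>})))"
    using uniform_local_solution[of "\<delta> / 2" \<eta> "r + 1"] assms \<eta> by (auto simp del: mem_cball)
  have "\<exists>x. x 0 = e0 \<and> (\<forall>t\<in>{0..\<tau>}. 0 < d (x t) \<and> (x has_vector_derivative F (x t)) (at t within {0..\<tau>}))"
    if e0: "norm e0 \<le> r" "\<delta> \<le> d e0" for e0
  proof -
    note br = ball_in_region[OF e0 \<eta>(2) \<eta>2]
    obtain x where x: "x 0 = e0" "\<And>t. t \<in> {0..\<tau>} \<Longrightarrow> x t \<in> cball e0 \<eta> \<and> (x has_vector_derivative F (x t)) (at t within {0..\<tau>})"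
      using \<tau>(2)[of e0] br by blast
    have "0 < d (x t)" if "t \<in> {0..\<tau>}" for t
      using br(2)[of "x t"] x(2)[OF that] assms by (auto simp del: mem_cball)
    then show ?thesis using x by (intro exI[of _ x]) blast
  qed
  then show ?thesis using \<tau>(1) by blast
qed

lemma life_pos: "0 < d e0 \<Longrightarrow> 0 < life e0"
proof -
  assume d0: "0 < d e0"
  obtain \<tau> x where \<tau>: "\<tau> > 0" "x 0 = e0" "\<And>t. t \<in> {0..\<tau>} \<Longrightarrow> 0 < d (x t) \<and> (x has_vector_derivative F (x t)) (at t within {0..\<tau>})"
    using uniform_time[OF d0, of "norm e0"] by blast
  have "sol e0 (ereal \<tau>) x"
    unfolding sol_def time_interval_ereal using \<tau> by (auto intro: has_vector_derivative_within_subset[of _ _ _ "{0..\<tau>}"])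
  from life_upper[OF this] show ?thesis using \<tau>(1) by (metis ereal_less(2) less_le_trans)
qed

text \<open>A point of the region at a time t within \<tau> of T could be continued for the uniform
  time \<tau>, that is, beyond the lifespan. This excludes every t in the last stretch of length
  \<tau>.\<close>

lemma blow_up:
  assumes T: "life e0 = ereal T" "0 < T" and \<delta>: "0 < \<delta>"
  shows "\<exists>s<T. \<forall>t. s < t \<longrightarrow> t < T \<longrightarrow> \<not> (norm (max_sol e0 t) \<le> r \<and> \<delta> \<le> d (max_sol e0 t))"
proof -
  obtain \<tau> where \<tau>: "\<tau> > 0" "\<And>e. norm e \<le> r \<Longrightarrow> \<delta> \<le> d e \<Longrightarrow>
    (\<exists>x. x 0 = e \<and> (\<forall>t\<in>{0..\<tau>}. 0 < d (x t) \<and> (x has_vector_derivative F (x t)) (at t within {0..\<tau>})))"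
    using uniform_time[OF \<delta>, of r] by blast
  have "\<not> (norm (max_sol e0 t) \<le> r \<and> \<delta> \<le> d (max_sol e0 t))" if t: "max 0 (T - \<tau>) < t" "t < T" for t
  proof
    assume "norm (max_sol e0 t) \<le> r \<and> \<delta> \<le> d (max_sol e0 t)"
    then obtain y where y: "y 0 = max_sol e0 t" "\<And>s. s \<in> {0..\<tau>} \<Longrightarrow> 0 < d (y s) \<and> (y has_vector_derivative F (y s)) (at s within {0..\<tau>})"
      using \<tau>(2) by blast
    have "t \<in> time_interval (life e0)" using t by (simp add: T time_interval_ereal)
    from life_upper[OF sol_extend[OF max_sol this \<tau>(1) y]] show False using t by (simp add: T)
  qed
  then show ?thesis using T(2) \<tau>(1) by (intro exI[of _ "max 0 (T - \<tau>)"]) auto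
qed

end

section \<open>The evolution equation as an ordinary differential equation\<close>

lemma integrable_bounded_test_mult:
  "continuous_on UNIV a \<Longrightarrow> locally_integrable f \<Longrightarrow> test_function \<psi> \<Longrightarrow> integrable lborel (\<lambda>z. a z * f z * \<psi> z)"
  by (intro integrable_test_mult locally_integrable_mult_continuous)

lemma integral_deriv_test_function:
  assumes "test_function \<psi>" shows "(LINT z|lborel. deriv \<psi> z) = 0"
proof -
  have "primitive (\<lambda>_. 1) (\<lambda>_. 0)" by (rule primitive_DERIV) auto
  from primitive_weak_derivative[OF this] assms show ?thesis by (simp add: weak_derivative_1)
qed

lemma admissible_powr_mult_L2:
  assumes f: "admissible k r \<delta> f" and k: "k \<ge> 1" and d: "0 < \<delta>" and g: "L2 g"
  shows "L2 (\<lambda>z. (1 + f z) powr p * g z)"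
proof -
  obtain c C where c: "0 < c" "\<And>z. c \<le> (1 + f z) powr p \<and> (1 + f z) powr p \<le> C"
    using admissible_powr_bounds[OF k d, of r p] f by blast
  have "\<bar>(1 + f z) powr p\<bar> \<le> C" for z using c(2)[of z] by simp
  then show ?thesis using L2_mult_bounded[OF g admissible_powr_measurable[OF f d]] by blast
qed

lemma admissible_powr_cancel:
  assumes "admissible k r \<delta> f" "0 < \<delta>" shows "(1 + f z) powr p * (1 + f z) powr (- p) = 1"
proof -
  have "1 + f z > 0" using assms less_le_trans unfolding admissible_def by blast
  then show ?thesis by (simp add: powr_add[symmetric])
qed

text \<open>The auxiliary unknown is \<open>v = \<phi>\<^sup>n (u\<^sub>z - 1) + 1\<close>, so that the equation reads \<open>v\<^sub>z = \<phi>\<^sup>m u\<close>;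
  the constant \<open>1\<close> makes \<open>v\<close> square integrable.\<close>

lemma flux_system_elliptic:
  assumes f: "admissible k r \<delta> f" and k: "k \<ge> 1" and d: "0 < \<delta>" and s: "flux_system n m f u v"
  shows "elliptic_weak_solution n m (\<lambda>z. 1 + f z) u"
    and "test_function \<psi> \<Longrightarrow> integrable lborel (\<lambda>z. (1 + f z) powr n * weak_D 1 u z * deriv \<psi> z)"
    and "test_function \<psi> \<Longrightarrow> integrable lborel (\<lambda>z. (1 + f z) powr m * u z * \<psi> z)"
    and "test_function \<psi> \<Longrightarrow> integrable lborel (\<lambda>z. (1 + f z) powr n * deriv \<psi> z)"
proof -
  let ?a = "\<lambda>z. (1 + f z) powr (- n)" and ?A = "\<lambda>z. (1 + f z) powr n" and ?b = "\<lambda>z. (1 + f z) powr m"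
  let ?u' = "\<lambda>z. ?a z * v z + (1 - ?a z)"
  note s' = s[unfolded flux_system_def]
  have Lu': "L2 ?u'"
    using s' by (intro L2_add admissible_powr_mult_L2[OF f k d] admissible_powr_L2[OF f k d]) auto
  have w: "weakly_diff u ?u'" using s' Lu' by (intro primitive_weakly_diff) auto
  have cA: "continuous_on UNIV ?A" "continuous_on UNIV ?b" by (intro admissible_powr_continuous[OF f d])+
  have lA: "locally_integrable ?A" by (rule locally_integrable_continuous[OF cA(1)])
  have D: "L2 (weak_D 1 u)" "AE z in lborel. weak_D 1 u z = ?u' z"
    using weak_D_props[OF weakly_diffD(2,3)[OF w]] by auto
  show i1: "integrable lborel (\<lambda>z. ?A z * weak_D 1 u z * deriv \<psi> z)" if "test_function \<psi>" for \<psi>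
    by (intro integrable_bounded_test_mult cA L2_locally_integrable D test_function_deriv that)
  show i2: "integrable lborel (\<lambda>z. ?b z * u z * \<psi> z)" if "test_function \<psi>" for \<psi>
    using s' by (intro integrable_bounded_test_mult cA L2_locally_integrable that) auto
  show i3: "integrable lborel (\<lambda>z. ?A z * deriv \<psi> z)" if "test_function \<psi>" for \<psi>
    by (intro integrable_test_mult lA test_function_deriv that)
  have "(LINT z|lborel. ?A z * weak_D 1 u z * deriv \<psi> z + ?b z * u z * \<psi> z) = (LINT z|lborel. ?A z * deriv \<psi> z)"
    if t: "test_function \<psi>" for \<psi>
  proof -
    have t': "test_function (deriv \<psi>)" by (rule test_function_deriv[OF t])
    have Lv: "L2 v" using s' by auto
    have j1: "integrable lborel (\<lambda>z. v z * deriv \<psi> z)" by (intro integrable_test_mult L2_locally_integrable Lv t')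
    have j2: "integrable lborel (deriv \<psi>)"
      using integrable_test_mult[OF locally_integrable_continuous[of "\<lambda>_. 1"] t'] by simp
    have vw: "(LINT z|lborel. v z * deriv \<psi> z) = - (LINT z|lborel. ?b z * u z * \<psi> z)"
      using primitive_weak_derivative[of v "\<lambda>z. ?b z * u z"] s' t by (simp add: weak_derivative_1)
    have [measurable]: "?A \<in> borel_measurable borel" "?a \<in> borel_measurable borel" "v \<in> borel_measurable borel"
       "weak_D 1 u \<in> borel_measurable borel" "deriv \<psi> \<in> borel_measurable borel"
      using admissible_powr_measurable[OF f d] Lv D(1) smooth_measurable[OF test_function_smooth[OF t']] by (auto simp: L2_def)
    \<comment> \<open>\<phi>^n u_z = v + \<phi>^n - 1; the constant 1 is harmless because the
      integral of the derivative of a test function is 0.\<close>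
    have "(LINT z|lborel. ?A z * weak_D 1 u z * deriv \<psi> z)
        = (LINT z|lborel. v z * deriv \<psi> z + (?A z * deriv \<psi> z - deriv \<psi> z))"
    proof (rule integral_cong_AE)
      show "AE z in lborel. ?A z * weak_D 1 u z * deriv \<psi> z = v z * deriv \<psi> z + (?A z * deriv \<psi> z - deriv \<psi> z)"
        using D(2)
      proof eventually_elim
        case (elim z)
        have "?A z * ?u' z = (?A z * ?a z) * v z + (?A z - ?A z * ?a z)" by algebra
        also have "\<dots> = v z + (?A z - 1)" unfolding admissible_powr_cancel[OF f d] by simp
        finally have eq: "?A z * ?u' z = v z + (?A z - 1)" .
        show ?case unfolding elim eq by algebra
      qed
    qed simp_all
    also have "\<dots> = (LINT z|lborel. v z * deriv \<psi> z) + (LINT z|lborel. ?A z * deriv \<psi> z)"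
      using j1 j2 i3[OF t] integral_deriv_test_function[OF t] by simp
    finally show ?thesis using i1[OF t] i2[OF t] vw by simp
  qed
  moreover have "Hk 1 u" using Hk_Suc_weakly_diff[OF w, of 0] Lu' by (simp add: Hk_0 One_nat_def)
  ultimately show "elliptic_weak_solution n m (\<lambda>z. 1 + f z) u"
    unfolding elliptic_weak_solution_def by blast
qed

text \<open>The converse translation, which together with \<open>flux_system_unique\<close>
  identifies the u of an arbitrary local solution. The weak equation says precisely that the flux
  has weak derivative \<phi>^m u; its continuous representative is the second unknown.\<close>

lemma elliptic_flux_system:
  assumes f: "admissible k r \<delta> f" and k: "k \<ge> 1" and d: "0 < \<delta>"
    and e: "elliptic_weak_solution n m (\<lambda>z. 1 + f z) u" and c: "continuous_on UNIV u"
  shows "\<exists>v. flux_system n m f u v"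
proof -
  let ?a = "\<lambda>z. (1 + f z) powr (- n)" and ?A = "\<lambda>z. (1 + f z) powr n" and ?b = "\<lambda>z. (1 + f z) powr m"
  have H: "Hk (Suc 0) u" using e by (simp add: elliptic_weak_solution_def One_nat_def)
  let ?u' = "weak_D 1 u"
  have w: "weakly_diff u ?u'" by (rule Hk_weakly_diff[OF H])
  note L = weakly_diffD(1,2)[OF w]
  define v where "v z = ?A z * ?u' z + (1 - ?A z)" for z
  have Lv: "L2 v" unfolding v_def[abs_def]
    by (intro L2_add admissible_powr_mult_L2[OF f k d] admissible_powr_L2[OF f k d] L)
  have Lb: "L2 (\<lambda>z. ?b z * u z)" by (intro admissible_powr_mult_L2[OF f k d] L)
  have cA: "continuous_on UNIV ?A" "continuous_on UNIV ?b" by (intro admissible_powr_continuous[OF f d])+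
  have "(LINT z|lborel. v z * deriv \<psi> z) = - (LINT z|lborel. ?b z * u z * \<psi> z)" if t: "test_function \<psi>" for \<psi>
  proof -
    have t': "test_function (deriv \<psi>)" by (rule test_function_deriv[OF t])
    have i1: "integrable lborel (\<lambda>z. ?A z * ?u' z * deriv \<psi> z)"
      by (intro integrable_bounded_test_mult cA L2_locally_integrable L t')
    have i2: "integrable lborel (\<lambda>z. ?b z * u z * \<psi> z)"
      by (intro integrable_bounded_test_mult cA L2_locally_integrable L t)
    have i3: "integrable lborel (\<lambda>z. ?A z * deriv \<psi> z)"
      by (intro integrable_test_mult locally_integrable_continuous cA t')
    have i4: "integrable lborel (deriv \<psi>)"
      using integrable_test_mult[OF locally_integrable_continuous[of "\<lambda>_. 1"] t'] by simp
    have "(LINT z|lborel. v z * deriv \<psi> z)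
        = (LINT z|lborel. ?A z * ?u' z * deriv \<psi> z + (deriv \<psi> z - ?A z * deriv \<psi> z))"
      by (rule Bochner_Integration.integral_cong) (simp_all add: v_def algebra_simps)
    also have "\<dots> = (LINT z|lborel. ?A z * ?u' z * deriv \<psi> z) - (LINT z|lborel. ?A z * deriv \<psi> z)"
      using i1 i3 i4 integral_deriv_test_function[OF t] by simp
    also have "(LINT z|lborel. ?A z * deriv \<psi> z)
        = (LINT z|lborel. ?A z * ?u' z * deriv \<psi> z) + (LINT z|lborel. ?b z * u z * \<psi> z)"
    proof -
      have "(LINT z|lborel. ?A z * ?u' z * deriv \<psi> z + ?b z * u z * \<psi> z) = (LINT z|lborel. ?A z * deriv \<psi> z)"
        using e t unfolding elliptic_weak_solution_def by blast
      then show ?thesis using Bochner_Integration.integral_add[OF i1 i2] by simp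
    qed
    finally show ?thesis by simp
  qed
  then have wv: "weakly_diff v (\<lambda>z. ?b z * u z)" using Lv Lb by (simp add: weakly_diff_def weak_derivative_1)
  obtain V where V: "primitive V (\<lambda>z. ?b z * u z)" "L2 V" "AE z in lborel. v z = V z"
    using weakly_diff_continuous_representative[OF wv] by blast
  \<comment> \<open>Solving the definition of v for u_z gives the first row with v; almost
    everywhere v may be replaced by its representative V.\<close>
  have "weakly_diff u (\<lambda>z. ?a z * V z + (1 - ?a z))"
  proof (rule weakly_diff_cong[OF w _ _ L(1)])
    show "AE z in lborel. ?u' z = ?a z * V z + (1 - ?a z)"
      using V(3)
    proof eventually_elim
      case (elim z)
      have "?a z * v z + (1 - ?a z) = (?A z * ?a z) * ?u' z + (1 - ?A z * ?a z)" unfolding v_def by algebra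
      also have "\<dots> = ?u' z" unfolding admissible_powr_cancel[OF f d] by simp
      finally show ?case unfolding elim by simp
    qed
    show "L2 (\<lambda>z. ?a z * V z + (1 - ?a z))"
      by (intro L2_add admissible_powr_mult_L2[OF f k d] admissible_powr_L2[OF f k d] V)
  qed simp
  from weakly_diff_primitive[OF this c] show ?thesis using V L unfolding flux_system_def by blast
qed

section \<open>The evolution in the coordinates of L^2\<close>

definition inf_value :: "nat \<Rightarrow> l2 \<Rightarrow> real" where
  "inf_value k e = (INF z. 1 + \<iota> k e z)"

text \<open>The vector field pulled back along \<iota>. It has this meaning where
  \<open>inf_value\<close> is positive; elsewhere the choice is arbitrary.\<close>

definition velocity_l2 :: "real \<Rightarrow> real \<Rightarrow> nat \<Rightarrow> l2 \<Rightarrow> l2" where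
  "velocity_l2 n m k e = (SOME e'. \<iota> k e' = velocity n m (\<iota> k e))"

definition iota_bound :: "nat \<Rightarrow> real" where
  "iota_bound k = (SOME C. C > 0 \<and> (\<forall>e. Hk_norm k (\<iota> k e) \<le> C * norm e))"

lemma iota_bound: "iota_bound k > 0" "Hk_norm k (\<iota> k e) \<le> iota_bound k * norm e"
proof -
  have "\<exists>C. C > 0 \<and> (\<forall>e. Hk_norm k (\<iota> k e) \<le> C * norm e)" using iota_norm_le[of k] by blast
  from someI_ex[OF this] show "iota_bound k > 0" "Hk_norm k (\<iota> k e) \<le> iota_bound k * norm e"
    unfolding iota_bound_def by auto
qed

lemma iota_sup: "k \<ge> 1 \<Longrightarrow> \<bar>\<iota> k e z\<bar> \<le> 2 * iota_bound k * norm e"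
  using Hk_sup_bound[OF iota_Hk[of k e] _ iota_continuous, of z] iota_bound(2)[of k e] by simp

lemma iota_diff_ext: "k \<ge> 1 \<Longrightarrow> \<iota> k (d - e) = (\<lambda>z. \<iota> k d z - \<iota> k e z)"
  by (intro ext iota_diff)

lemma norm_diff_le_iota: "k \<ge> 1 \<Longrightarrow> norm (d - e) \<le> 2 ^ k * Hk_norm k (\<lambda>z. \<iota> k d z - \<iota> k e z)"
  using norm_le_iota[of "d - e" k] by (simp add: iota_diff_ext)

lemma inf_value_bdd: "k \<ge> 1 \<Longrightarrow> bdd_below (range (\<lambda>z. 1 + \<iota> k e z))"
proof (rule bdd_belowI2)
  fix z assume "k \<ge> 1"
  from iota_sup[OF this, of e z] show "1 - 2 * iota_bound k * norm e \<le> 1 + \<iota> k e z" by linarith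
qed

lemma inf_value_ge: "k \<ge> 1 \<Longrightarrow> \<delta> \<le> inf_value k e \<longleftrightarrow> (\<forall>z. \<delta> \<le> 1 + \<iota> k e z)"
  unfolding inf_value_def by (subst le_cINF_iff) (auto intro: inf_value_bdd)

lemma inf_value_lipschitz:
  assumes k: "k \<ge> 1" shows "\<bar>inf_value k d - inf_value k e\<bar> \<le> (2 * iota_bound k) * norm (d - e)"
proof -
  have *: "inf_value k d - (2 * iota_bound k) * norm (d - e) \<le> inf_value k e" for d e
    unfolding inf_value_ge[OF k]
  proof
    fix z
    have "inf_value k d \<le> 1 + \<iota> k d z" using inf_value_ge[OF k, of "inf_value k d" d] by auto
    then show "inf_value k d - (2 * iota_bound k) * norm (d - e) \<le> 1 + \<iota> k e z"
      using iota_sup[OF k, of "d - e" z] iota_diff[OF k, of d e z] by linarith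
  qed
  show ?thesis using *[of d e] *[of e d] by (simp add: norm_minus_commute abs_le_iff)
qed

text \<open>\<phi> exceeds 1/2 outside a bounded interval and attains its minimum on it. This links
  the pointwise positivity of \<open>local_solution\<close> with the uniform bound that the
  differential equation works with.\<close>

lemma inf_value_pos:
  assumes k: "k \<ge> 1" shows "0 < inf_value k e \<longleftrightarrow> (\<forall>z. 0 < 1 + \<iota> k e z)"
proof
  assume "0 < inf_value k e"
  then show "\<forall>z. 0 < 1 + \<iota> k e z" using inf_value_ge[OF k, of "inf_value k e" e] by (auto intro: less_le_trans)
next
  assume pos: "\<forall>z. 0 < 1 + \<iota> k e z"
  have c: "continuous_on UNIV (\<lambda>z. 1 + \<iota> k e z)" by (intro continuous_intros iota_continuous k)
  obtain N where N: "\<And>z. \<bar>z\<bar> \<ge> N \<Longrightarrow> \<bar>\<iota> k e z\<bar> < 1 / 2"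
    using Hk_decay[OF iota_Hk k iota_continuous[OF k], of "1/2" e] by auto
  have ne: "{- \<bar>N\<bar>..\<bar>N\<bar>} \<noteq> {}" by auto
  obtain y where y: "\<And>z. z \<in> {- \<bar>N\<bar>..\<bar>N\<bar>} \<Longrightarrow> 1 + \<iota> k e y \<le> 1 + \<iota> k e z"
    using continuous_attains_inf[OF compact_Icc ne continuous_on_subset[OF c subset_UNIV]] by blast
  have "min (1 / 2) (1 + \<iota> k e y) \<le> 1 + \<iota> k e z" for z
  proof (cases "z \<in> {- \<bar>N\<bar>..\<bar>N\<bar>}")
    case True
    then show ?thesis using y[of z] by linarith
  next
    case False
    then have "\<bar>z\<bar> \<ge> N" by auto
    from N[OF this] show ?thesis by linarith
  qed
  then have "min (1 / 2) (1 + \<iota> k e y) \<le> inf_value k e" by (simp add: inf_value_ge[OF k])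
  then show "0 < inf_value k e" using pos by (auto intro: less_le_trans[of 0 "min (1/2) (1 + \<iota> k e y)"])
qed

lemma iota_admissible:
  assumes "k \<ge> 1" "\<delta> \<le> inf_value k e" "norm e \<le> r"
  shows "admissible k (iota_bound k * r) \<delta> (\<iota> k e)"
proof -
  have "Hk_norm k (\<iota> k e) \<le> iota_bound k * r"
    using iota_bound(2)[of k e] mult_left_mono[OF assms(3), of "iota_bound k"] iota_bound(1)[of k] by linarith
  then show ?thesis using assms inf_value_ge[OF assms(1), of \<delta> e] by (simp add: admissible_def iota_Hk iota_continuous)
qed

lemma iota_velocity_l2:
  assumes k: "k \<ge> 1" and p: "0 < inf_value k e"
  shows "\<iota> k (velocity_l2 n m k e) = velocity n m (\<iota> k e)"
proof -
  have a: "admissible k (iota_bound k * norm e) (inf_value k e) (\<iota> k e)" by (intro iota_admissible k) auto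
  have "\<exists>e'. velocity n m (\<iota> k e) = \<iota> k e'"
    by (intro iota_surj_continuous[OF k] Lip_Hk[OF velocity_Lip[OF k] p a] velocity_continuous[OF a k p])
  then have "\<exists>e'. \<iota> k e' = velocity n m (\<iota> k e)" by metis
  from someI_ex[OF this] show ?thesis unfolding velocity_l2_def .
qed

text \<open>\<open>velocity_Lip\<close> transported along \<iota>: \<open>iota_bound\<close> passes
  from L^2 to H^k and 2^k passes back. The constant of \<open>inf_value\<close> is that of the
  embedding into bounded functions.\<close>

lemma ode_velocity_l2:
  assumes k: "k \<ge> 1" shows "ode (velocity_l2 n m k) (inf_value k) (2 * iota_bound k)"
proof
  show "\<bar>inf_value k x - inf_value k y\<bar> \<le> 2 * iota_bound k * norm (x - y)" for x y
    by (rule inf_value_lipschitz[OF k])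
  show "0 < 2 * iota_bound k" using iota_bound(1) by simp
  fix \<delta> r :: real assume d: "0 < \<delta>"
  let ?r = "iota_bound k * r"
  obtain K where "Lip_on k k ?r \<delta> (velocity n m) K" using Lip_bound[OF velocity_Lip[OF k] d] by blast
  note K = Lip_onD(1,3,4)[OF this]
  have "norm (velocity_l2 n m k x - velocity_l2 n m k y) \<le> (2 ^ k * K * iota_bound k) * norm (x - y)"
    if x: "norm x \<le> r" "\<delta> \<le> inf_value k x" and y: "norm y \<le> r" "\<delta> \<le> inf_value k y" for x y
  proof -
    have p: "0 < inf_value k x" "0 < inf_value k y" using d x y by auto
    have "norm (velocity_l2 n m k x - velocity_l2 n m k y) \<le> 2 ^ k * Hk_norm k (\<lambda>z. velocity n m (\<iota> k x) z - velocity n m (\<iota> k y) z)"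
      using norm_diff_le_iota[OF k, of "velocity_l2 n m k x" "velocity_l2 n m k y"] by (simp add: iota_velocity_l2[OF k] p)
    also have "\<dots> \<le> 2 ^ k * (K * Hk_norm k (\<lambda>z. \<iota> k x z - \<iota> k y z))"
      by (intro mult_left_mono K iota_admissible k x y) auto
    also have "\<dots> \<le> 2 ^ k * (K * (iota_bound k * norm (x - y)))"
      using iota_bound(2)[of k "x - y"] K(1) by (intro mult_left_mono) (auto simp: iota_diff_ext[OF k])
    finally show ?thesis by (simp add: mult.assoc)
  qed
  then show "\<exists>L\<ge>0. \<forall>x y. norm x \<le> r \<longrightarrow> norm y \<le> r \<longrightarrow> \<delta> \<le> inf_value k x \<longrightarrow> \<delta> \<le> inf_value k y \<longrightarrow>
      norm (velocity_l2 n m k x - velocity_l2 n m k y) \<le> L * norm (x - y)"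
    using K(1) iota_bound(1)[of k] by (intro exI[of _ "2 ^ k * K * iota_bound k"]) auto
  have "norm (velocity_l2 n m k x) \<le> 2 ^ k * K" if x: "norm x \<le> r" "\<delta> \<le> inf_value k x" for x
  proof -
    have p: "0 < inf_value k x" using d x by auto
    have "norm (velocity_l2 n m k x) \<le> 2 ^ k * Hk_norm k (velocity n m (\<iota> k x))"
      using norm_le_iota[of "velocity_l2 n m k x" k] by (simp add: iota_velocity_l2[OF k p])
    also have "\<dots> \<le> 2 ^ k * K" by (intro mult_left_mono K iota_admissible k x) auto
    finally show ?thesis .
  qed
  then show "\<exists>M\<ge>0. \<forall>x. norm x \<le> r \<longrightarrow> \<delta> \<le> inf_value k x \<longrightarrow> norm (velocity_l2 n m k x) \<le> M"
    using K(1) by (intro exI[of _ "2 ^ k * K"]) auto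
qed

lemma bounded_linear_iota: "k \<ge> 1 \<Longrightarrow> bounded_linear (\<lambda>e. \<iota> k e z)"
proof (rule bounded_linear_intro[where K = "2 * iota_bound k"])
  fix x assume "k \<ge> 1"
  from iota_sup[OF this, of x z] show "norm (\<iota> k x z) \<le> norm x * (2 * iota_bound k)" by (simp add: mult.commute)
qed (simp_all add: iota_add iota_scaleR)

text \<open>The form in which \<open>C1_Hk_derivative\<close> expresses differentiability.\<close>

lemma has_vector_derivative_iff_quotient:
  fixes x :: "real \<Rightarrow> 'a::real_normed_vector"
  shows "(x has_vector_derivative v) (at t within S) \<longleftrightarrow>
    ((\<lambda>s. norm ((1 / (s - t)) *\<^sub>R (x s - x t) - v)) \<longlongrightarrow> 0) (at t within S)"
proof -
  have "norm (x s - x t - (s - t) *\<^sub>R v) / norm (s - t) = norm ((1 / (s - t)) *\<^sub>R (x s - x t) - v)" if "s \<noteq> t" for s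
  proof -
    have "(1 / (s - t)) *\<^sub>R (x s - x t) - v = (1 / (s - t)) *\<^sub>R (x s - x t - (s - t) *\<^sub>R v)"
      using that by (simp add: scaleR_diff_right)
    then show ?thesis by (simp add: divide_inverse mult.commute)
  qed
  then have "((\<lambda>s. norm (x s - x t - (s - t) *\<^sub>R v) / norm (s - t)) \<longlongrightarrow> 0) (at t within S)
    \<longleftrightarrow> ((\<lambda>s. norm ((1 / (s - t)) *\<^sub>R (x s - x t) - v)) \<longlongrightarrow> 0) (at t within S)"
    by (intro tendsto_cong) (auto simp: eventually_at_filter)
  moreover have "bounded_linear (\<lambda>h. h *\<^sub>R v)" by (rule bounded_linear_scaleR_left)
  ultimately show ?thesis by (simp add: has_vector_derivative_def has_derivative_iff_norm)
qed

text \<open>The reciprocal is taken in the extended reals, where 1/0 is infinite, so a finite bound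
  excludes zeros. Only the modulus of \<phi> is controlled in this way.\<close>

lemma recip_norm_lower_bound:
  assumes "recip_norm \<phi> \<le> ereal c" "c > 0"
  shows "AE z in lborel. 1 / c \<le> \<bar>\<phi> z\<bar>"
proof -
  have "AE z in lborel. \<bar>1 / ereal (\<phi> z)\<bar> \<le> recip_norm \<phi>" unfolding Linf_norm_def by (rule esssup_AE)
  then show ?thesis
  proof eventually_elim
    case (elim z)
    then have le: "\<bar>1 / ereal (\<phi> z)\<bar> \<le> ereal c" using assms(1) by (rule order_trans)
    have "\<phi> z \<noteq> 0"
    proof
      assume "\<phi> z = 0"
      then have "\<bar>1 / ereal (\<phi> z)\<bar> = \<infinity>" by (simp add: divide_ereal_def zero_ereal_def[symmetric])
      then show False using le by simp
    qed
    then have "1 / \<bar>\<phi> z\<bar> \<le> c" using le by (simp add: one_ereal_def)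
    then show ?case using \<open>\<phi> z \<noteq> 0\<close> assms(2) by (simp add: field_simps)
  qed
qed

lemma recip_norm_nonneg: "0 \<le> recip_norm \<phi>"
proof -
  have "AE z in lborel. \<bar>1 / ereal (\<phi> z)\<bar> \<le> recip_norm \<phi>" unfolding Linf_norm_def by (rule esssup_AE)
  then have "AE z in (lborel :: real measure). 0 \<le> recip_norm \<phi>"
    by eventually_elim (rule order_trans[OF abs_ereal_pos])
  moreover have "ae_filter (lborel :: real measure) \<noteq> bot" by (simp add: ae_filter_eq_bot_iff)
  ultimately show ?thesis by (simp add: eventually_const)
qed

text \<open>The hypothesis leaves the sign of \<phi> open. It is settled by the limit 1 at infinity:
  a continuous function that is positive somewhere and never smaller than c in modulus cannot become
  negative.\<close>

lemma inf_value_ge_AE: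
  assumes k: "k \<ge> 1" and c: "c > 0" and ae: "AE z in lborel. c \<le> \<bar>1 + \<iota> k e z\<bar>"
  shows "c \<le> inf_value k e"
proof -
  let ?h = "\<lambda>z. 1 + \<iota> k e z"
  have ch: "continuous_on UNIV ?h" by (intro continuous_intros iota_continuous k)
  \<comment> \<open>The inequality c \<le> |?h| is written as an equation between continuous
    functions, so that it passes from almost every z to every z.\<close>
  have "max c \<bar>?h z\<bar> = \<bar>?h z\<bar>" for z
    by (rule continuous_AE_eq) (use ae in \<open>auto intro!: continuous_intros iota_continuous k elim!: eventually_mono\<close>)
  then have b: "c \<le> \<bar>?h z\<bar>" for z by (metis max.cobounded1)
  obtain N where N: "\<And>z. \<bar>z\<bar> \<ge> N \<Longrightarrow> \<bar>\<iota> k e z\<bar> < 1"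
    using Hk_decay[OF iota_Hk k iota_continuous[OF k], of 1 e] by auto
  have pN: "0 < ?h N" using N[OF abs_ge_self] by linarith
  have "0 \<le> ?h z" for z
  proof (rule ccontr)
    assume "\<not> 0 \<le> ?h z"
    have "connected (range ?h)" by (rule connected_continuous_image[OF ch connected_UNIV])
    then have "0 \<in> range ?h"
      using \<open>\<not> 0 \<le> ?h z\<close> pN connectedD_interval[of "range ?h" "?h z" "?h N" 0] by auto
    then obtain y where "?h y = 0" by force
    then show False using b[of y] c by simp
  qed
  then have "c \<le> ?h z" for z using b[of z] by (metis abs_of_nonneg)
  then show ?thesis by (simp add: inf_value_ge[OF k])
qed

lemma Hk_norm_tendsto_0I:
  assumes le: "\<And>s. Hk_norm k (f s) \<le> h s" and h: "(h \<longlongrightarrow> 0) G"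
  shows "((\<lambda>s. Hk_norm k (f s)) \<longlongrightarrow> 0) G"
  by (rule tendsto_sandwich[OF _ _ tendsto_const h]) (simp_all add: le)

text \<open>The time derivative of \<phi> is the image of the vector field under \<iota>, and this
  is \<phi>^m u. Boundedness of \<iota> turns limits in L^2 into limits in H^k.\<close>

lemma sol_local_solution:
  fixes n m :: real
  assumes k: "k \<ge> 1" and s: "ode.sol (velocity_l2 n m k) (inf_value k) e0 T x"
    and \<phi>0: "AE z in lborel. \<phi>0 z - 1 = \<iota> k e0 z"
  shows "local_solution n m k \<phi>0 T (\<lambda>t z. 1 + \<iota> k (x t) z)"
    and "solves_evolution_equation n m k T (\<lambda>t z. 1 + \<iota> k (x t) z)"
proof -
  interpret ode "velocity_l2 n m k" "inf_value k" "2 * iota_bound k" by (rule ode_velocity_l2[OF k])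
  let ?F = "velocity_l2 n m k"
  define u where "u t = ell_u n m (\<iota> k (x t))" for t
  have pos: "0 < inf_value k (x t)" if "t \<in> time_interval T" for t using s that by (simp add: sol_def)
  have der: "(x has_vector_derivative ?F (x t)) (at t within time_interval T)" if "t \<in> time_interval T" for t
    using s that by (simp add: sol_def)
  have adm: "admissible k (iota_bound k * norm (x t)) (inf_value k (x t)) (\<iota> k (x t))" for t
    by (intro iota_admissible k) auto
  have fs: "flux_system n m (\<iota> k (x t)) (u t) (ell_v n m (\<iota> k (x t)))" if "t \<in> time_interval T" for t
    unfolding u_def by (rule flux_solution[OF adm k pos[OF that]])
  have Fu: "\<iota> k (?F (x t)) = (\<lambda>z. (1 + \<iota> k (x t) z) powr m * u t z)" if "t \<in> time_interval T" for t
    unfolding iota_velocity_l2[OF k pos[OF that]] velocity_def[abs_def] u_def ..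
  have p1: "0 < 1 + \<iota> k (x t) z" if "t \<in> time_interval T" for t z
    using pos[OF that] by (simp add: inf_value_pos[OF k])
  have C1: "C1_Hk_derivative k T (\<lambda>t z. (1 + \<iota> k (x t) z) - 1) (\<lambda>t. \<iota> k (?F (x t)))"
    unfolding C1_Hk_derivative_def
  proof (intro ballI conjI)
    fix t assume t: "t \<in> time_interval T"
    show "Hk k (\<lambda>z. (1 + \<iota> k (x t) z) - 1)" "Hk k (\<iota> k (?F (x t)))" by (simp_all add: iota_Hk)
    have lim: "((\<lambda>s. iota_bound k * norm ((1 / (s - t)) *\<^sub>R (x s - x t) - ?F (x t))) \<longlongrightarrow> 0) (at t within time_interval T)"
      using der[OF t] unfolding has_vector_derivative_iff_quotient by (rule tendsto_mult_right_zero)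
    show "((\<lambda>s. Hk_norm k (\<lambda>z. ((1 + \<iota> k (x s) z) - 1 - ((1 + \<iota> k (x t) z) - 1)) / (s - t) - \<iota> k (?F (x t)) z)) \<longlongrightarrow> 0)
        (at t within time_interval T)"
    proof (rule Hk_norm_tendsto_0I[OF _ lim])
      fix s
      have eq: "(\<lambda>z. ((1 + \<iota> k (x s) z) - 1 - ((1 + \<iota> k (x t) z) - 1)) / (s - t) - \<iota> k (?F (x t)) z)
         = \<iota> k ((1 / (s - t)) *\<^sub>R (x s - x t) - ?F (x t))"
        by (rule ext) (simp add: iota_diff[OF k] iota_scaleR[OF k])
      show "Hk_norm k (\<lambda>z. ((1 + \<iota> k (x s) z) - 1 - ((1 + \<iota> k (x t) z) - 1)) / (s - t) - \<iota> k (?F (x t)) z)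
         \<le> iota_bound k * norm ((1 / (s - t)) *\<^sub>R (x s - x t) - ?F (x t))"
        unfolding eq by (rule iota_bound(2))
    qed
    have "(x \<longlongrightarrow> x t) (at t within time_interval T)"
      using has_vector_derivative_continuous[OF der[OF t]] by (simp add: continuous_within)
    then have "((\<lambda>s. ?F (x s)) \<longlongrightarrow> ?F (x t)) (at t within time_interval T)"
      by (rule isCont_tendsto_compose[OF F_continuous[OF pos[OF t]]])
    then have "((\<lambda>s. norm (?F (x s) - ?F (x t))) \<longlongrightarrow> 0) (at t within time_interval T)"
      by (intro tendsto_norm_zero) (simp add: LIM_zero_iff)
    then have lim': "((\<lambda>s. iota_bound k * norm (?F (x s) - ?F (x t))) \<longlongrightarrow> 0) (at t within time_interval T)"
      by (rule tendsto_mult_right_zero)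
    show "((\<lambda>s. Hk_norm k (\<lambda>z. \<iota> k (?F (x s)) z - \<iota> k (?F (x t)) z)) \<longlongrightarrow> 0) (at t within time_interval T)"
      by (rule Hk_norm_tendsto_0I[OF _ lim']) (simp only: iota_diff_ext[OF k, symmetric] iota_bound(2))
  qed
  show "local_solution n m k \<phi>0 T (\<lambda>t z. 1 + \<iota> k (x t) z)"
    unfolding local_solution_def
  proof (intro conjI ballI exI[of _ u])
    fix t assume t: "t \<in> time_interval T"
    show "continuous_on UNIV (\<lambda>z. 1 + \<iota> k (x t) z)" by (intro continuous_intros iota_continuous k)
    show "\<forall>z. 0 < 1 + \<iota> k (x t) z" using p1[OF t] by simp
    show "continuous_on UNIV (u t)" using fs[OF t] unfolding flux_system_def by (blast intro: primitive_continuous)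
    show "elliptic_weak_solution n m (\<lambda>z. 1 + \<iota> k (x t) z) (u t)"
      by (rule flux_system_elliptic(1)[OF adm k pos[OF t] fs[OF t]])
    have sub: "{0..t} \<subseteq> time_interval T" by (rule time_interval_Icc_subset[OF t])
    have x0: "x 0 = e0" using s time_interval_pos[OF t] by (simp add: sol_def)
    \<comment> \<open>Evaluation at z is a bounded linear functional, so the fundamental theorem of
      calculus applies separately for each z.\<close>
    have "((\<lambda>s. (1 + \<iota> k (x s) z) powr m * u s z) has_integral (\<iota> k (x t) z - \<iota> k (x 0) z)) {0..t}" for z
    proof (rule fundamental_theorem_of_calculus)
      show "0 \<le> t" using t by (simp add: time_interval_def)
      fix r assume r: "r \<in> {0..t}"
      then have rT: "r \<in> time_interval T" using sub by blast
      have "((\<lambda>s. \<iota> k (x s) z) has_vector_derivative \<iota> k (?F (x r)) z) (at r within {0..t})"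
        by (rule bounded_linear.has_vector_derivative[OF bounded_linear_iota[OF k]])
           (rule has_vector_derivative_within_subset[OF der[OF rT] sub])
      then show "((\<lambda>s. \<iota> k (x s) z) has_vector_derivative (1 + \<iota> k (x r) z) powr m * u r z) (at r within {0..t})"
        by (simp add: Fu[OF rT])
    qed
    then have I: "((\<lambda>s. (1 + \<iota> k (x s) z) powr m * u s z) has_integral (\<iota> k (x t) z - \<iota> k e0 z)) {0..t}" for z
      by (simp add: x0)
    show "AE z in lborel. ((\<lambda>s. (1 + \<iota> k (x s) z) powr m * u s z) has_integral (1 + \<iota> k (x t) z - \<phi>0 z)) {0..t}"
      using \<phi>0
    proof eventually_elim
      case (elim z)
      then have "1 + \<iota> k (x t) z - \<phi>0 z = \<iota> k (x t) z - \<iota> k e0 z" by simp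
      then show ?case using I[of z] by (simp only:)
    qed
  next
    show "C1_Hk k T (\<lambda>t z. 1 + \<iota> k (x t) z - 1)" using C1 unfolding C1_Hk_def by blast
  qed
  show "solves_evolution_equation n m k T (\<lambda>t z. 1 + \<iota> k (x t) z)"
    unfolding solves_evolution_equation_def
  proof (intro exI[of _ "\<lambda>t. \<iota> k (?F (x t))"] conjI ballI allI impI C1)
    fix t assume t: "t \<in> time_interval T"
    \<comment> \<open>\<phi>^(-m) \<phi>_t is exactly u, so the tested evolution equation is the
      tested elliptic equation with its terms rearranged.\<close>
    have ut: "(\<lambda>z. (1 + \<iota> k (x t) z) powr (- m) * \<iota> k (?F (x t)) z) = u t"
    proof
      fix z
      have "(1 + \<iota> k (x t) z) powr m * (1 + \<iota> k (x t) z) powr (- m) = 1"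
        by (rule admissible_powr_cancel[OF adm pos[OF t]])
      then show "(1 + \<iota> k (x t) z) powr (- m) * \<iota> k (?F (x t)) z = u t z"
        unfolding Fu[OF t] by algebra
    qed
    note ell = flux_system_elliptic[OF adm k pos[OF t] fs[OF t]]
    show "Hk 1 (\<lambda>z. (1 + \<iota> k (x t) z) powr (- m) * \<iota> k (?F (x t)) z)"
      using ell(1) unfolding ut elliptic_weak_solution_def by blast
    fix \<psi> :: "real \<Rightarrow> real" assume \<psi>: "test_function \<psi>"
    have "(LINT z|lborel. (1 + \<iota> k (x t) z) powr n * weak_D 1 (u t) z * deriv \<psi> z + (1 + \<iota> k (x t) z) powr m * u t z * \<psi> z)
       = (LINT z|lborel. (1 + \<iota> k (x t) z) powr n * deriv \<psi> z)"
      using ell(1) \<psi> unfolding elliptic_weak_solution_def by blast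
    then have "(LINT z|lborel. ((1 + \<iota> k (x t) z) powr n * weak_D 1 (u t) z * deriv \<psi> z + (1 + \<iota> k (x t) z) powr m * u t z * \<psi> z)
       - (1 + \<iota> k (x t) z) powr n * deriv \<psi> z) = 0"
      using Bochner_Integration.integral_diff[OF Bochner_Integration.integrable_add[OF ell(2,3)[OF \<psi>]] ell(4)[OF \<psi>]] by simp
    moreover have "(1 + \<iota> k (x t) z) powr m * u t z * \<psi> z - (1 + \<iota> k (x t) z) powr n * deriv \<psi> z
          + (1 + \<iota> k (x t) z) powr n * weak_D 1 (u t) z * deriv \<psi> z
        = ((1 + \<iota> k (x t) z) powr n * weak_D 1 (u t) z * deriv \<psi> z + (1 + \<iota> k (x t) z) powr m * u t z * \<psi> z)
       - (1 + \<iota> k (x t) z) powr n * deriv \<psi> z" for z by simp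
    ultimately show "(LINT z|lborel. \<iota> k (?F (x t)) z * \<psi> z - (1 + \<iota> k (x t) z) powr n * deriv \<psi> z
          + (1 + \<iota> k (x t) z) powr n * weak_D 1 (\<lambda>y. (1 + \<iota> k (x t) y) powr (- m) * \<iota> k (?F (x t)) y) z * deriv \<psi> z) = 0"
      unfolding ut unfolding Fu[OF t] by (simp only:)
  qed
qed

text \<open>This makes the lifespan of the differential equation an upper bound for the time of
  every local solution. The integral equation for almost every z is lifted to one in L^2, whose
  differentiation gives the differential equation.\<close>

lemma local_solution_sol:
  fixes n m :: real
  assumes k: "k \<ge> 1" and l: "local_solution n m k \<phi>0 T \<phi>"
    and \<phi>0: "AE z in lborel. \<phi>0 z - 1 = \<iota> k e0 z"
  shows "\<exists>x. ode.sol (velocity_l2 n m k) (inf_value k) e0 T x"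
proof -
  interpret ode "velocity_l2 n m k" "inf_value k" "2 * iota_bound k" by (rule ode_velocity_l2[OF k])
  let ?F = "velocity_l2 n m k"
  obtain f' where C1: "C1_Hk_derivative k T (\<lambda>t z. \<phi> t z - 1) f'"
    using l unfolding local_solution_def C1_Hk_def by blast
  obtain u where u: "\<And>t. t \<in> time_interval T \<Longrightarrow> continuous_on UNIV (u t)"
    "\<And>t. t \<in> time_interval T \<Longrightarrow> elliptic_weak_solution n m (\<phi> t) (u t)"
    "\<And>t. t \<in> time_interval T \<Longrightarrow> AE z in lborel. ((\<lambda>s. \<phi> s z powr m * u s z) has_integral (\<phi> t z - \<phi>0 z)) {0..t}"
    using l unfolding local_solution_def by blast
  have ph: "continuous_on UNIV (\<phi> t)" "\<And>z. \<phi> t z > 0" if "t \<in> time_interval T" for t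
    using l that unfolding local_solution_def by auto
  have "\<exists>e. (\<lambda>z. \<phi> t z - 1) = \<iota> k e" if t: "t \<in> time_interval T" for t
    using C1 t unfolding C1_Hk_derivative_def by (intro iota_surj_continuous[OF k] continuous_intros ph) auto
  then obtain x where x: "\<And>t. t \<in> time_interval T \<Longrightarrow> (\<lambda>z. \<phi> t z - 1) = \<iota> k (x t)" by metis
  have x': "\<phi> t = (\<lambda>z. 1 + \<iota> k (x t) z)" if "t \<in> time_interval T" for t
    using fun_cong[OF x[OF that]] by (intro ext) (simp add: algebra_simps)
  have "\<exists>e. AE z in lborel. f' t z = \<iota> k e z" if t: "t \<in> time_interval T" for t
    using C1 t unfolding C1_Hk_derivative_def by (intro iota_surj) auto
  then obtain g where g: "\<And>t. t \<in> time_interval T \<Longrightarrow> AE z in lborel. f' t z = \<iota> k (g t) z" by metis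
  have pos: "0 < inf_value k (x t)" if "t \<in> time_interval T" for t
    using ph(2)[OF that] x'[OF that] by (simp add: inf_value_pos[OF k])
  have adm: "admissible k (iota_bound k * norm (x t)) (inf_value k (x t)) (\<iota> k (x t))" for t
    by (intro iota_admissible k) auto
  \<comment> \<open>Serves to make x continuous in time; that the derivative is the vector field is
    read off from the integral equation below.\<close>
  have der: "(x has_vector_derivative g t) (at t within time_interval T)" if t: "t \<in> time_interval T" for t
    unfolding has_vector_derivative_iff_quotient
  proof (rule tendsto_sandwich[OF _ _ tendsto_const])
    have "((\<lambda>s. Hk_norm k (\<lambda>z. ((\<phi> s z - 1) - (\<phi> t z - 1)) / (s - t) - f' t z)) \<longlongrightarrow> 0) (at t within time_interval T)"
      using C1 t unfolding C1_Hk_derivative_def by auto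
    from tendsto_mult[OF tendsto_const[of "2 ^ k"] this]
    show "((\<lambda>s. 2 ^ k * Hk_norm k (\<lambda>z. ((\<phi> s z - 1) - (\<phi> t z - 1)) / (s - t) - f' t z)) \<longlongrightarrow> 0) (at t within time_interval T)"
      by simp
    show "\<forall>\<^sub>F s in at t within time_interval T. 0 \<le> norm ((1 / (s - t)) *\<^sub>R (x s - x t) - g t)" by simp
    have "norm ((1 / (s - t)) *\<^sub>R (x s - x t) - g t) \<le> 2 ^ k * Hk_norm k (\<lambda>z. ((\<phi> s z - 1) - (\<phi> t z - 1)) / (s - t) - f' t z)"
      if s: "s \<in> time_interval T" for s
    proof -
      let ?h = "\<lambda>z. ((\<phi> s z - 1) - (\<phi> t z - 1)) / (s - t) - f' t z"
      have eq: "?h = (\<lambda>z. (1 / (s - t)) * (\<iota> k (x s) z - \<iota> k (x t) z) - f' t z)"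
        by (rule ext) (simp add: x'[OF s] x'[OF t])
      have Lf: "L2 (f' t)" using C1 t unfolding C1_Hk_derivative_def by (auto intro: Hk_L2)
      have Lh: "L2 ?h" unfolding eq by (intro L2_diff L2_cmult Lf Hk_L2[OF iota_Hk])
      have "AE z in lborel. ?h z = \<iota> k ((1 / (s - t)) *\<^sub>R (x s - x t) - g t) z"
        using g[OF t]
      proof eventually_elim
        case (elim z)
        have "((\<phi> s z - 1) - (\<phi> t z - 1)) / (s - t) = (1 / (s - t)) * (\<iota> k (x s) z - \<iota> k (x t) z)"
          by (simp add: x'[OF s] x'[OF t])
        then show ?case by (simp only: elim iota_diff[OF k] iota_scaleR[OF k])
      qed
      from Hk_cong(2)[OF this Lh Hk_L2[OF iota_Hk]]
      have "Hk_norm k ?h = Hk_norm k (\<iota> k ((1 / (s - t)) *\<^sub>R (x s - x t) - g t))" .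
      then show ?thesis using norm_le_iota by simp
    qed
    then show "\<forall>\<^sub>F s in at t within time_interval T. norm ((1 / (s - t)) *\<^sub>R (x s - x t) - g t)
        \<le> 2 ^ k * Hk_norm k (\<lambda>z. ((\<phi> s z - 1) - (\<phi> t z - 1)) / (s - t) - f' t z)"
      by (auto simp: eventually_at_filter)
  qed
  have cx: "continuous_on (time_interval T) x"
    using der by (auto simp: continuous_on_eq_continuous_within intro: has_vector_derivative_continuous)
  have cF: "continuous_on (time_interval T) (\<lambda>s. ?F (x s))"
    unfolding continuous_on_def
  proof
    fix t assume t: "t \<in> time_interval T"
    have "(x \<longlongrightarrow> x t) (at t within time_interval T)" using cx t by (simp add: continuous_on_def)
    then show "((\<lambda>s. ?F (x s)) \<longlongrightarrow> ?F (x t)) (at t within time_interval T)"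
      by (rule isCont_tendsto_compose[OF F_continuous[OF pos[OF t]]])
  qed
  \<comment> \<open>Uniqueness for the elliptic problem identifies the given u with the one inside
    the vector field.\<close>
  have uF: "\<phi> t z powr m * u t z = \<iota> k (?F (x t)) z" if t: "t \<in> time_interval T" for t z
  proof -
    have "elliptic_weak_solution n m (\<lambda>z. 1 + \<iota> k (x t) z) (u t)" using u(2)[OF t] x'[OF t] by simp
    from elliptic_flux_system[OF adm k pos[OF t] this u(1)[OF t]] obtain v
      where "flux_system n m (\<iota> k (x t)) (u t) v" by blast
    from flux_system_unique(1)[OF adm k pos[OF t] this flux_solution[OF adm k pos[OF t]]]
    have "u t = ell_u n m (\<iota> k (x t))" .
    then show ?thesis by (simp add: iota_velocity_l2[OF k pos[OF t]] velocity_def x'[OF t])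
  qed
  \<comment> \<open>The integral in L^2 is evaluated at z by the bounded functional. Agreement for
    almost every z at a fixed t is enough, since \<iota> is injective modulo null sets.\<close>
  have int_eq: "x t = e0 + integral {0..t} (\<lambda>s. ?F (x s))" if t: "t \<in> time_interval T" for t
  proof (rule iota_inj[OF k])
    have sub: "{0..t} \<subseteq> time_interval T" by (rule time_interval_Icc_subset[OF t])
    have "((\<lambda>s. ?F (x s)) has_integral integral {0..t} (\<lambda>s. ?F (x s))) {0..t}"
      by (intro integrable_integral integrable_continuous_real continuous_on_subset[OF cF sub])
    from has_integral_linear[OF this bounded_linear_iota[OF k]]
    have I: "((\<lambda>s. \<iota> k (?F (x s)) z) has_integral \<iota> k (integral {0..t} (\<lambda>s. ?F (x s))) z) {0..t}" for z
      by (simp add: o_def)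
    show "AE z in lborel. \<iota> k (x t) z = \<iota> k (e0 + integral {0..t} (\<lambda>s. ?F (x s))) z"
      using u(3)[OF t] \<phi>0
    proof eventually_elim
      case (elim z)
      have "((\<lambda>s. \<iota> k (?F (x s)) z) has_integral (\<phi> t z - \<phi>0 z)) {0..t}"
        by (rule has_integral_eq[OF _ elim(1)]) (use uF sub in blast)
      from has_integral_unique[OF this I] have "\<phi> t z - \<phi>0 z = \<iota> k (integral {0..t} (\<lambda>s. ?F (x s))) z" .
      then show ?case using elim(2) by (simp add: iota_add[OF k] x'[OF t])
    qed
  qed
  have "sol e0 T x"
    unfolding sol_def
  proof (intro conjI impI ballI)
    assume "0 < T"
    then have "0 \<in> time_interval T" by (simp add: time_interval_def zero_ereal_def[symmetric])
    then show "x 0 = e0" using int_eq[of 0] by simp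
  next
    fix t assume t: "t \<in> time_interval T"
    show "0 < inf_value k (x t)" by (rule pos[OF t])
    \<comment> \<open>A compact interval reaching beyond t is required for the derivative of the
      integral; near t it has the same neighbourhoods as the interval of existence.\<close>
    from t obtain t' where t': "t < t'" "ereal t' < T" using ereal_dense2[of "ereal t" T] by (auto simp: time_interval_def)
    then have tT': "t' \<in> time_interval T" using t by (auto simp: time_interval_def)
    have sub: "{0..t'} \<subseteq> time_interval T" by (rule time_interval_Icc_subset[OF tT'])
    have tI: "t \<in> {0..t'}" using t t' by (auto simp: time_interval_def)
    have "((\<lambda>t. e0 + integral {0..t} (\<lambda>s. ?F (x s))) has_vector_derivative (0 + ?F (x t))) (at t within {0..t'})"
      by (intro has_vector_derivative_add has_vector_derivative_const integral_has_vector_derivative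
          continuous_on_subset[OF cF sub] tI)
    from this[unfolded add_0] have "(x has_vector_derivative ?F (x t)) (at t within {0..t'})"
      by (rule has_vector_derivative_transform[OF tI, rotated]) (use int_eq sub in blast)
    moreover have "at t within {0..t'} = at t within time_interval T"
      by (rule at_within_nhd[of t "{..<t'}"]) (use t' sub in \<open>auto simp: time_interval_def\<close>)
    ultimately show "(x has_vector_derivative ?F (x t)) (at t within time_interval T)" by simp
  qed
  then show ?thesis by blast
qed

text \<open>The bounds \<epsilon> and R have to come out exactly, so the ball is fitted to the H^k
  norm and to the infimum before the uniform Picard time is taken; \<gamma> is the gap between R and
  the norm of the data.\<close>

lemma local_existence_time:
  assumes k: "k \<ge> 1" and \<epsilon>: "0 < \<epsilon>" and \<gamma>: "0 < \<gamma>"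
  shows "\<exists>\<tau>>0. \<forall>e0. Hk_norm k (\<iota> k e0) \<le> R - \<gamma> \<longrightarrow> 2 * \<epsilon> \<le> inf_value k e0 \<longrightarrow>
    (\<exists>x. ode.sol (velocity_l2 n m k) (inf_value k) e0 (ereal \<tau>) x \<and>
      (\<forall>t\<in>{0..<\<tau>}. \<epsilon> \<le> inf_value k (x t) \<and> Hk_norm k (\<iota> k (x t)) \<le> R))"
proof -
  interpret ode "velocity_l2 n m k" "inf_value k" "2 * iota_bound k" by (rule ode_velocity_l2[OF k])
  let ?C = "iota_bound k"
  note C = iota_bound(1)[of k]
  \<comment> \<open>On a ball of radius \<eta> the H^k norm changes by at most \<gamma> and the
    infimum, which starts at 2 \<epsilon> or more, by at most \<epsilon>.\<close>
  define \<eta> where "\<eta> = min (\<gamma> / ?C) (\<epsilon> / (2 * ?C))"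
  have \<eta>: "0 < \<eta>" using \<epsilon> \<gamma> C by (simp add: \<eta>_def)
  have "?C * \<eta> \<le> ?C * (\<gamma> / ?C)" "(2 * ?C) * \<eta> \<le> (2 * ?C) * (\<epsilon> / (2 * ?C))"
    using C by (intro mult_left_mono; simp add: \<eta>_def)+
  then have C\<eta>: "?C * \<eta> \<le> \<gamma>" "(2 * ?C) * \<eta> \<le> \<epsilon>" using C by simp_all
  obtain \<tau> where \<tau>: "\<tau> > 0" "\<And>e0. (\<forall>e\<in>cball e0 \<eta>. norm e \<le> 2 ^ k * R \<and> \<epsilon> \<le> inf_value k e) \<Longrightarrow>
    (\<exists>x. x 0 = e0 \<and> (\<forall>t\<in>{0..\<tau>}. x t \<in> cball e0 \<eta> \<and> (x has_vector_derivative velocity_l2 n m k (x t)) (at t within {0..\<tau>})))"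
    using uniform_local_solution[OF \<epsilon> \<eta>, of "2 ^ k * R"] by blast
  have "\<exists>x. sol e0 (ereal \<tau>) x \<and> (\<forall>t\<in>{0..<\<tau>}. \<epsilon> \<le> inf_value k (x t) \<and> Hk_norm k (\<iota> k (x t)) \<le> R)"
    if e0: "Hk_norm k (\<iota> k e0) \<le> R - \<gamma>" "2 * \<epsilon> \<le> inf_value k e0" for e0
  proof -
    have b: "Hk_norm k (\<iota> k e) \<le> R" "\<epsilon> \<le> inf_value k e" if e: "e \<in> cball e0 \<eta>" for e
    proof -
      have ne: "norm (e - e0) \<le> \<eta>" using e by (simp add: dist_norm norm_minus_commute)
      have "\<iota> k e = (\<lambda>z. \<iota> k e0 z + \<iota> k (e - e0) z)" by (rule ext) (simp add: iota_diff[OF k])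
      then have "Hk_norm k (\<iota> k e) \<le> Hk_norm k (\<iota> k e0) + Hk_norm k (\<iota> k (e - e0))"
        using Hk_norm_triangle[OF iota_Hk iota_Hk, of k e0 "e - e0"] by simp
      moreover have "Hk_norm k (\<iota> k (e - e0)) \<le> ?C * norm (e - e0)" by (rule iota_bound(2))
      moreover have "?C * norm (e - e0) \<le> ?C * \<eta>" using C ne by (intro mult_left_mono) auto
      ultimately show "Hk_norm k (\<iota> k e) \<le> R" using e0(1) C\<eta>(1) by linarith
      have "(2 * ?C) * norm (e - e0) \<le> (2 * ?C) * \<eta>" using C ne by (intro mult_left_mono) auto
      then show "\<epsilon> \<le> inf_value k e" using inf_value_lipschitz[OF k, of e e0] e0(2) C\<eta>(2) by linarith
    qed
    have "norm e \<le> 2 ^ k * R" if "e \<in> cball e0 \<eta>" for e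
      using norm_le_iota[of e k] b(1)[OF that] by (meson mult_left_mono order_trans zero_le_numeral zero_le_power)
    with b obtain x where x: "x 0 = e0"
      "\<And>t. t \<in> {0..\<tau>} \<Longrightarrow> x t \<in> cball e0 \<eta> \<and> (x has_vector_derivative velocity_l2 n m k (x t)) (at t within {0..\<tau>})"
      using \<tau>(2)[of e0] by blast
    have bx: "\<epsilon> \<le> inf_value k (x t)" "Hk_norm k (\<iota> k (x t)) \<le> R" if "t \<in> {0..<\<tau>}" for t
      using b[of "x t"] x(2)[of t] that by auto
    have "sol e0 (ereal \<tau>) x"
      unfolding sol_def time_interval_ereal
    proof (intro conjI impI ballI)
      show "x 0 = e0" by (rule x(1))
      fix t assume t: "t \<in> {0..<\<tau>}"
      show "0 < inf_value k (x t)" using bx(1)[OF t] \<epsilon> by simp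
      have "(x has_vector_derivative velocity_l2 n m k (x t)) (at t within {0..\<tau>})" using x(2)[of t] t by auto
      then show "(x has_vector_derivative velocity_l2 n m k (x t)) (at t within {0..<\<tau>})"
        by (rule has_vector_derivative_within_subset) auto
    qed
    then show ?thesis using bx by blast
  qed
  then show ?thesis using \<tau>(1) by blast
qed

text \<open>Both summands are nonnegative, so a bound r on the sum bounds each of them and places
  the solution in a region that \<open>blow_up\<close> excludes near T.\<close>

lemma norm_blow_up:
  fixes n m :: real
  assumes k: "k \<ge> 1" and T: "ode.life (velocity_l2 n m k) (inf_value k) e0 = ereal T" "0 < T"
  defines "\<Phi> \<equiv> \<lambda>t z. 1 + \<iota> k (ode.max_sol (velocity_l2 n m k) (inf_value k) e0 t) z"
  shows "((\<lambda>t. ereal (Hk_norm k (\<lambda>z. \<Phi> t z - 1)) + recip_norm (\<Phi> t)) \<longlongrightarrow> \<infinity>) (at_left T)"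
proof -
  interpret ode "velocity_l2 n m k" "inf_value k" "2 * iota_bound k" by (rule ode_velocity_l2[OF k])
  show ?thesis
    unfolding tendsto_PInfty
  proof
    fix r :: real
    \<comment> \<open>Positive even for r \<le> 0, so that 1 / ?c is a valid lower bound for the
      infimum.\<close>
    let ?c = "\<bar>r\<bar> + 1"
    have c: "?c > 0" by simp
    then have "1 / ?c > 0" by simp
    from blow_up[OF T this, of "2 ^ k * \<bar>r\<bar>"] obtain s where s: "s < T"
      "\<And>t. s < t \<Longrightarrow> t < T \<Longrightarrow> \<not> (norm (max_sol e0 t) \<le> 2 ^ k * \<bar>r\<bar> \<and> 1 / ?c \<le> inf_value k (max_sol e0 t))"
      by blast
    have "ereal r < ereal (Hk_norm k (\<lambda>z. \<Phi> t z - 1)) + recip_norm (\<Phi> t)" if t: "s < t" "t < T" for t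
    proof (rule ccontr)
      let ?e = "max_sol e0 t"
      assume "\<not> ereal r < ereal (Hk_norm k (\<lambda>z. \<Phi> t z - 1)) + recip_norm (\<Phi> t)"
      then have le: "ereal (Hk_norm k (\<iota> k ?e)) + recip_norm (\<Phi> t) \<le> ereal r" by (simp add: \<Phi>_def)
      have "ereal (Hk_norm k (\<iota> k ?e)) \<le> ereal (Hk_norm k (\<iota> k ?e)) + recip_norm (\<Phi> t)"
        using recip_norm_nonneg[of "\<Phi> t"] by (simp add: ereal_le_add_self)
      with le have "ereal (Hk_norm k (\<iota> k ?e)) \<le> ereal r" by (rule order_trans[rotated])
      then have "Hk_norm k (\<iota> k ?e) \<le> \<bar>r\<bar>" by simp
      then have 1: "norm ?e \<le> 2 ^ k * \<bar>r\<bar>"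
        using norm_le_iota[of ?e k] by (meson mult_left_mono order_trans zero_le_numeral zero_le_power)
      have "recip_norm (\<Phi> t) \<le> ereal (Hk_norm k (\<iota> k ?e)) + recip_norm (\<Phi> t)"
        by (simp add: ereal_le_add_self2)
      also note le
      also have "ereal r \<le> ereal ?c" by simp
      finally have "recip_norm (\<Phi> t) \<le> ereal ?c" .
      from recip_norm_lower_bound[OF this c] have "1 / ?c \<le> inf_value k ?e"
        by (intro inf_value_ge_AE[OF k]) (simp_all add: \<Phi>_def)
      with 1 s(2)[OF t] show False by blast
    qed
    then show "\<forall>\<^sub>F t in at_left T. ereal r < ereal (Hk_norm k (\<lambda>z. \<Phi> t z - 1)) + recip_norm (\<Phi> t)"
      using eventually_at_left_real[OF s(1)] by (auto elim!: eventually_mono)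
  qed
qed

theorem theorem2p12:
  fixes n m :: real and k :: nat
  assumes "k \<ge> 1"
  shows "\<exists>T :: real \<Rightarrow> real \<Rightarrow> real \<Rightarrow> real.
    \<forall>(R::real) (\<epsilon>::real) (\<phi>0 :: real \<Rightarrow> real).
      0 < R \<longrightarrow> 0 < \<epsilon> \<longrightarrow> \<epsilon> \<le> 1 \<longrightarrow>
      Hk k (\<lambda>z. \<phi>0 z - 1) \<longrightarrow>
      Hk_norm k (\<lambda>z. \<phi>0 z - 1) < R \<longrightarrow>
      recip_norm \<phi>0 \<le> ereal (1 / (2 * \<epsilon>)) \<longrightarrow>
      (let T0 = T R \<epsilon> (R - Hk_norm k (\<lambda>z. \<phi>0 z - 1)) in
        0 < T0 \<and>
        (\<exists>\<phi> :: real \<Rightarrow> real \<Rightarrow> real.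
          local_solution n m k \<phi>0 (ereal T0) \<phi> \<and>
          solves_evolution_equation n m k (ereal T0) \<phi> \<and>
          (\<forall>t. 0 \<le> t \<and> t < T0 \<longrightarrow>
             (\<forall>z. \<epsilon> \<le> \<phi> t z) \<and> Hk_norm k (\<lambda>z. \<phi> t z - 1) \<le> R) \<and>
          (\<exists>(Tmax :: ereal) (\<Phi> :: real \<Rightarrow> real \<Rightarrow> real).
             0 < Tmax \<and>
             maximal_solution n m k \<phi>0 Tmax \<Phi> \<and>
             (\<forall>t. 0 \<le> t \<and> t < T0 \<longrightarrow> \<Phi> t = \<phi> t) \<and>
             (Tmax < \<infinity> \<longrightarrow>
               ((\<lambda>t. ereal (Hk_norm k (\<lambda>z. \<Phi> t z - 1)) + recip_norm (\<Phi> t)) \<longlongrightarrow> \<infinity>)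
                 (at_left (real_of_ereal Tmax))))))"
proof -
  note k = assms
  interpret ode "velocity_l2 n m k" "inf_value k" "2 * iota_bound k" by (rule ode_velocity_l2[OF k])
  \<comment> \<open>The sign conditions on \<epsilon> and \<gamma> are premises inside P, so that
    some \<tau> exists for all real parameters. The choice of T thereby precedes the initial
    datum.\<close>
  define P where "P R \<epsilon> \<gamma> \<tau> \<longleftrightarrow> (0 < \<epsilon> \<longrightarrow> 0 < \<gamma> \<longrightarrow> 0 < \<tau> \<and>
    (\<forall>e0. Hk_norm k (\<iota> k e0) \<le> R - \<gamma> \<longrightarrow> 2 * \<epsilon> \<le> inf_value k e0 \<longrightarrow>
      (\<exists>x. sol e0 (ereal \<tau>) x \<and> (\<forall>t\<in>{0..<\<tau>}. \<epsilon> \<le> inf_value k (x t) \<and> Hk_norm k (\<iota> k (x t)) \<le> R))))"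
    for R \<epsilon> \<gamma> \<tau> :: real
  have "\<exists>\<tau>. P R \<epsilon> \<gamma> \<tau>" for R \<epsilon> \<gamma>
    unfolding P_def using local_existence_time[OF k, of \<epsilon> \<gamma> R n m] by blast
  then obtain T where T: "\<And>R \<epsilon> \<gamma>. P R \<epsilon> \<gamma> (T R \<epsilon> \<gamma>)" by metis
  show ?thesis
  proof (rule exI[of _ T], intro allI impI, goal_cases)
    case (1 R \<epsilon> \<phi>0)
    then have \<epsilon>: "0 < \<epsilon>" and H: "Hk k (\<lambda>z. \<phi>0 z - 1)" and HR: "Hk_norm k (\<lambda>z. \<phi>0 z - 1) < R"
      and rc: "recip_norm \<phi>0 \<le> ereal (1 / (2 * \<epsilon>))" by auto
    define \<gamma> where "\<gamma> = R - Hk_norm k (\<lambda>z. \<phi>0 z - 1)"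
    have \<gamma>: "0 < \<gamma>" using HR by (simp add: \<gamma>_def)
    define T0 where "T0 = T R \<epsilon> \<gamma>"
    obtain e0 where e0: "AE z in lborel. \<phi>0 z - 1 = \<iota> k e0 z" using iota_surj[OF H] by blast
    have He0: "Hk_norm k (\<iota> k e0) = R - \<gamma>"
      using Hk_cong(2)[OF e0 Hk_L2[OF H] Hk_L2[OF iota_Hk]] by (simp add: \<gamma>_def)
    \<comment> \<open>The factor 2 in the hypothesis on 1/\<phi>0 is the room that the local
      existence time uses to keep \<phi> \<ge> \<epsilon>.\<close>
    have "AE z in lborel. 2 * \<epsilon> \<le> \<bar>1 + \<iota> k e0 z\<bar>"
      using recip_norm_lower_bound[OF rc] \<epsilon> e0 by (auto elim!: eventually_elim2)
    then have d0: "2 * \<epsilon> \<le> inf_value k e0" using \<epsilon> by (intro inf_value_ge_AE[OF k]) auto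
    from T[of R \<epsilon> \<gamma>] \<epsilon> \<gamma> have T0: "0 < T0"
      and ex: "\<exists>x. sol e0 (ereal T0) x \<and> (\<forall>t\<in>{0..<T0}. \<epsilon> \<le> inf_value k (x t) \<and> Hk_norm k (\<iota> k (x t)) \<le> R)"
      using He0 d0 unfolding P_def T0_def by auto
    from ex obtain x where x: "sol e0 (ereal T0) x"
      and bx: "\<And>t. t \<in> {0..<T0} \<Longrightarrow> \<epsilon> \<le> inf_value k (x t) \<and> Hk_norm k (\<iota> k (x t)) \<le> R" by blast
    have life0: "0 < life e0" using d0 \<epsilon> by (intro life_pos) simp
    let ?\<phi> = "\<lambda>t z. 1 + \<iota> k (x t) z" and ?\<Phi> = "\<lambda>t z. 1 + \<iota> k (max_sol e0 t) z"
    have mx: "\<exists>(Tmax :: ereal) (\<Phi> :: real \<Rightarrow> real \<Rightarrow> real).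
             0 < Tmax \<and>
             maximal_solution n m k \<phi>0 Tmax \<Phi> \<and>
             (\<forall>t. 0 \<le> t \<and> t < T0 \<longrightarrow> \<Phi> t = ?\<phi> t) \<and>
             (Tmax < \<infinity> \<longrightarrow>
               ((\<lambda>t. ereal (Hk_norm k (\<lambda>z. \<Phi> t z - 1)) + recip_norm (\<Phi> t)) \<longlongrightarrow> \<infinity>)
                 (at_left (real_of_ereal Tmax)))"
    proof (rule exI[of _ "life e0"], rule exI[of _ ?\<Phi>], intro conjI life0)
      show "maximal_solution n m k \<phi>0 (life e0) ?\<Phi>"
        unfolding maximal_solution_def
      proof (intro conjI allI impI)
        show "local_solution n m k \<phi>0 (life e0) ?\<Phi>" by (rule sol_local_solution(1)[OF k max_sol e0])
        fix S \<phi>' assume "local_solution n m k \<phi>0 S \<phi>'"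
        from local_solution_sol[OF k this e0] obtain y where "sol e0 S y" by blast
        then show "S \<le> life e0" by (rule life_upper)
      qed
      show "\<forall>t. 0 \<le> t \<and> t < T0 \<longrightarrow> ?\<Phi> t = ?\<phi> t"
        using max_sol_eq[OF x] by (simp add: time_interval_ereal)
      show "life e0 < \<infinity> \<longrightarrow> ((\<lambda>t. ereal (Hk_norm k (\<lambda>z. ?\<Phi> t z - 1)) + recip_norm (?\<Phi> t)) \<longlongrightarrow> \<infinity>)
          (at_left (real_of_ereal (life e0)))"
      proof
        assume "life e0 < \<infinity>"
        then obtain S where S: "life e0 = ereal S" using life0 by (cases "life e0") auto
        then have "0 < S" using life0 by simp
        from norm_blow_up[OF k S this] show "((\<lambda>t. ereal (Hk_norm k (\<lambda>z. ?\<Phi> t z - 1)) + recip_norm (?\<Phi> t)) \<longlongrightarrow> \<infinity>)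
          (at_left (real_of_ereal (life e0)))" unfolding S real_of_ereal.simps .
      qed
    qed
    have lo: "\<forall>t. 0 \<le> t \<and> t < T0 \<longrightarrow> (\<forall>z. \<epsilon> \<le> ?\<phi> t z) \<and> Hk_norm k (\<lambda>z. ?\<phi> t z - 1) \<le> R"
      using bx by (simp add: inf_value_ge[OF k])
    show ?case
      unfolding Let_def \<gamma>_def[symmetric] T0_def[symmetric]
      using T0 sol_local_solution[OF k x e0] lo mx by (intro conjI exI[of _ ?\<phi>]) assumption+
  qed
qed

end
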